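(* For every $\alpha>0$, there exist $n$-point metric spaces $(X,d)$ where every scale admits a Euclidean embedding with distortion at most $\alpha$, but the whole space requires Euclidean distortion at least $\Omega(\sqrt{\alpha\log n})$. Consequently, the upper bound $O(\sqrt{\alpha\log n})$ on the Euclidean distortion of $n$-point metric spaces all of whose scales admit Euclidean embeddings with distortion at most $\alpha$ is tight, and this is so for any dependence $\alpha=\alpha(n)=O(\log n)$.
   Context: Every scale of an $n$-point metric space $(X,d)$ admits a Euclidean embedding with distortion at most $\alpha$ means: for every $k\in\mathbb{Z}$ there is a non-expansive map $\phi_k:X\to L_2$ (i.e. $\|\phi_k(x)-\phi_k(y)\|\le d(x,y)$ for all $x,y\in X$) such that $\|\phi_k(x)-\phi_k(y)\|\ge 2^k/\alpha$ for all $x,y\in X$ with $d(x,y)\ge 2^k$. It is known (the scale-gluing lemma of Lee, SODA 2005) that the existence of such a collection $\{\phi_k\}$ yields a Euclidean embedding of $(X,d)$ with distortion $O(\sqrt{\alpha\log n})$. The distortion of an injective map $f:(X,d)\to L_2$ is $\|f\|_{\mathrm{Lip}}\cdot\|f^{-1}\|_{\mathrm{Lip}}$, where $\|f\|_{\mathrm{Lip}}=\sup_{x\ne y}\|f(x)-f(y)\|/d(x,y)$ and $f^{-1}$ is defined on the image of $f$; the whole space requires Euclidean distortion at least $K$ if every injective map of $(X,d)$ into $L_2$ has distortion at least $K$. The notations $O(\cdot)$ and $\Omega(\cdot)$ hide constant factors independent of the parameters.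
   Formalization: "For every α>0" becomes every α>1 (false for α<1), with n large depending on α and the Ω-constant uniform on α≥a for each fixed a>1; "any dependence α(n)=O(log n)" is required to stay above some a>1 eventually, and its constant may depend on the function α(n). *)

theory Defs
  imports "HOL-Analysis.Analysis" "HOL-Library.Landau_Symbols"
begin

(* The Hilbert space L_2 = L_2([0,1]), with square-integrable functions standing for their
   classes modulo equality almost everywhere.  Two elements are equal in L_2 iff their
   L2_dist is 0, so that injectivity into L_2 is positivity of L2_dist (injective_L2). *)
definition L2 :: "(real \<Rightarrow> real) set" where
  "L2 = {f. f \<in> borel_measurable (lebesgue_on {0..1}) \<and>
            integrable (lebesgue_on {0..1}) (\<lambda>t. (f t)\<^sup>2)}"

definition L2_dist :: "(real \<Rightarrow> real) \<Rightarrow> (real \<Rightarrow> real) \<Rightarrow> real" where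
  "L2_dist f g = sqrt (integral\<^sup>L (lebesgue_on {0..1}) (\<lambda>t. (f t - g t)\<^sup>2))"

definition injective_L2 :: "'a set \<Rightarrow> ('a \<Rightarrow> real \<Rightarrow> real) \<Rightarrow> bool" where
  "injective_L2 X f \<longleftrightarrow> (\<forall>x\<in>X. \<forall>y\<in>X. x \<noteq> y \<longrightarrow> L2_dist (f x) (f y) \<noteq> 0)"

(* The supremum is taken in the reals, so this is the Lipschitz constant only where the
   set of quotients is nonempty and bounded, in particular for finite A with two points. *)
definition Lip :: "'a set \<Rightarrow> ('a \<Rightarrow> 'a \<Rightarrow> real) \<Rightarrow> ('b \<Rightarrow> 'b \<Rightarrow> real) \<Rightarrow> ('a \<Rightarrow> 'b) \<Rightarrow> real" where
  "Lip A dA dB f = Sup {dB (f x) (f y) / dA x y | x y. x \<in> A \<and> y \<in> A \<and> x \<noteq> y}"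

definition distortion :: "'a set \<Rightarrow> ('a \<Rightarrow> 'a \<Rightarrow> real) \<Rightarrow> ('a \<Rightarrow> real \<Rightarrow> real) \<Rightarrow> real" where
  "distortion X d f = Lip X d L2_dist f * Lip (f ` X) L2_dist d (inv_into X f)"

definition requires_Euclidean_distortion ::
    "'a set \<Rightarrow> ('a \<Rightarrow> 'a \<Rightarrow> real) \<Rightarrow> real \<Rightarrow> bool" where
  "requires_Euclidean_distortion X d K \<longleftrightarrow>
     (\<forall>f \<in> X \<rightarrow> L2. injective_L2 X f \<longrightarrow> K \<le> distortion X d f)"

definition every_scale_embeds :: "'a set \<Rightarrow> ('a \<Rightarrow> 'a \<Rightarrow> real) \<Rightarrow> real \<Rightarrow> bool" where
  "every_scale_embeds X d \<alpha> \<longleftrightarrow>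
     (\<forall>k::int. \<exists>\<phi> \<in> X \<rightarrow> L2.
        (\<forall>x\<in>X. \<forall>y\<in>X. L2_dist (\<phi> x) (\<phi> y) \<le> d x y) \<and>
        (\<forall>x\<in>X. \<forall>y\<in>X. d x y \<ge> 2 powi k \<longrightarrow> L2_dist (\<phi> x) (\<phi> y) \<ge> 2 powi k / \<alpha>))"

(* Reason for the lower bound on alpha in the main theorem: for alpha <= 1/2 only one-point
   spaces have every scale embedded. *)
lemma every_scale_embeds_imp_gt_half:
  assumes "Metric_space X d" "x \<in> X" "y \<in> X" "x \<noteq> y" "\<alpha> > 0" "every_scale_embeds X d \<alpha>"
  shows "\<alpha> > 1 / 2"
proof -
  have pos: "d x y > 0"
    using assms(1-4) Metric_space.nonneg[of X d x y] Metric_space.zero[of X d x y] by force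
  define k where "k = \<lfloor>log 2 (d x y)\<rfloor>"
  have p: "(2::real) powi j = 2 powr (real_of_int j)" for j :: int
    by (simp add: powr_real_of_int')
  have lo: "2 powi k \<le> d x y"
    unfolding p k_def using pos by (simp add: powr_le_iff le_log_iff[symmetric])
  have "d x y < 2 powr (real_of_int k + 1)"
    unfolding k_def using pos by (simp add: log_less_iff[symmetric])
  then have hi: "d x y < 2 * 2 powi k"
    unfolding p by (simp add: powr_add)
  have "2 powi k / \<alpha> \<le> d x y"
    using assms(2,3,6) lo unfolding every_scale_embeds_def by (meson order_trans)
  then have "2 powi k / \<alpha> < 2 * 2 powi k" using hi by linarith
  then have "2 powi k * 1 < 2 powi k * (2 * \<alpha>)"
    using assms(5) by (simp add: field_simps)
  then show ?thesis by (simp add: mult_less_cancel_left)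
qed

end

theory Submission
  imports Defs
begin

text \<open>Points are pairs of a time \<open>t\<close> and a label \<open>\<sigma>\<close>. For each of \<open>K\<close> levels the label describes a closed
  walk of \<open>T = 4 m\<close> steps on an expanding Cayley graph of \<open>(\<int>/2)\<^sup>m\<close>, and level \<open>k\<close> is run with step length
  \<open>T\<^sup>k\<close>, starting over whenever a step of level \<open>k + 1\<close> is completed. Thus a step of each level is
  subdivided by the walks of the next finer one, as in the recursive products of graphs.

  Lower bound: for \<open>T\<close> increments subdividing a segment, the mean of the squares exceeds the square of
  the mean by their variance, and by the Poincare inequality of the expander the variance is
  proportional to the typical squared distance of two vertices in the same layer, that is to \<open>m\<^sup>2\<close> for
  the word metric. So every level adds a constant multiple of \<open>m\<^sup>2\<close> to the mean squared stretch of
  the shortest steps, which makes the distortion at least of order \<open>m \<surd>K\<close>, while the logarithm of the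
  number of points is of order \<open>m K\<close>.

  Upper bound: two labels at the same time \<open>t\<close> are at an ultrametric distance \<open>u t\<close>, namely the
  largest height at \<open>t\<close> of a tent function around a node where the walks differ. After a small rescaling
  by \<open>\<theta>\<close>, the product of time and ultrametric embeds at each scale with distortion arbitrarily
  close to \<open>1\<close>. This metric (with \<open>m = 1\<close>) covers \<open>\<alpha>\<close> close to \<open>1\<close>; the maximum with the word metric,
  which is larger by a factor \<open>O(m)\<close> only, covers large \<open>\<alpha>\<close>.\<close>

section \<open>Maps into \<open>L\<^sub>2\<close>\<close>

text \<open>The parameters: \<open>m * sqrt K\<close> is the square root of \<open>m\<close> times
  \<open>m * K\<close>, and \<open>m * K\<close> has the order of \<open>ln n\<close>. With
  \<open>m\<close> of order \<alpha> this is the order of \<open>sqrt (\<alpha> * ln n)\<close>, and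
  an \<alpha> of that size pays for the loss O(m) of the word metric at each scale. There is room
  for a level only if \<open>m\<close> is at most of order \<open>ln n\<close>, which is where
  \<alpha> = O(ln n) enters. How small \<theta> must be depends only on how close to 1 the lower
  bound \<open>a\<close> for \<alpha> is. For the gains of the levels to add up, the variance must
  be taken about the segment that is subdivided. Since the walks are closed, the end points of that
  segment do not depend on the label of the finer level; the same linear interpolation is subtracted
  for all of these labels, and the Poincare inequality applies to the rest with this label chosen at
  random. Taking \<open>T\<close> proportional to \<open>m\<close> reconciles two demands:
  \<open>2 * m\<close> unit steps serve to reach and leave an arbitrary group element, and the
  random edges must make up a constant fraction of all steps.\<close>

lemma L2_dist_power2:
  "(L2_dist f g)\<^sup>2 = integral\<^sup>L (lebesgue_on {0..1}) (\<lambda>t. (f t - g t)\<^sup>2)"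
  by (simp add: L2_dist_def)

lemma L2_dist_nonneg: "0 \<le> L2_dist f g"
  by (simp add: L2_dist_def)

lemma L2_diff_square_integrable:
  assumes "f \<in> L2" "g \<in> L2"
  shows "integrable (lebesgue_on {0..1}) (\<lambda>t. (f t - g t)\<^sup>2)"
proof (rule Bochner_Integration.integrable_bound)
  show "integrable (lebesgue_on {0..1}) (\<lambda>t. 2 * (f t)\<^sup>2 + 2 * (g t)\<^sup>2)"
    using assms by (simp add: L2_def)
  have [measurable]: "f \<in> borel_measurable (lebesgue_on {0..1})"
    "g \<in> borel_measurable (lebesgue_on {0..1})"
    using assms by (auto simp: L2_def)
  show "(\<lambda>t. (f t - g t)\<^sup>2) \<in> borel_measurable (lebesgue_on {0..1})"
    by measurable
  have "(a - b)\<^sup>2 \<le> 2 * a\<^sup>2 + 2 * b\<^sup>2" for a b :: real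
    using zero_le_power2[of "a + b"] by (simp add: power2_eq_square algebra_simps)
  then show "AE t in lebesgue_on {0..1}.
      norm ((f t - g t)\<^sup>2) \<le> norm (2 * (f t)\<^sup>2 + 2 * (g t)\<^sup>2)"
    by simp
qed

text \<open>Indicators of \<open>card J\<close> disjoint intervals of equal length, scaled to norm
  1, are orthonormal, so step functions contain an isometric copy of the Euclidean space with
  coordinates in \<open>J\<close>.\<close>

lemma finite_dim_embeds_L2:
  fixes \<phi> :: "'p \<Rightarrow> 'j \<Rightarrow> real"
  assumes "finite J"
  obtains \<psi> where "\<And>p. \<psi> p \<in> L2"
    "\<And>p q. L2_dist (\<psi> p) (\<psi> q) = L2_set (\<lambda>j. \<phi> p j - \<phi> q j) J"
proof -
  define N where "N = card J"
  obtain e where e: "bij_betw e {..<N} J"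
    using assms ex_bij_betw_nat_finite[of J] by (auto simp: N_def atLeast0LessThan)
  define I where "I i = {real i / N..<real (Suc i) / N}" for i
  define \<psi> where "\<psi> p x = (\<Sum>i<N. (sqrt N * \<phi> p (e i)) * indicator (I i) x)" for p x
  \<comment> \<open>At most one indicator is nonzero at \<open>x\<close>, so squaring can be done
    term by term.\<close>
  have sq: "(\<Sum>i<N. c i * indicator (I i) x)\<^sup>2 = (\<Sum>i<N. (c i)\<^sup>2 * indicator (I i) x)"
    for c :: "nat \<Rightarrow> real" and x :: real
  proof (cases "\<exists>i<N. x \<in> I i")
    case True
    then obtain i where i: "i < N" "x \<in> I i" by blast
    have uniq: "j = i" if "j < N" "x \<in> I j" for j
    proof -
      have N: "real N > 0" using i by simp
      have "x * N < real (Suc i)" "x * N \<ge> real i" "x * N < real (Suc j)" "x * N \<ge> real j"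
        using i(2) that(2) N unfolding I_def by (auto simp: field_simps)
      then have "real i < real (Suc j)" "real j < real (Suc i)" by linarith+
      then show ?thesis by linarith
    qed
    have "(\<Sum>j<N. f j * indicator (I j) x) = f i" for f :: "nat \<Rightarrow> real"
    proof -
      have "(\<Sum>j<N. f j * indicator (I j) x) = (\<Sum>j<N. if j = i then f j else 0)"
      proof (intro sum.cong refl)
        fix j assume "j \<in> {..<N}"
        then show "f j * indicator (I j) x = (if j = i then f j else 0)"
          using uniq[of j] i(2) by (cases "x \<in> I j") auto
      qed
      then show ?thesis using i by simp
    qed
    then show ?thesis by simp
  next
    case False
    then have "(\<Sum>j<N. f j * indicator (I j) x) = 0" for f :: "nat \<Rightarrow> real"
      by (intro sum.neutral ballI) (simp add: indicator_def)
    then show ?thesis by simp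
  qed
  have sub: "I i \<subseteq> {0..1}" if "i < N" for i
  proof
    fix x assume "x \<in> I i"
    then have "real i / N \<le> x" "x < real (Suc i) / N" by (auto simp: I_def)
    moreover have "real (Suc i) / N \<le> 1" using that by (simp add: field_simps)
    moreover have "0 \<le> real i / N" by simp
    ultimately show "x \<in> {0..1}" unfolding atLeastAtMost_iff by linarith
  qed
  have meas: "I i \<in> sets (lebesgue_on {0..1})" if "i < N" for i
    using sub[OF that] by (simp add: I_def sets_restrict_space_iff)
  have mI: "measure (lebesgue_on {0..1}) (I i) = 1 / N" if "i < N" for i
  proof -
    have "measure (lebesgue_on {0..1}) (I i) = measure lebesgue (I i)"
      using sub[OF that] by (subst measure_restrict_space) auto
    also have "\<dots> = 1 / N" using that by (simp add: I_def field_simps)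
    finally show ?thesis .
  qed
  have fin: "emeasure (lebesgue_on {0..1}) (I i) < \<infinity>" if "i < N" for i
  proof -
    have "emeasure (lebesgue_on {0..1}) (I i) = emeasure lebesgue (I i)"
      using sub[OF that] by (subst emeasure_restrict_space) auto
    moreover have "real i / N \<le> real (Suc i) / N" by (intro divide_right_mono) auto
    ultimately show ?thesis by (simp add: I_def emeasure_lborel_Ico del: of_nat_Suc)
  qed
  have int: "integrable (lebesgue_on {0..1}) (\<lambda>x. \<Sum>i<N. c i * indicator (I i) x)" for c :: "nat \<Rightarrow> real"
    using meas fin by (intro Bochner_Integration.integrable_sum integrable_mult_right) auto
  have "\<psi> p \<in> L2" for p
    unfolding L2_def mem_Collect_eq \<psi>_def sq
    by (intro conjI int borel_measurable_integrable[OF int])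
  moreover have "L2_dist (\<psi> p) (\<psi> q) = L2_set (\<lambda>j. \<phi> p j - \<phi> q j) J" for p q
  proof -
    let ?c = "\<lambda>i. sqrt N * (\<phi> p (e i) - \<phi> q (e i))"
    have d: "\<psi> p x - \<psi> q x = (\<Sum>i<N. ?c i * indicator (I i) x)" for x
      unfolding \<psi>_def sum_subtractf[symmetric]
      by (intro sum.cong refl) (simp only: right_diff_distrib left_diff_distrib)
    have "integral\<^sup>L (lebesgue_on {0..1}) (\<lambda>x. (\<psi> p x - \<psi> q x)\<^sup>2)
        = (\<Sum>i<N. integral\<^sup>L (lebesgue_on {0..1}) (\<lambda>x. (?c i)\<^sup>2 * indicator (I i) x))"
      unfolding d sq using meas fin
      by (intro Bochner_Integration.integral_sum integrable_mult_right) auto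
    also have "\<dots> = (\<Sum>i<N. (\<phi> p (e i) - \<phi> q (e i))\<^sup>2)"
    proof (intro sum.cong refl)
      fix i assume i: "i \<in> {..<N}"
      have "integral\<^sup>L (lebesgue_on {0..1}) (\<lambda>x. (?c i)\<^sup>2 * indicator (I i) x)
          = (?c i)\<^sup>2 * measure (lebesgue_on {0..1}) (I i \<inter> space (lebesgue_on {0..1}))"
        by simp
      also have "I i \<inter> space (lebesgue_on {0..1}) = I i"
        using sub i by auto
      finally show "integral\<^sup>L (lebesgue_on {0..1}) (\<lambda>x. (?c i)\<^sup>2 * indicator (I i) x)
          = (\<phi> p (e i) - \<phi> q (e i))\<^sup>2"
        using mI[of i] i by (simp only: lessThan_iff) (simp add: power_mult_distrib)
    qed
    also have "\<dots> = (\<Sum>j\<in>J. (\<phi> p j - \<phi> q j)\<^sup>2)"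
      using sum.reindex_bij_betw[OF e] .
    finally show ?thesis by (simp add: L2_dist_def L2_set_def)
  qed
  ultimately show ?thesis using that by blast
qed

text \<open>As \<open>X\<close> is finite, both suprema in \<open>distortion\<close> are genuine
  upper bounds, so they form an admissible pair \<open>A\<close>, \<open>B\<close>. The two distinct
  points make the sets of quotients nonempty, hence the suprema nonnegative.\<close>

lemma requires_Euclidean_distortionI:
  assumes M: "Metric_space X d" and fin: "finite X" and two: "x0 \<in> X" "y0 \<in> X" "x0 \<noteq> y0"
    and bound: "\<And>f A B. \<lbrakk>f \<in> X \<rightarrow> L2; A \<ge> 0; B \<ge> 0;
        \<And>x y. \<lbrakk>x \<in> X; y \<in> X\<rbrakk> \<Longrightarrow> L2_dist (f x) (f y) \<le> A * d x y;
        \<And>x y. \<lbrakk>x \<in> X; y \<in> X\<rbrakk> \<Longrightarrow> d x y \<le> B * L2_dist (f x) (f y)\<rbrakk> \<Longrightarrow> C \<le> A * B"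
  shows "requires_Euclidean_distortion X d C"
  unfolding requires_Euclidean_distortion_def
proof (intro ballI impI)
  fix f assume f: "f \<in> X \<rightarrow> L2" and inj: "injective_L2 X f"
  interpret Metric_space X d by (rule M)
  have d0: "L2_dist g g = 0" for g by (simp add: L2_dist_def)
  have ne: "f x \<noteq> f y" if "x \<in> X" "y \<in> X" "x \<noteq> y" for x y
    using inj that d0 unfolding injective_L2_def by metis
  then have injf: "inj_on f X" by (auto simp: inj_on_def)
  have pos: "L2_dist (f x) (f y) > 0" if "x \<in> X" "y \<in> X" "x \<noteq> y" for x y
    using inj that L2_dist_nonneg[of "f x" "f y"] unfolding injective_L2_def
    by (metis less_eq_real_def)
  have dpos: "d x y > 0" if "x \<in> X" "y \<in> X" "x \<noteq> y" for x y
    using that nonneg[of x y] zero[of x y] by force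
  let ?A = "Lip X d L2_dist f" and ?B = "Lip (f ` X) L2_dist d (inv_into X f)"
  have finA: "finite {L2_dist (f x) (f y) / d x y |x y. x \<in> X \<and> y \<in> X \<and> x \<noteq> y}"
    by (rule finite_subset[of _ "(\<lambda>(x,y). L2_dist (f x) (f y) / d x y) ` (X \<times> X)"])
      (use fin in auto)
  have finB: "finite {d (inv_into X f x) (inv_into X f y) / L2_dist x y |x y.
      x \<in> f ` X \<and> y \<in> f ` X \<and> x \<noteq> y}"
    by (rule finite_subset[of _ "(\<lambda>(x,y). d (inv_into X f x) (inv_into X f y) / L2_dist x y) `
        (f ` X \<times> f ` X)"]) (use fin in auto)
  have A: "L2_dist (f x) (f y) / d x y \<le> ?A" if "x \<in> X" "y \<in> X" "x \<noteq> y" for x y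
    unfolding Lip_def using that finA
    by (intro cSup_upper bdd_above_finite) auto
  have B: "d x y / L2_dist (f x) (f y) \<le> ?B" if "x \<in> X" "y \<in> X" "x \<noteq> y" for x y
  proof -
    have "d (inv_into X f (f x)) (inv_into X f (f y)) / L2_dist (f x) (f y) \<le> ?B"
      unfolding Lip_def using that finB ne
      by (intro cSup_upper bdd_above_finite) blast+
    then show ?thesis using that injf by simp
  qed
  have "?A \<ge> 0" using A[OF two] pos[OF two] dpos[OF two]
    by (meson divide_pos_pos less_eq_real_def order_trans)
  moreover have "?B \<ge> 0" using B[OF two] pos[OF two] dpos[OF two]
    by (meson divide_pos_pos less_eq_real_def order_trans)
  moreover have "L2_dist (f x) (f y) \<le> ?A * d x y" if "x \<in> X" "y \<in> X" for x y
    using A[OF that] dpos[OF that] that by (cases "x = y") (auto simp: d0 field_simps)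
  moreover have "d x y \<le> ?B * L2_dist (f x) (f y)" if "x \<in> X" "y \<in> X" for x y
    using B[OF that] pos[OF that] that by (cases "x = y") (auto simp: d0 field_simps)
  ultimately show "C \<le> distortion X d f"
    unfolding distortion_def using bound f by blast
qed

section \<open>Ultrametrics varying slowly in time\<close>

text \<open>The weight of an element is the increment of the square over its predecessor in
  \<open>insert 0 A\<close>, and the sums telescope. The induction adds the maximum last, which
  leaves the earlier sums unchanged.\<close>

lemma ex_threshold_weights:
  fixes A :: "real set"
  assumes "finite A"
  shows "(\<forall>x\<in>A. 0 < x) \<longrightarrow>
    (\<exists>w. (\<forall>r. 0 \<le> w r) \<and> (\<forall>x\<in>insert 0 A. (\<Sum>r | r \<in> A \<and> r \<le> x. w r) = x\<^sup>2))"
  using assms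
proof (induction rule: finite_linorder_max_induct)
  case empty
  show ?case by (auto intro: exI[of _ "\<lambda>_. 0"])
next
  case (insert b A)
  show ?case
  proof
    assume pos: "\<forall>x\<in>insert b A. 0 < x"
    then obtain w where w: "\<And>r. 0 \<le> w r"
      "\<And>x. x \<in> insert 0 A \<Longrightarrow> (\<Sum>r | r \<in> A \<and> r \<le> x. w r) = x\<^sup>2"
      using insert.IH by (metis insert_iff)
    define M where "M = Max (insert 0 A)"
    have M: "M \<in> insert 0 A" "\<And>x. x \<in> A \<Longrightarrow> x \<le> M" "0 \<le> M"
      using insert.hyps(1) Max_in[of "insert 0 A"] by (auto simp: M_def simp del: Max_insert)
    have Mb: "M < b" using M(1) insert.hyps(2) pos by auto
    have bA: "b \<notin> A" using insert.hyps(2) by auto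
    let ?w = "w(b := b\<^sup>2 - M\<^sup>2)"
    have "0 \<le> ?w r" for r
      using w(1) Mb M(3) by (simp add: power_mono)
    moreover have "(\<Sum>r | r \<in> insert b A \<and> r \<le> x. ?w r) = x\<^sup>2" if x: "x \<in> insert 0 (insert b A)" for x
    proof (cases "x = b")
      case True
      have "{r. r \<in> insert b A \<and> r \<le> x} = insert b {r. r \<in> A \<and> r \<le> M}"
        using True M(2) insert.hyps(2) by force
      moreover have "(\<Sum>r\<in>{r. r \<in> A \<and> r \<le> M}. ?w r) = (\<Sum>r\<in>{r. r \<in> A \<and> r \<le> M}. w r)"
        using bA by (intro sum.cong) auto
      ultimately show ?thesis
        using bA insert.hyps(1) w(2)[OF M(1)] True by simp
    next
      case False
      then have xA: "x \<in> insert 0 A" using x by auto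
      then have "x < b" using insert.hyps(2) pos by auto
      then have "{r. r \<in> insert b A \<and> r \<le> x} = {r. r \<in> A \<and> r \<le> x}" by auto
      moreover have "(\<Sum>r\<in>{r. r \<in> A \<and> r \<le> x}. ?w r) = (\<Sum>r\<in>{r. r \<in> A \<and> r \<le> x}. w r)"
        using bA by (intro sum.cong) auto
      ultimately show ?thesis using w(2)[OF xA] by simp
    qed
    ultimately show "\<exists>w. (\<forall>r. 0 \<le> w r) \<and>
        (\<forall>x\<in>insert 0 (insert b A). (\<Sum>r | r \<in> insert b A \<and> r \<le> x. w r) = x\<^sup>2)"
      by blast
  qed
qed

text \<open>Distinct points may be at distance 0: truncation and \<open>u t\<close> identify
  labels.\<close>

definition ultrametric_on :: "'w set \<Rightarrow> ('w \<Rightarrow> 'w \<Rightarrow> real) \<Rightarrow> bool" where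
  "ultrametric_on \<Omega> u \<longleftrightarrow>
     (\<forall>x\<in>\<Omega>. u x x = 0) \<and> (\<forall>x\<in>\<Omega>. \<forall>y\<in>\<Omega>. 0 \<le> u x y \<and> u x y = u y x) \<and>
     (\<forall>x\<in>\<Omega>. \<forall>y\<in>\<Omega>. \<forall>z\<in>\<Omega>. u x z \<le> max (u x y) (u y z))"

lemma ultrametric_on_mono_comp:
  assumes "ultrametric_on \<Omega> u" "mono_on {0..} f" "f 0 = (0::real)"
  shows "ultrametric_on \<Omega> (\<lambda>x y. f (u x y))"
proof -
  have m: "f a \<le> f b" if "0 \<le> a" "a \<le> b" for a b
    using assms(2) that by (auto simp: mono_on_def)
  have "f (u x z) \<le> max (f (u x y)) (f (u y z))" if "x \<in> \<Omega>" "y \<in> \<Omega>" "z \<in> \<Omega>" for x y z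
  proof -
    have "u x z \<le> u x y \<or> u x z \<le> u y z" "0 \<le> u x z"
      using assms(1) that unfolding ultrametric_on_def le_max_iff_disj by blast+
    then show ?thesis using m by (auto simp: le_max_iff_disj)
  qed
  then show ?thesis
    using assms m[of 0] unfolding ultrametric_on_def by auto
qed

text \<open>The squared distance is decomposed over the thresholds \<open>r\<close> into discrete metrics on the
  classes of the equivalence relation \<open>u x y < r\<close>, each of which is a regular simplex.\<close>

lemma finite_ultrametric_embeds:
  fixes u :: "'w \<Rightarrow> 'w \<Rightarrow> real"
  assumes fin: "finite \<Omega>" and ult: "ultrametric_on \<Omega> u"
    and bd: "\<And>x y. \<lbrakk>x \<in> \<Omega>; y \<in> \<Omega>\<rbrakk> \<Longrightarrow> u x y \<le> R" and "0 \<le> R"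
  obtains J :: "(real \<times> 'w set) set" and \<beta> where "finite J"
    "\<And>x y. \<lbrakk>x \<in> \<Omega>; y \<in> \<Omega>\<rbrakk> \<Longrightarrow> L2_set (\<lambda>j. \<beta> x j - \<beta> y j) J = u x y"
    "\<And>x. x \<in> \<Omega> \<Longrightarrow> L2_set (\<beta> x) J \<le> R"
proof -
  note ult' = ult[unfolded ultrametric_on_def]
  define A where "A = {r. 0 < r \<and> (\<exists>x\<in>\<Omega>. \<exists>y\<in>\<Omega>. u x y = r)}"
  have finA: "finite A"
    by (rule finite_subset[of _ "(\<lambda>(x,y). u x y) ` (\<Omega> \<times> \<Omega>)"]) (use fin in \<open>auto simp: A_def\<close>)
  obtain w where w: "\<And>r. 0 \<le> w r"
      "\<And>x. x \<in> insert 0 A \<Longrightarrow> (\<Sum>r | r \<in> A \<and> r \<le> x. w r) = x\<^sup>2"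
  proof -
    have "\<forall>x\<in>A. 0 < x" by (simp add: A_def)
    with ex_threshold_weights[OF finA] that show ?thesis by meson
  qed
  define cl where "cl x r = {y \<in> \<Omega>. u x y < r}" for x r
  define J where "J = A \<times> Pow \<Omega>"
  \<comment> \<open>Two different vertices of a simplex differ in two coordinates; the factor 1/2
    makes their squared distance \<open>w r\<close>.\<close>
  define \<beta> where "\<beta> x = (\<lambda>(r, C). sqrt (w r / 2) * of_bool (C = cl x r))" for x
  have cl_eq: "cl x r = cl y r \<longleftrightarrow> u x y < r" if xy: "x \<in> \<Omega>" "y \<in> \<Omega>" and r: "r \<in> A" for x y r
  proof
    assume "cl x r = cl y r"
    moreover have "y \<in> cl y r" using xy r ult' by (auto simp: cl_def A_def)
    ultimately show "u x y < r" by (auto simp: cl_def)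
  next
    assume "u x y < r"
    then show "cl x r = cl y r"
      unfolding cl_def using xy ult' by (smt (verit, best) Collect_cong max_def)
  qed
  have clP: "cl x r \<in> Pow \<Omega>" for x r by (auto simp: cl_def)
  have one: "(\<Sum>C\<in>Pow \<Omega>. (\<beta> x (r, C))\<^sup>2) = w r / 2" for x r
  proof -
    have "(\<Sum>C\<in>Pow \<Omega>. (\<beta> x (r, C))\<^sup>2) = (\<Sum>C\<in>Pow \<Omega>. if C = cl x r then w r / 2 else 0)"
      using w(1) by (intro sum.cong) (auto simp: \<beta>_def power_mult_distrib)
    then show ?thesis using fin clP[of x r] by (simp add: sum.delta)
  qed
  have two: "(\<Sum>C\<in>Pow \<Omega>. (\<beta> x (r, C) - \<beta> y (r, C))\<^sup>2) = (if r \<le> u x y then w r else 0)"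
    if xy: "x \<in> \<Omega>" "y \<in> \<Omega>" and r: "r \<in> A" for x y r
  proof (cases "cl x r = cl y r")
    case True
    then show ?thesis using cl_eq[OF xy r] by (simp add: \<beta>_def)
  next
    case False
    have "(\<Sum>C\<in>Pow \<Omega>. (\<beta> x (r, C) - \<beta> y (r, C))\<^sup>2)
        = (\<Sum>C\<in>Pow \<Omega>. (\<beta> x (r, C))\<^sup>2 + (\<beta> y (r, C))\<^sup>2)"
      using False by (intro sum.cong) (auto simp: \<beta>_def)
    then show ?thesis using cl_eq[OF xy r] False by (simp add: sum.distrib one)
  qed
  have "finite J" using finA fin by (simp add: J_def)
  moreover have "L2_set (\<lambda>j. \<beta> x j - \<beta> y j) J = u x y" if xy: "x \<in> \<Omega>" "y \<in> \<Omega>" for x y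
  proof -
    have "(\<Sum>j\<in>J. (\<beta> x j - \<beta> y j)\<^sup>2) = (\<Sum>r\<in>A. \<Sum>C\<in>Pow \<Omega>. (\<beta> x (r, C) - \<beta> y (r, C))\<^sup>2)"
      unfolding J_def by (simp add: sum.cartesian_product case_prod_beta')
    also have "\<dots> = (\<Sum>r\<in>A. if r \<le> u x y then w r else 0)"
      using two[OF xy] by simp
    also have "\<dots> = (\<Sum>r | r \<in> A \<and> r \<le> u x y. w r)"
      using finA by (simp add: sum.inter_filter)
    also have "\<dots> = (u x y)\<^sup>2"
    proof (rule w(2))
      have "0 \<le> u x y" using xy ult' by blast
      then show "u x y \<in> insert 0 A" using xy by (cases "u x y = 0") (auto simp: A_def)
    qed
    finally show ?thesis using xy ult' by (simp add: L2_set_def)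
  qed
  \<comment> \<open>Besides distances, the gluing in time needs a bound on the norms: multiplying by
    a varying cutoff moves a point in proportion to its norm.\<close>
  moreover have "L2_set (\<beta> x) J \<le> R" if "x \<in> \<Omega>" for x
  proof -
    have "(\<Sum>j\<in>J. (\<beta> x j)\<^sup>2) = (\<Sum>r\<in>A. \<Sum>C\<in>Pow \<Omega>. (\<beta> x (r, C))\<^sup>2)"
      unfolding J_def by (simp add: sum.cartesian_product case_prod_beta')
    also have "\<dots> = (\<Sum>r\<in>A. w r) / 2" by (simp add: one sum_divide_distrib)
    also have "\<dots> \<le> R\<^sup>2"
    proof (cases "A = {}")
      case False
      have "Max A \<in> A" using finA False by simp
      moreover have "0 < r" "r \<le> R" if "r \<in> A" for r
        using that bd by (auto simp: A_def)
      ultimately have "(\<Sum>r | r \<in> A \<and> r \<le> Max A. w r) = (Max A)\<^sup>2" "0 < Max A" "Max A \<le> R"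
        using w(2) by auto
      moreover have "{r. r \<in> A \<and> r \<le> Max A} = A" using finA by auto
      ultimately have "(\<Sum>r\<in>A. w r) \<le> R\<^sup>2" by (simp add: power_mono)
      moreover have "0 \<le> (\<Sum>r\<in>A. w r)" using w(1) by (simp add: sum_nonneg)
      ultimately show ?thesis by linarith
    qed simp
    finally show ?thesis using \<open>0 \<le> R\<close> by (simp add: L2_set_def real_le_lsqrt)
  qed
  ultimately show ?thesis using that by blast
qed

section \<open>Gluing embeddings in time by a partition of unity\<close>

lemma abs_cos_diff_le: "\<bar>cos a - cos b\<bar> \<le> \<bar>a - b\<bar>" for a b :: real
proof -
  have "\<bar>cos a - cos b\<bar> = 2 * \<bar>sin ((a + b) / 2)\<bar> * \<bar>sin ((b - a) / 2)\<bar>"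
    by (simp add: cos_diff_cos abs_mult)
  also have "\<dots> \<le> 2 * 1 * \<bar>(b - a) / 2\<bar>"
    by (intro mult_mono abs_sin_x_le_abs_x) auto
  finally show ?thesis by simp
qed

text \<open>Neighbouring cosine bumps form a cosine-sine pair where they overlap, so the squares sum
  to 1. Each bump has Lipschitz constant \<open>pi / 2 / W\<close>, and at most two are nonzero at
  each of two times, that is four in all; the constant \<open>pi\<close> is
  \<open>sqrt 4 * (pi / 2)\<close>.\<close>

lemma lipschitz_square_partition_of_unity:
  fixes W Tm :: real
  assumes W: "0 < W"
  obtains pu :: "nat \<Rightarrow> real \<Rightarrow> real" and M :: nat where
    "\<And>t. \<lbrakk>0 \<le> t; t \<le> Tm\<rbrakk> \<Longrightarrow> (\<Sum>i\<le>M. (pu i t)\<^sup>2) = 1"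
    "\<And>s t. \<lbrakk>0 \<le> s; s \<le> Tm; 0 \<le> t; t \<le> Tm\<rbrakk> \<Longrightarrow>
        L2_set (\<lambda>i. pu i t - pu i s) {..M} \<le> pi * \<bar>t - s\<bar> / W"
    "\<And>i t. pu i t \<noteq> 0 \<Longrightarrow> \<bar>t - i * W\<bar> \<le> W"
proof -
  define pu where "pu i t = cos (pi / 2 * min 1 \<bar>t / W - real i\<bar>)" for i t
  define M where "M = nat \<lceil>Tm / W\<rceil> + 1"
  define n where "n t = nat \<lfloor>t / W\<rfloor>" for t
  have n: "real (n t) \<le> t / W" "t / W < real (n t) + 1" if "0 \<le> t" for t
    using that W by (auto simp: n_def)
  have nM: "n t + 1 \<le> M" if "0 \<le> t" "t \<le> Tm" for t
  proof -
    have "\<lfloor>t / W\<rfloor> \<le> \<lceil>Tm / W\<rceil>"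
      using that W by (meson divide_right_mono floor_le_ceiling floor_mono less_imp_le order_trans)
    then show ?thesis by (simp add: n_def M_def nat_mono)
  qed
  have supp: "\<bar>t / W - real i\<bar> < 1" if "pu i t \<noteq> 0" for i t
    using that by (rule_tac ccontr) (simp add: pu_def min_def)
  have zero: "pu i t = 0" if "0 \<le> t" "i \<notin> {n t, n t + 1}" for i t
  proof (rule ccontr)
    assume "pu i t \<noteq> 0"
    then have "\<bar>t / W - real i\<bar> < 1" by (rule supp)
    then have "real i < real (n t) + 2" "real (n t) < real i + 1" using n[OF that(1)] by linarith+
    then have "i = n t \<or> i = n t + 1" by linarith
    then show False using that by auto
  qed
  have one: "(\<Sum>i\<le>M. (pu i t)\<^sup>2) = 1" if t: "0 \<le> t" "t \<le> Tm" for t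
  proof -
    have "(\<Sum>i\<le>M. (pu i t)\<^sup>2) = (\<Sum>i\<in>{n t, n t + 1}. (pu i t)\<^sup>2)"
      using nM[OF t] zero[OF t(1)] by (intro sum.mono_neutral_right) auto
    also have "\<dots> = (pu (n t) t)\<^sup>2 + (pu (n t + 1) t)\<^sup>2" by simp
    also have "pu (n t) t = cos (pi / 2 * (t / W - n t))"
      using n[OF t(1)] by (simp add: pu_def)
    also have "pu (n t + 1) t = cos (pi / 2 * (1 - (t / W - n t)))"
    proof -
      have "\<bar>t / W - real (n t + 1)\<bar> = 1 - (t / W - n t)" using n[OF t(1)] by simp
      moreover have "min 1 (1 - (t / W - n t)) = 1 - (t / W - n t)" using n[OF t(1)] by simp
      ultimately show ?thesis unfolding pu_def by (simp only:)
    qed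
    also have "\<dots> = sin (pi / 2 * (t / W - n t))"
      by (simp add: right_diff_distrib cos_diff)
    finally show ?thesis by simp
  qed
  have lip1: "\<bar>pu i t - pu i s\<bar> \<le> pi / 2 * (\<bar>t - s\<bar> / W)" for i s t
  proof -
    have "\<bar>pu i t - pu i s\<bar> \<le> \<bar>pi / 2 * min 1 \<bar>t / W - real i\<bar> - pi / 2 * min 1 \<bar>s / W - real i\<bar>\<bar>"
      unfolding pu_def by (rule abs_cos_diff_le)
    also have "\<dots> = pi / 2 * \<bar>min 1 \<bar>t / W - real i\<bar> - min 1 \<bar>s / W - real i\<bar>\<bar>"
      by (simp only: right_diff_distrib[symmetric] abs_mult) simp
    also have "\<dots> \<le> pi / 2 * \<bar>t / W - s / W\<bar>"
      by (intro mult_left_mono) auto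
    also have "\<bar>t / W - s / W\<bar> = \<bar>t - s\<bar> / W"
      using W by (simp add: diff_divide_distrib[symmetric])
    finally show ?thesis .
  qed
  have "L2_set (\<lambda>i. pu i t - pu i s) {..M} \<le> pi * \<bar>t - s\<bar> / W"
    if "0 \<le> s" "s \<le> Tm" "0 \<le> t" "t \<le> Tm" for s t
  proof -
    let ?I = "{n t, n t + 1, n s, n s + 1}"
    have "(\<Sum>i\<le>M. (pu i t - pu i s)\<^sup>2) = (\<Sum>i\<in>?I. (pu i t - pu i s)\<^sup>2)"
    proof (intro sum.mono_neutral_right ballI)
      show "?I \<subseteq> {..M}" using nM[of t] nM[of s] that by auto
      fix i assume "i \<in> {..M} - ?I"
      then have "pu i t = 0" "pu i s = 0" using zero[of t i] zero[of s i] that by auto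
      then show "(pu i t - pu i s)\<^sup>2 = 0" by simp
    qed simp
    also have "\<dots> \<le> (\<Sum>i\<in>?I. (pi / 2 * (\<bar>t - s\<bar> / W))\<^sup>2)"
      using lip1 by (intro sum_mono) (metis abs_ge_zero power2_abs power_mono)
    also have "\<dots> = real (card ?I) * (pi / 2 * (\<bar>t - s\<bar> / W))\<^sup>2" by simp
    also have "\<dots> \<le> 4 * (pi / 2 * (\<bar>t - s\<bar> / W))\<^sup>2"
    proof (intro mult_right_mono)
      have "card ?I \<le> 4" by (simp add: card_insert_if)
      then show "real (card ?I) \<le> 4" by linarith
    qed simp
    also have "\<dots> = (pi * \<bar>t - s\<bar> / W)\<^sup>2" by (simp add: power2_eq_square)
    finally show ?thesis unfolding L2_set_def using W by (intro real_le_lsqrt) auto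
  qed
  moreover have "\<bar>t - real i * W\<bar> \<le> W" if "pu i t \<noteq> 0" for i t
  proof -
    have "\<bar>t / W - real i\<bar> * W \<le> 1 * W"
      using supp[OF that] W by (intro mult_right_mono) auto
    moreover have "\<bar>t / W - real i\<bar> * W = \<bar>t - real i * W\<bar>"
      using W by (simp add: abs_mult_pos left_diff_distrib)
    ultimately show ?thesis by simp
  qed
  ultimately show ?thesis using that one by blast
qed

lemma L2_set_Sigma:
  assumes "finite A" "\<And>i. i \<in> A \<Longrightarrow> finite (B i)"
  shows "L2_set f (Sigma A B) = L2_set (\<lambda>i. L2_set (\<lambda>j. f (i, j)) (B i)) A"
  using assms by (simp add: L2_set_def sum.Sigma sum_nonneg case_prod_beta')

text \<open>The term \<open>\<theta> * \<bar>t - s\<bar>\<close> inside the maximum pays for the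
  change of \<open>u\<close> between the two times in the triangle inequality.\<close>

definition flow_dist :: "real \<Rightarrow> (real \<Rightarrow> 'w \<Rightarrow> 'w \<Rightarrow> real) \<Rightarrow> real \<times> 'w \<Rightarrow> real \<times> 'w \<Rightarrow> real" where
  "flow_dist \<theta> u = (\<lambda>(t, x) (s, y). sqrt ((t - s)\<^sup>2 +
     (max (max (u t x y) (u s x y)) (\<theta> * \<bar>t - s\<bar>))\<^sup>2))"

locale ultrametric_flow =
  fixes \<Omega> :: "'w set" and u :: "real \<Rightarrow> 'w \<Rightarrow> 'w \<Rightarrow> real" and \<theta> :: real
  assumes finite_space: "finite \<Omega>"
    and ultrametric: "ultrametric_on \<Omega> (u t)"
    and time_lipschitz: "\<lbrakk>x \<in> \<Omega>; y \<in> \<Omega>\<rbrakk> \<Longrightarrow> u t x y \<le> u s x y + \<theta> * \<bar>t - s\<bar>"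
    and theta_nonneg: "0 \<le> \<theta>"
begin

text \<open>The ultrametric inequality at time \<open>t\<close> involves \<open>u t y z\<close>,
  which only the second summand can control, and at another time. Moving it to time \<open>s\<close>
  costs \<open>\<theta> * \<bar>t - s\<bar>\<close>, which is contained in the maximum of the first
  summand. So the second coordinates obey the triangle inequality, and Minkowski in the plane
  finishes.\<close>

lemma flow_dist_triangle:
  assumes "x \<in> \<Omega>" "y \<in> \<Omega>" "z \<in> \<Omega>"
  shows "flow_dist \<theta> u (t, x) (r, z) \<le> flow_dist \<theta> u (t, x) (s, y) + flow_dist \<theta> u (s, y) (r, z)"
proof -
  define a b where "a = max (max (u t x y) (u s x y)) (\<theta> * \<bar>t - s\<bar>)"
    and "b = max (max (u s y z) (u r y z)) (\<theta> * \<bar>s - r\<bar>)"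
  let ?c = "max (max (u t x z) (u r x z)) (\<theta> * \<bar>t - r\<bar>)"
  have ab: "u t x y \<le> a" "u s x y \<le> a" "\<theta> * \<bar>t - s\<bar> \<le> a"
    "u s y z \<le> b" "u r y z \<le> b" "\<theta> * \<bar>s - r\<bar> \<le> b"
    by (auto simp: a_def b_def)
  have nn: "0 \<le> u t x y" "0 \<le> u s y z" "0 \<le> u t x z"
    using ultrametric assms unfolding ultrametric_on_def by blast+
  have "u t x z \<le> u t x y \<or> u t x z \<le> u t y z" "u r x z \<le> u r x y \<or> u r x z \<le> u r y z"
    using ultrametric assms unfolding ultrametric_on_def le_max_iff_disj by blast+
  moreover have "u t y z \<le> u s y z + \<theta> * \<bar>t - s\<bar>" "u r x y \<le> u s x y + \<theta> * \<bar>s - r\<bar>"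
    using time_lipschitz[of y z t s] time_lipschitz[of x y r s] assms by (auto simp: abs_minus_commute)
  moreover have "\<theta> * \<bar>t - r\<bar> \<le> \<theta> * \<bar>t - s\<bar> + \<theta> * \<bar>s - r\<bar>"
    using mult_left_mono[OF _ theta_nonneg, of "\<bar>t - r\<bar>" "\<bar>t - s\<bar> + \<bar>s - r\<bar>"]
    by (simp add: distrib_left)
  ultimately have "u t x z \<le> a + b" "u r x z \<le> a + b" "\<theta> * \<bar>t - r\<bar> \<le> a + b"
    using nn ab by linarith+
  then have c: "?c \<le> a + b" by simp
  have "0 \<le> ?c" using nn(3) by (simp add: le_max_iff_disj)
  then have "?c\<^sup>2 \<le> (a + b)\<^sup>2" using c by (rule power_mono[rotated])
  then have "sqrt ((t - r)\<^sup>2 + ?c\<^sup>2) \<le> sqrt (((t - s) + (s - r))\<^sup>2 + (a + b)\<^sup>2)"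
    by simp
  also have "\<dots> \<le> sqrt ((t - s)\<^sup>2 + a\<^sup>2) + sqrt ((s - r)\<^sup>2 + b\<^sup>2)"
    by (rule real_sqrt_sum_squares_triangle_ineq)
  finally show ?thesis unfolding flow_dist_def a_def b_def prod.case .
qed

text \<open>Near scale \<open>R\<close> the space looks like a product of an interval with the ultrametric
  \<open>min R (u t)\<close>, which barely changes over times of length \<open>W = S * R\<close>. The ultrametric is frozen at
  the nodes \<open>i * W\<close>, embedded there isometrically, and the embeddings are glued by a partition of
  unity whose variation over time \<open>R\<close> is of order \<open>1 / S\<close>. Subtracting \<open>\<theta> * W\<close> before truncating
  makes the frozen ultrametric smaller than \<open>u t\<close> at all active times.\<close>

lemma flow_scale_embeds:
  fixes R S Tm :: real
  assumes R: "0 < R" and S: "0 < S"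
  obtains J :: "(nat \<times> real \<times> 'w set) option set" and \<phi> where "finite J"
    "\<And>t s x y. \<lbrakk>0 \<le> t; t \<le> Tm; 0 \<le> s; s \<le> Tm; x \<in> \<Omega>; y \<in> \<Omega>\<rbrakk> \<Longrightarrow>
       L2_set (\<lambda>j. \<phi> (t, x) j - \<phi> (s, y) j) J \<le> flow_dist \<theta> u (t, x) (s, y)"
    "\<And>t s x y. \<lbrakk>0 \<le> t; t \<le> Tm; 0 \<le> s; s \<le> Tm; x \<in> \<Omega>; y \<in> \<Omega>; R \<le> flow_dist \<theta> u (t, x) (s, y)\<rbrakk> \<Longrightarrow>
       R * (1 - \<theta> - 2 * \<theta> * S - pi / S) / (1 + pi / S) \<le> L2_set (\<lambda>j. \<phi> (t, x) j - \<phi> (s, y) j) J"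
proof -
  define W where "W = S * R"
  define \<kappa> where "\<kappa> = pi / S"
  have W: "0 < W" and \<kappa>: "0 < \<kappa>" using R S by (auto simp: W_def \<kappa>_def)
  obtain pu and M :: nat where
    one: "\<And>t. \<lbrakk>0 \<le> t; t \<le> Tm\<rbrakk> \<Longrightarrow> (\<Sum>i\<le>M. (pu i t)\<^sup>2) = 1" and
    lip: "\<And>s t. \<lbrakk>0 \<le> s; s \<le> Tm; 0 \<le> t; t \<le> Tm\<rbrakk> \<Longrightarrow>
        L2_set (\<lambda>i. pu i t - pu i s) {..M} \<le> pi * \<bar>t - s\<bar> / W" and
    supp: "\<And>i t. pu i t \<noteq> 0 \<Longrightarrow> \<bar>t - i * W\<bar> \<le> W"
    using lipschitz_square_partition_of_unity[OF W] by blast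
  define f where "f i x y = min R (max 0 (u (real i * W) x y - \<theta> * W))" for i x y
  have "ultrametric_on \<Omega> (f i)" for i
    unfolding f_def using R theta_nonneg W
    by (intro ultrametric_on_mono_comp[OF ultrametric, of "\<lambda>v. min R (max 0 (v - \<theta> * W))"])
      (auto simp: mono_on_def)
  then have "\<forall>i. \<exists>(J :: (real \<times> 'w set) set) \<beta>. finite J \<and> (\<forall>x\<in>\<Omega>. \<forall>y\<in>\<Omega>. L2_set (\<lambda>j. \<beta> x j - \<beta> y j) J = f i x y) \<and>
      (\<forall>x\<in>\<Omega>. L2_set (\<beta> x) J \<le> R)"
  proof (intro allI)
    fix i assume ult: "\<And>i. ultrametric_on \<Omega> (f i)"
    have "f i x y \<le> R" for x y by (simp add: f_def)
    from finite_ultrametric_embeds[OF finite_space ult this less_imp_le[OF R]]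
    obtain J :: "(real \<times> 'w set) set" and \<beta> where "finite J"
      "\<And>x y. \<lbrakk>x \<in> \<Omega>; y \<in> \<Omega>\<rbrakk> \<Longrightarrow> L2_set (\<lambda>j. \<beta> x j - \<beta> y j) J = f i x y"
      "\<And>x. x \<in> \<Omega> \<Longrightarrow> L2_set (\<beta> x) J \<le> R" by blast
    then show "\<exists>(J :: (real \<times> 'w set) set) \<beta>. finite J \<and> (\<forall>x\<in>\<Omega>. \<forall>y\<in>\<Omega>. L2_set (\<lambda>j. \<beta> x j - \<beta> y j) J = f i x y) \<and>
      (\<forall>x\<in>\<Omega>. L2_set (\<beta> x) J \<le> R)" by blast
  qed
  from choice[OF this] obtain J :: "nat \<Rightarrow> (real \<times> 'w set) set"
    where "\<forall>i. \<exists>\<beta>. finite (J i) \<and>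
      (\<forall>x\<in>\<Omega>. \<forall>y\<in>\<Omega>. L2_set (\<lambda>j. \<beta> x j - \<beta> y j) (J i) = f i x y) \<and>
      (\<forall>x\<in>\<Omega>. L2_set (\<beta> x) (J i) \<le> R)" by blast
  from choice[OF this] obtain \<beta> where J: "\<And>i. finite (J i)"
    and \<beta>: "\<And>i x y. \<lbrakk>x \<in> \<Omega>; y \<in> \<Omega>\<rbrakk> \<Longrightarrow> L2_set (\<lambda>j. \<beta> i x j - \<beta> i y j) (J i) = f i x y"
    and \<beta>R: "\<And>i x. x \<in> \<Omega> \<Longrightarrow> L2_set (\<beta> i x) (J i) \<le> R"
    by blast
  define I where "I = Sigma {..M} J"
  have I: "finite I" using J by (simp add: I_def)
  define K where "K = insert None (Some ` I)"
  \<comment> \<open>The coordinate \<open>None\<close> carries the time. Division by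
    \<open>1 + \<kappa>\<close> compensates for the variation of the partition of unity and makes
    the map non-expansive.\<close>
  define \<phi> where "\<phi> p = (\<lambda>j. case j of None \<Rightarrow> fst p / (1 + \<kappa>)
     | Some (i, k) \<Rightarrow> pu i (fst p) * \<beta> i (snd p) k / (1 + \<kappa>))" for p
  have main: "L2_set (\<lambda>j. \<phi> (t, x) j - \<phi> (s, y) j) K \<le> flow_dist \<theta> u (t, x) (s, y) \<and>
      (R \<le> flow_dist \<theta> u (t, x) (s, y) \<longrightarrow>
         R * (1 - \<theta> - 2 * \<theta> * S - \<kappa>) / (1 + \<kappa>) \<le> L2_set (\<lambda>j. \<phi> (t, x) j - \<phi> (s, y) j) K)"
    if ts: "0 \<le> t" "t \<le> Tm" "0 \<le> s" "s \<le> Tm" and xy: "x \<in> \<Omega>" "y \<in> \<Omega>" for t s x y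
  proof -
    \<comment> \<open>\<open>P\<close> is the change of label with the cutoffs frozen at time
      \<open>t\<close>, \<open>Q\<close> the change of the cutoffs with the label \<open>y\<close>
      fixed; \<open>P + Q\<close> is the whole difference of the spatial coordinates before division
      by \<open>1 + \<kappa>\<close>.\<close>
    define P where "P = (\<lambda>(i, k). pu i t * (\<beta> i x k - \<beta> i y k))"
    define Q where "Q = (\<lambda>(i, k). (pu i t - pu i s) * \<beta> i y k)"
    define z where "z = L2_set (\<lambda>q. P q + Q q) I"
    define d where "d = \<bar>t - s\<bar>"
    define c where "c = min R (u t x y)"
    have ut: "0 \<le> u t x y" "0 \<le> u s x y"
      using ultrametric xy unfolding ultrametric_on_def by blast+
    have c: "0 \<le> c" "c \<le> u t x y" using ut R by (auto simp: c_def)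
    have P: "L2_set P I = L2_set (\<lambda>i. pu i t * f i x y) {..M}"
    proof -
      have "L2_set (\<lambda>k. P (i, k)) (J i) = \<bar>pu i t * f i x y\<bar>" for i
      proof -
        have "(\<Sum>k\<in>J i. (P (i, k))\<^sup>2) = (pu i t)\<^sup>2 * (\<Sum>k\<in>J i. (\<beta> i x k - \<beta> i y k)\<^sup>2)"
          by (simp add: P_def power_mult_distrib sum_distrib_left)
        then have "L2_set (\<lambda>k. P (i, k)) (J i) = \<bar>pu i t\<bar> * L2_set (\<lambda>k. \<beta> i x k - \<beta> i y k) (J i)"
          by (simp add: L2_set_def real_sqrt_mult)
        moreover have "0 \<le> f i x y" using R by (simp add: f_def)
        ultimately show ?thesis using \<beta>[OF xy] by (simp add: abs_mult)
      qed
      then have "L2_set P I = L2_set (\<lambda>i. \<bar>pu i t * f i x y\<bar>) {..M}"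
        unfolding I_def using J by (subst L2_set_Sigma) auto
      then show ?thesis by (simp add: L2_set_def)
    qed
    have sc: "L2_set (\<lambda>i. pu i t * b) {..M} = \<bar>b\<bar>" for b
      using one[OF ts(1,2)] by (simp add: L2_set_def power_mult_distrib sum_distrib_right[symmetric])
    have fb: "f i x y \<le> c \<and> max 0 (c - 2 * \<theta> * W) \<le> f i x y" if "pu i t \<noteq> 0" for i
    proof -
      have "\<theta> * \<bar>t - i * W\<bar> \<le> \<theta> * W" using supp[OF that] theta_nonneg by (intro mult_left_mono)
      then have "u (i * W) x y \<le> u t x y + \<theta> * W" "u t x y \<le> u (i * W) x y + \<theta> * W"
        using time_lipschitz[OF xy, of "i * W" t] time_lipschitz[OF xy, of t "i * W"]
        by (auto simp: abs_minus_commute)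
      moreover have "0 \<le> \<theta> * W" using theta_nonneg W by simp
      moreover have "min R (max 0 (v - q)) \<le> min R w \<and> max 0 (min R w - 2 * q) \<le> min R (max 0 (v - q))"
        if "v \<le> w + q" "w \<le> v + q" "0 \<le> q" "0 \<le> w" for v w q
        using that R by (auto simp: min_def max_def)
      ultimately show ?thesis unfolding f_def c_def mult.assoc using ut(1) by blast
    qed
    have mono: "L2_set (\<lambda>i. pu i t * g i) {..M} \<le> L2_set (\<lambda>i. pu i t * h i) {..M}"
      if "\<And>i. pu i t \<noteq> 0 \<Longrightarrow> 0 \<le> g i \<and> g i \<le> h i" for g h
      unfolding L2_set_def
    proof (intro real_sqrt_le_mono sum_mono)
      fix i
      show "(pu i t * g i)\<^sup>2 \<le> (pu i t * h i)\<^sup>2"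
        using that[of i] by (cases "pu i t = 0") (auto simp: power_mult_distrib intro!: mult_left_mono power_mono)
    qed
    have P_le: "L2_set P I \<le> c"
      unfolding P using mono[of "\<lambda>i. f i x y" "\<lambda>_. c"] fb sc[of c] c by auto
    have P_ge: "c - 2 * \<theta> * W \<le> L2_set P I"
      unfolding P using mono[of "\<lambda>_. max 0 (c - 2 * \<theta> * W)" "\<lambda>i. f i x y"] fb
        sc[of "max 0 (c - 2 * \<theta> * W)"] by auto
    have Q_le: "L2_set Q I \<le> \<kappa> * d"
    proof -
      have "L2_set (\<lambda>k. Q (i, k)) (J i) = \<bar>pu i t - pu i s\<bar> * L2_set (\<beta> i y) (J i)" for i
      proof -
        have "(\<Sum>k\<in>J i. (Q (i, k))\<^sup>2) = (pu i t - pu i s)\<^sup>2 * (\<Sum>k\<in>J i. (\<beta> i y k)\<^sup>2)"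
          by (simp add: Q_def power_mult_distrib sum_distrib_left)
        then show ?thesis by (simp add: L2_set_def real_sqrt_mult)
      qed
      then have "L2_set Q I = L2_set (\<lambda>i. \<bar>pu i t - pu i s\<bar> * L2_set (\<beta> i y) (J i)) {..M}"
        unfolding I_def using J by (subst L2_set_Sigma) auto
      also have "\<dots> \<le> L2_set (\<lambda>i. \<bar>pu i t - pu i s\<bar> * R) {..M}"
        using \<beta>R[OF xy(2)] by (intro L2_set_mono mult_left_mono) auto
      also have "\<dots> = R * L2_set (\<lambda>i. pu i t - pu i s) {..M}"
        using R by (simp add: L2_set_def power_mult_distrib sum_distrib_right[symmetric] real_sqrt_mult)
      also have "\<dots> \<le> R * (pi * \<bar>t - s\<bar> / W)"
        using R lip[OF ts(3,4,1,2)] by (intro mult_left_mono) auto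
      also have "\<dots> = \<kappa> * d" using R by (simp add: W_def \<kappa>_def d_def)
      finally show ?thesis .
    qed
    have z_le: "z \<le> c + \<kappa> * d"
      using L2_set_triangle_ineq[of P Q I] P_le Q_le by (simp add: z_def)
    have z_ge: "c - 2 * \<theta> * W - \<kappa> * d \<le> z"
    proof -
      have "L2_set P I \<le> L2_set (\<lambda>q. P q + Q q) I + L2_set (\<lambda>q. - Q q) I"
        using L2_set_triangle_ineq[of "\<lambda>q. P q + Q q" "\<lambda>q. - Q q" I] by simp
      moreover have "L2_set (\<lambda>q. - Q q) I = L2_set Q I" by (simp add: L2_set_def)
      ultimately show ?thesis using P_ge Q_le by (simp add: z_def)
    qed
    have z0: "0 \<le> z" by (simp add: z_def)
    have L: "L2_set (\<lambda>j. \<phi> (t, x) j - \<phi> (s, y) j) K = sqrt (d\<^sup>2 + z\<^sup>2) / (1 + \<kappa>)"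
    proof -
      have "\<phi> (t, x) (Some q) - \<phi> (s, y) (Some q) = (P q + Q q) / (1 + \<kappa>)" for q
        by (cases q) (simp add: \<phi>_def P_def Q_def diff_divide_distrib add_divide_distrib algebra_simps)
      then have "(\<Sum>j\<in>K. (\<phi> (t, x) j - \<phi> (s, y) j)\<^sup>2)
          = ((t - s) / (1 + \<kappa>))\<^sup>2 + (\<Sum>q\<in>I. ((P q + Q q) / (1 + \<kappa>))\<^sup>2)"
        unfolding K_def using I
        by (simp add: sum.reindex \<phi>_def[of "(_, _)"] diff_divide_distrib image_iff)
      also have "\<dots> = (d\<^sup>2 + z\<^sup>2) / (1 + \<kappa>)\<^sup>2"
      proof -
        have "(\<Sum>q\<in>I. ((P q + Q q) / (1 + \<kappa>))\<^sup>2) = z\<^sup>2 / (1 + \<kappa>)\<^sup>2"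
          unfolding power_divide sum_divide_distrib[symmetric]
          by (simp add: z_def L2_set_def sum_nonneg)
        then show ?thesis by (simp add: d_def power_divide add_divide_distrib)
      qed
      finally show ?thesis using \<kappa> by (simp add: L2_set_def real_sqrt_divide)
    qed
    define \<rho> where "\<rho> = max (max (u t x y) (u s x y)) (\<theta> * \<bar>t - s\<bar>)"
    define D where "D = flow_dist \<theta> u (t, x) (s, y)"
    have D: "D = sqrt (d\<^sup>2 + \<rho>\<^sup>2)" by (simp add: D_def flow_dist_def \<rho>_def d_def)
    have d0: "0 \<le> d" "d \<le> D" by (auto simp: d_def D real_le_rsqrt)
    \<comment> \<open>Minkowski in the plane: an error \<open>b\<close> in the spatial coordinate
      costs at most \<open>b\<close>.\<close>
    have shift: "sqrt (d\<^sup>2 + (a + b)\<^sup>2) \<le> sqrt (d\<^sup>2 + a\<^sup>2) + b" if "0 \<le> b" for a b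
      using real_sqrt_sum_squares_triangle_ineq[of d 0 a b] that by simp
    have "sqrt (d\<^sup>2 + z\<^sup>2) \<le> sqrt (d\<^sup>2 + (c + \<kappa> * d)\<^sup>2)"
      using z_le z0 by (intro real_sqrt_le_mono add_left_mono power_mono) auto
    also have "\<dots> \<le> sqrt (d\<^sup>2 + c\<^sup>2) + \<kappa> * d" using shift \<kappa> d0 by simp
    also have "sqrt (d\<^sup>2 + c\<^sup>2) \<le> D"
      unfolding D using c by (intro real_sqrt_le_mono add_left_mono power_mono) (auto simp: \<rho>_def)
    also have "\<kappa> * d \<le> \<kappa> * D" using d0 \<kappa> by (intro mult_left_mono) auto
    finally have up: "sqrt (d\<^sup>2 + z\<^sup>2) \<le> (1 + \<kappa>) * D" by (simp add: algebra_simps)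
    have low: "R * (1 - \<theta> - 2 * \<theta> * S - \<kappa>) \<le> sqrt (d\<^sup>2 + z\<^sup>2)" if RD: "R \<le> D"
    proof (cases "R \<le> d")
      case True
      have "0 \<le> 2 * \<theta> * S" using S theta_nonneg by simp
      then have "R * (1 - \<theta> - 2 * \<theta> * S - \<kappa>) \<le> R * 1"
        using R \<kappa> theta_nonneg by (intro mult_left_mono) linarith+
      also have "R * 1 \<le> sqrt (d\<^sup>2 + z\<^sup>2)" using True R by (simp add: real_le_rsqrt power_mono add_increasing2)
      finally show ?thesis .
    next
      case False
      define e where "e = 2 * \<theta> * W + \<kappa> * d"
      have th: "\<theta> * d \<le> \<theta> * R" using False theta_nonneg by (intro mult_left_mono) auto
      have "\<kappa> * d \<le> \<kappa> * R" using False \<kappa> by (intro mult_left_mono) auto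
      then have e: "e \<le> R * (2 * \<theta> * S + \<kappa>)" "0 \<le> e"
        using \<kappa> d0 theta_nonneg W by (simp_all add: e_def W_def algebra_simps R S less_imp_le)
      have ze: "c \<le> z + e" using z_ge by (simp add: e_def)
      have *: "sqrt (d\<^sup>2 + c\<^sup>2) \<le> sqrt (d\<^sup>2 + z\<^sup>2) + e"
      proof -
        have "sqrt (d\<^sup>2 + c\<^sup>2) \<le> sqrt (d\<^sup>2 + (z + e)\<^sup>2)"
          using ze c by (intro real_sqrt_le_mono add_left_mono power_mono) auto
        also have "\<dots> \<le> sqrt (d\<^sup>2 + z\<^sup>2) + e" by (rule shift[OF e(2)])
        finally show ?thesis .
      qed
      \<comment> \<open>If \<open>u t x y\<close> reaches \<open>R\<close>, the truncated value
        \<open>c = R\<close> suffices alone. Otherwise nothing is truncated, and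
        \<open>\<rho>\<close> exceeds \<open>u t x y\<close> by at most \<open>\<theta> * R\<close>,
        since the times differ by less than \<open>R\<close>.\<close>
      have "R \<le> sqrt (d\<^sup>2 + c\<^sup>2) + \<theta> * R"
      proof (cases "R \<le> u t x y")
        case True
        then have "R \<le> sqrt (d\<^sup>2 + c\<^sup>2)" using R by (simp add: c_def real_le_rsqrt)
        moreover have "0 \<le> \<theta> * R" using theta_nonneg R by simp
        ultimately show ?thesis by linarith
      next
        case False
        then have cu: "c = u t x y" by (simp add: c_def)
        have "\<rho> \<le> c + \<theta> * R"
          using time_lipschitz[OF xy, of s t] th c ut theta_nonneg R
          by (auto simp: \<rho>_def cu d_def abs_minus_commute intro: order_trans)
        then have "D \<le> sqrt (d\<^sup>2 + (c + \<theta> * R)\<^sup>2)"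
          unfolding D using ut by (intro real_sqrt_le_mono add_left_mono power_mono) (auto simp: \<rho>_def)
        also have "\<dots> \<le> sqrt (d\<^sup>2 + c\<^sup>2) + \<theta> * R" using theta_nonneg R by (intro shift) simp
        finally show ?thesis using RD by simp
      qed
      then show ?thesis using * e(1) by (simp add: algebra_simps)
    qed
    have "0 < 1 + \<kappa>" using \<kappa> by simp
    then show ?thesis
      using up low unfolding L D_def[symmetric]
      by (auto simp: pos_divide_le_eq mult.commute intro!: divide_right_mono)
  qed
  have "finite K" using I by (simp add: K_def)
  then show ?thesis using that main unfolding \<kappa>_def by blast
qed

end

section \<open>Expanding Cayley graphs of elementary abelian 2-groups\<close>

text \<open>The characters of the group of finite sets under symmetric difference.\<close>

definition walsh :: "nat set \<Rightarrow> nat set \<Rightarrow> real" where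
  "walsh w v = (-1) ^ card (w \<inter> v)"

lemma walsh_commute: "walsh w v = walsh v w"
  by (simp add: walsh_def Int_commute)

lemma walsh_cases: "walsh w v = 1 \<or> walsh w v = -1"
  by (simp add: walsh_def uminus_power_if)

lemma walsh_empty [simp]: "walsh {} v = 1" "walsh w {} = 1"
  by (simp_all add: walsh_def)

lemma card_sym_diff:
  assumes "finite A" "finite B"
  shows "card (sym_diff A B) + 2 * card (A \<inter> B) = card A + card B"
proof -
  have "card (sym_diff A B) = card (A - B) + card (B - A)"
    using assms by (intro card_Un_disjoint) auto
  moreover have "card A = card (A - B) + card (A \<inter> B)"
    using assms(1) by (metis card_Int_Diff add.commute)
  moreover have "card B = card (B - A) + card (A \<inter> B)"
    using assms(2) by (metis card_Int_Diff add.commute Int_commute)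
  ultimately show ?thesis by simp
qed

lemma walsh_sym_diff:
  assumes "finite w"
  shows "walsh w (sym_diff v v') = walsh w v * walsh w v'"
proof -
  have "card (w \<inter> sym_diff v v') + 2 * card (w \<inter> v \<inter> (w \<inter> v')) = card (w \<inter> v) + card (w \<inter> v')"
  proof -
    have "w \<inter> sym_diff v v' = sym_diff (w \<inter> v) (w \<inter> v')" by auto
    then show ?thesis using card_sym_diff[of "w \<inter> v" "w \<inter> v'"] assms by simp
  qed
  then have "(-1 :: real) ^ (card (w \<inter> sym_diff v v') + 2 * card (w \<inter> v \<inter> (w \<inter> v')))
      = (-1) ^ (card (w \<inter> v) + card (w \<inter> v'))" by simp
  then show ?thesis by (simp add: walsh_def power_add power_mult)
qed

lemma sum_sym_diff_shift:
  assumes "g \<subseteq> U"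
  shows "(\<Sum>v\<in>Pow U. f (sym_diff v g)) = (\<Sum>v\<in>Pow U. f v)"
  by (rule sum.reindex_bij_witness[of _ "\<lambda>v. sym_diff v g" "\<lambda>v. sym_diff v g"]) (use assms in auto)

text \<open>Translation by an element of \<open>w\<close> flips the sign of every term.\<close>

lemma sum_walsh:
  assumes "finite U" "w \<subseteq> U"
  shows "(\<Sum>v\<in>Pow U. walsh w v) = (if w = {} then 2 ^ card U else 0)"
proof (cases "w = {}")
  case True
  then show ?thesis using assms by (simp add: card_Pow)
next
  case False
  then obtain l where l: "l \<in> w" by auto
  have fw: "finite w" using assms finite_subset by blast
  have "(\<Sum>v\<in>Pow U. walsh w v) = (\<Sum>v\<in>Pow U. walsh w (sym_diff v {l}))"
    using sum_sym_diff_shift[of "{l}" U "walsh w"] l assms by auto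
  also have "\<dots> = (\<Sum>v\<in>Pow U. - walsh w v)"
    using l fw by (simp add: walsh_sym_diff) (simp add: walsh_def)
  finally show ?thesis using False by (simp add: sum_negf)
qed

lemma sum_walsh_second:
  assumes "finite U" "v \<subseteq> U"
  shows "(\<Sum>w\<in>Pow U. walsh w v) = (if v = {} then 2 ^ card U else 0)"
  using sum_walsh[OF assms] by (simp add: walsh_commute)

lemma walsh_parseval:
  assumes U: "finite U"
  shows "(\<Sum>w\<in>Pow U. (\<Sum>v\<in>Pow U. h v * walsh w v)\<^sup>2) = 2 ^ card U * (\<Sum>v\<in>Pow U. (h v)\<^sup>2)"
proof -
  have "(\<Sum>w\<in>Pow U. (\<Sum>v\<in>Pow U. h v * walsh w v)\<^sup>2)
      = (\<Sum>w\<in>Pow U. \<Sum>v\<in>Pow U. \<Sum>v'\<in>Pow U. h v * h v' * walsh w (sym_diff v v'))"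
    unfolding power2_eq_square sum_product
    using finite_subset[OF _ U] by (intro sum.cong refl) (simp add: walsh_sym_diff)
  also have "\<dots> = (\<Sum>v\<in>Pow U. \<Sum>v'\<in>Pow U. \<Sum>w\<in>Pow U. h v * h v' * walsh w (sym_diff v v'))"
    by (subst sum.swap, rule sum.cong[OF refl], rule sum.swap)
  also have "\<dots> = (\<Sum>v\<in>Pow U. \<Sum>v'\<in>Pow U. if v' = v then 2 ^ card U * (h v)\<^sup>2 else 0)"
  proof (intro sum.cong refl)
    fix v v' assume v: "v \<in> Pow U" "v' \<in> Pow U"
    then have "(\<Sum>w\<in>Pow U. walsh w (sym_diff v v')) = (if sym_diff v v' = {} then 2 ^ card U else 0)"
      by (intro sum_walsh_second U) auto
    moreover have "sym_diff v v' = {} \<longleftrightarrow> v' = v" by auto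
    ultimately show "(\<Sum>w\<in>Pow U. h v * h v' * walsh w (sym_diff v v'))
        = (if v' = v then 2 ^ card U * (h v)\<^sup>2 else 0)"
      by (simp add: sum_distrib_left[symmetric] power2_eq_square)
  qed
  also have "\<dots> = 2 ^ card U * (\<Sum>v\<in>Pow U. (h v)\<^sup>2)"
    using U by (simp add: sum_distrib_left)
  finally show ?thesis .
qed

lemma sum_square_differences:
  fixes h :: "'a \<Rightarrow> real"
  shows "(\<Sum>x\<in>A. \<Sum>y\<in>A. (h x - h y)\<^sup>2) = 2 * (card A * (\<Sum>x\<in>A. (h x)\<^sup>2) - (\<Sum>x\<in>A. h x)\<^sup>2)"
proof -
  have "(\<Sum>x\<in>A. \<Sum>y\<in>A. (h x - h y)\<^sup>2)
      = (\<Sum>x\<in>A. \<Sum>y\<in>A. (h x)\<^sup>2) + (\<Sum>x\<in>A. \<Sum>y\<in>A. (h y)\<^sup>2) - 2 * (\<Sum>x\<in>A. \<Sum>y\<in>A. h x * h y)"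
    by (simp add: power2_diff sum.distrib sum_subtractf sum_distrib_left mult.assoc)
  also have "(\<Sum>x\<in>A. \<Sum>y\<in>A. h x * h y) = (\<Sum>x\<in>A. h x)\<^sup>2"
    by (simp add: power2_eq_square sum_product)
  finally show ?thesis by (simp add: sum_distrib_left)
qed

text \<open>The Walsh transform diagonalises translations: a difference along \<open>s c\<close>
  multiplies the coefficient at \<open>w\<close> by \<open>1 - walsh w (s c)\<close>, which is 0 or
  2. Hence the coefficient at \<open>w\<close> is counted, with factor 4, once for each generator on
  which the character is -1, so \<mu> plays the role of a spectral gap.\<close>

lemma walsh_poincare:
  fixes s :: "nat \<Rightarrow> nat set" and h :: "nat set \<Rightarrow> real" and \<mu> :: real
  assumes U: "finite U" and s: "\<And>c. s c \<subseteq> U"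
    and spec: "\<And>w. \<lbrakk>w \<subseteq> U; w \<noteq> {}\<rbrakk> \<Longrightarrow> \<mu> \<le> card {c\<in>{..<q}. walsh w (s c) = -1}"
  shows "2 * \<mu> * (\<Sum>v\<in>Pow U. \<Sum>v'\<in>Pow U. (h v - h v')\<^sup>2)
    \<le> 2 ^ card U * (\<Sum>c<q. \<Sum>v\<in>Pow U. (h v - h (sym_diff v (s c)))\<^sup>2)"
proof -
  define H where "H w = (\<Sum>v\<in>Pow U. h v * walsh w v)" for w
  have fw: "finite w" if "w \<subseteq> U" for w using that U finite_subset by blast
  have shift: "(\<Sum>v\<in>Pow U. (h v - h (sym_diff v (s c))) * walsh w v) = (1 - walsh w (s c)) * H w"
    if w: "w \<subseteq> U" for w c
  proof -
    have "(\<Sum>v\<in>Pow U. h (sym_diff v (s c)) * walsh w v)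
        = (\<Sum>v\<in>Pow U. h v * walsh w (sym_diff v (s c)))"
      by (rule sum.reindex_bij_witness[of _ "\<lambda>v. sym_diff v (s c)" "\<lambda>v. sym_diff v (s c)"])
        (use s[of c] in \<open>auto intro!: arg_cong2[where f="(*)"] arg_cong[where f="walsh w"]\<close>)
    also have "\<dots> = walsh w (s c) * H w"
      by (simp add: walsh_sym_diff[OF fw[OF w]] H_def sum_distrib_left mult_ac)
    finally show ?thesis by (simp add: H_def left_diff_distrib sum_subtractf)
  qed
  have L: "(\<Sum>v\<in>Pow U. \<Sum>v'\<in>Pow U. (h v - h v')\<^sup>2) = 2 * (\<Sum>w\<in>Pow U - {{}}. (H w)\<^sup>2)"
  proof -
    have "(\<Sum>w\<in>Pow U. (H w)\<^sup>2) = (H {})\<^sup>2 + (\<Sum>w\<in>Pow U - {{}}. (H w)\<^sup>2)"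
      using U by (intro sum.remove) auto
    moreover have "H {} = (\<Sum>v\<in>Pow U. h v)" by (simp add: H_def)
    ultimately show ?thesis
      using walsh_parseval[OF U, of h] U
      by (simp add: sum_square_differences card_Pow H_def)
  qed
  have "2 ^ card U * (\<Sum>c<q. \<Sum>v\<in>Pow U. (h v - h (sym_diff v (s c)))\<^sup>2)
      = (\<Sum>c<q. \<Sum>w\<in>Pow U. ((1 - walsh w (s c)) * H w)\<^sup>2)"
    unfolding sum_distrib_left[of "2 ^ card U"]
    using walsh_parseval[OF U, of "\<lambda>v. h v - h (sym_diff v (s _))"] shift
    by (simp add: sum_distrib_left)
  also have "\<dots> = (\<Sum>w\<in>Pow U. \<Sum>c<q. ((1 - walsh w (s c)) * H w)\<^sup>2)"
    by (rule sum.swap)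
  also have "\<dots> = (\<Sum>w\<in>Pow U. 4 * card {c\<in>{..<q}. walsh w (s c) = -1} * (H w)\<^sup>2)"
  proof (intro sum.cong refl)
    fix w
    have "((1 - walsh w (s c)) * H w)\<^sup>2 = (if walsh w (s c) = -1 then 4 * (H w)\<^sup>2 else 0)" for c
      using walsh_cases[of w "s c"] by (auto simp: power_mult_distrib)
    then have "(\<Sum>c<q. ((1 - walsh w (s c)) * H w)\<^sup>2)
        = (\<Sum>c | c \<in> {..<q} \<and> walsh w (s c) = -1. 4 * (H w)\<^sup>2)"
      by (simp only: sum.inter_filter[OF finite_lessThan])
    then show "(\<Sum>c<q. ((1 - walsh w (s c)) * H w)\<^sup>2)
        = 4 * card {c\<in>{..<q}. walsh w (s c) = -1} * (H w)\<^sup>2" by simp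
  qed
  also have "\<dots> \<ge> (\<Sum>w\<in>Pow U - {{}}. 4 * card {c\<in>{..<q}. walsh w (s c) = -1} * (H w)\<^sup>2)"
    using U by (intro sum_mono2) auto
  moreover have "(\<Sum>w\<in>Pow U - {{}}. 4 * card {c\<in>{..<q}. walsh w (s c) = -1} * (H w)\<^sup>2)
      \<ge> (\<Sum>w\<in>Pow U - {{}}. 4 * \<mu> * (H w)\<^sup>2)"
    using spec by (intro sum_mono mult_right_mono mult_left_mono) auto
  ultimately show ?thesis
    unfolding L by (simp add: sum_distrib_left[symmetric] mult.assoc)
qed

text \<open>Making the walk lazy turns the one-layer inequality into one for two consecutive layers
  carrying unrelated functions.\<close>

lemma lazy_walk_poincare:
  fixes s :: "nat \<Rightarrow> nat set" and P Q :: "nat set \<Rightarrow> real" and \<mu> :: real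
  assumes U: "finite U" and s: "\<And>c. s c \<subseteq> U" and lazy: "\<And>c. q \<le> c \<Longrightarrow> s c = {}"
    and spec: "\<And>w. \<lbrakk>w \<subseteq> U; w \<noteq> {}\<rbrakk> \<Longrightarrow> \<mu> \<le> card {c\<in>{..<q}. walsh w (s c) = -1}"
  shows "\<mu> / 2 ^ card U * (\<Sum>v\<in>Pow U. \<Sum>v'\<in>Pow U. (P v - P v')\<^sup>2)
    \<le> (\<Sum>c<2 * q. \<Sum>v\<in>Pow U. (P v - Q (sym_diff v (s c)))\<^sup>2)"
proof -
  \<comment> \<open>A step inside the layer of \<open>P\<close> is replaced by a random step into
    the layer of \<open>Q\<close> and a lazy step back.\<close>
  have "(P v - P (sym_diff v (s c)))\<^sup>2
      \<le> 2 * (P v - Q (sym_diff v (s c)))\<^sup>2 + 2 * (P (sym_diff v (s c)) - Q (sym_diff v (s c)))\<^sup>2" for v c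
  proof -
    have "(a - b)\<^sup>2 \<le> 2 * (a - d)\<^sup>2 + 2 * (b - d)\<^sup>2" for a b d :: real
      using zero_le_power2[of "a + b - 2 * d"] by (simp add: power2_eq_square algebra_simps)
    then show ?thesis .
  qed
  then have "(\<Sum>c<q. \<Sum>v\<in>Pow U. (P v - P (sym_diff v (s c)))\<^sup>2)
      \<le> (\<Sum>c<q. \<Sum>v\<in>Pow U. 2 * (P v - Q (sym_diff v (s c)))\<^sup>2
          + 2 * (P (sym_diff v (s c)) - Q (sym_diff v (s c)))\<^sup>2)"
    by (intro sum_mono)
  also have "\<dots> = 2 * (\<Sum>c<q. \<Sum>v\<in>Pow U. (P v - Q (sym_diff v (s c)))\<^sup>2)
      + 2 * (\<Sum>c<q. \<Sum>v\<in>Pow U. (P (sym_diff v (s c)) - Q (sym_diff v (s c)))\<^sup>2)"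
    by (simp add: sum.distrib sum_distrib_left)
  also have "(\<Sum>c<q. \<Sum>v\<in>Pow U. (P (sym_diff v (s c)) - Q (sym_diff v (s c)))\<^sup>2)
      = (\<Sum>c<q. \<Sum>v\<in>Pow U. (P v - Q v)\<^sup>2)"
    by (rule sum.cong[OF refl], rule sum_sym_diff_shift[OF s, of "\<lambda>v. (P v - Q v)\<^sup>2"])
  \<comment> \<open>The return steps are exactly the terms of the lazy indices, so both halves
    together give the sum over all \<open>2 * q\<close> indices.\<close>
  also have "\<dots> = (\<Sum>c\<in>{q..<2 * q}. \<Sum>v\<in>Pow U. (P v - Q (sym_diff v (s c)))\<^sup>2)"
    using lazy by simp
  finally have "(\<Sum>c<q. \<Sum>v\<in>Pow U. (P v - P (sym_diff v (s c)))\<^sup>2)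
      \<le> 2 * ((\<Sum>c<q. \<Sum>v\<in>Pow U. (P v - Q (sym_diff v (s c)))\<^sup>2)
        + (\<Sum>c\<in>{q..<2 * q}. \<Sum>v\<in>Pow U. (P v - Q (sym_diff v (s c)))\<^sup>2))"
    by simp
  also have "(\<Sum>c<q. \<Sum>v\<in>Pow U. (P v - Q (sym_diff v (s c)))\<^sup>2)
        + (\<Sum>c\<in>{q..<2 * q}. \<Sum>v\<in>Pow U. (P v - Q (sym_diff v (s c)))\<^sup>2)
      = (\<Sum>c<2 * q. \<Sum>v\<in>Pow U. (P v - Q (sym_diff v (s c)))\<^sup>2)"
    using sum.atLeastLessThan_concat[of 0 q "2 * q" "\<lambda>c. \<Sum>v\<in>Pow U. (P v - Q (sym_diff v (s c)))\<^sup>2"]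
    by (simp add: atLeast0LessThan)
  finally have "2 ^ card U * (\<Sum>c<q. \<Sum>v\<in>Pow U. (P v - P (sym_diff v (s c)))\<^sup>2)
      \<le> 2 ^ card U * (2 * (\<Sum>c<2 * q. \<Sum>v\<in>Pow U. (P v - Q (sym_diff v (s c)))\<^sup>2))"
    by (intro mult_left_mono) auto
  with walsh_poincare[where h = P, OF U s spec]
  have "2 * \<mu> * (\<Sum>v\<in>Pow U. \<Sum>v'\<in>Pow U. (P v - P v')\<^sup>2)
      \<le> 2 ^ card U * (2 * (\<Sum>c<2 * q. \<Sum>v\<in>Pow U. (P v - Q (sym_diff v (s c)))\<^sup>2))"
    by (meson order_trans)
  then show ?thesis by (simp add: field_simps)
qed

text \<open>The generators form a linear code of relative distance at least \<open>1 / 8\<close>; they are chosen one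
  at a time so as not to exceed the average of an exponential moment.\<close>

lemma ex_expanding_generators:
  assumes m: "0 < m"
  obtains g :: "nat \<Rightarrow> nat set" where "\<And>c. g c \<subseteq> {..<m}"
    "\<And>w. \<lbrakk>w \<subseteq> {..<m}; w \<noteq> {}\<rbrakk> \<Longrightarrow> real m / 2 \<le> card {c\<in>{..<4 * m}. walsh w (g c) = -1}"
proof -
  define N where "N g q w = card {c\<in>{..<q}. walsh w (g c) = -1}" for g :: "nat \<Rightarrow> nat set" and q w
  let ?V = "Pow {..<m}"
  have "\<exists>g. (\<forall>c. g c \<subseteq> {..<m}) \<and> (\<Sum>w\<in>?V - {{}}. (1/4 :: real) ^ N g q w) \<le> 2 ^ m * (5/8) ^ q" for q
  proof (induction q)
    case 0
    have "real (card (?V - {{}})) \<le> card ?V"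
      by (intro of_nat_mono card_mono) auto
    then have "(\<forall>c. (\<lambda>_. {}) c \<subseteq> {..<m}) \<and> (\<Sum>w\<in>?V - {{}}. (1/4 :: real) ^ N (\<lambda>_. {}) 0 w) \<le> 2 ^ m * (5/8) ^ 0"
      by (simp add: N_def card_Pow)
    then show ?case by (rule exI[of _ "\<lambda>_. {}"])
  next
    case (Suc q)
    then obtain g where g: "\<And>c. g c \<subseteq> {..<m}"
      and le: "(\<Sum>w\<in>?V - {{}}. (1/4 :: real) ^ N g q w) \<le> 2 ^ m * (5/8) ^ q" by blast
    \<comment> \<open>The factor \<open>5/8 + 3/8 * walsh w x\<close> is 1 or 1/4 according to the
      sign of the character, and averages to 5/8 over \<open>x\<close> because the nontrivial
      character sums to 0.\<close>
    define F where "F x = (\<Sum>w\<in>?V - {{}}. (1/4) ^ N g q w * (5/8 + 3/8 * walsh w x))" for x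
    have "(\<Sum>x\<in>?V. F x) = (\<Sum>w\<in>?V - {{}}. \<Sum>x\<in>?V. (1/4) ^ N g q w * (5/8 + 3/8 * walsh w x))"
      unfolding F_def by (rule sum.swap)
    also have "\<dots> = (\<Sum>w\<in>?V - {{}}. 2 ^ m * ((1/4) ^ N g q w * (5/8)))"
    proof (intro sum.cong refl)
      fix w assume "w \<in> ?V - {{}}"
      then have "(\<Sum>x\<in>?V. walsh w x) = 0" using sum_walsh[of "{..<m}" w] by auto
      then have "(\<Sum>x\<in>?V. 3/8 * walsh w x) = 0" by (subst sum_distrib_left[symmetric]) simp
      then show "(\<Sum>x\<in>?V. (1/4) ^ N g q w * (5/8 + 3/8 * walsh w x)) = 2 ^ m * ((1/4) ^ N g q w * (5/8))"
        by (simp add: sum_distrib_left[symmetric] sum.distrib card_Pow)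
    qed
    also have "\<dots> = 2 ^ m * (5/8 * (\<Sum>w\<in>?V - {{}}. (1/4) ^ N g q w))"
      by (simp add: sum_distrib_left mult_ac)
    also have "\<dots> \<le> 2 ^ m * (5/8 * (2 ^ m * (5/8) ^ q))"
      using le by (intro mult_left_mono) auto
    also have "\<dots> = (\<Sum>x\<in>?V. 2 ^ m * (5/8) ^ Suc q)" by (simp add: card_Pow)
    finally have "\<exists>x\<in>?V. F x \<le> 2 ^ m * (5/8) ^ Suc q"
      using sum_strict_mono[of ?V "\<lambda>_. 2 ^ m * (5/8) ^ Suc q" F] by (auto simp: not_le[symmetric])
    then obtain x where x: "x \<subseteq> {..<m}" "F x \<le> 2 ^ m * (5/8) ^ Suc q" by auto
    have "(1/4 :: real) ^ N (g(q := x)) (Suc q) w = (1/4) ^ N g q w * (5/8 + 3/8 * walsh w x)" for w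
    proof -
      have "{c\<in>{..<Suc q}. walsh w ((g(q := x)) c) = -1}
          = {c\<in>{..<q}. walsh w (g c) = -1} \<union> (if walsh w x = -1 then {q} else {})"
        by (auto simp: less_Suc_eq split: if_splits)
      then have "N (g(q := x)) (Suc q) w = N g q w + (if walsh w x = -1 then 1 else 0)"
        unfolding N_def by (simp add: card_insert_if)
      then show ?thesis using walsh_cases[of w x] by auto
    qed
    then have "(\<Sum>w\<in>?V - {{}}. (1/4 :: real) ^ N (g(q := x)) (Suc q) w) \<le> 2 ^ m * (5/8) ^ Suc q"
      using x(2) by (simp add: F_def)
    moreover have "\<forall>c. (g(q := x)) c \<subseteq> {..<m}" using g x(1) by simp
    ultimately show ?case by blast
  qed
  then obtain g where g: "\<And>c. g c \<subseteq> {..<m}"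
    and le: "(\<Sum>w\<in>?V - {{}}. (1/4 :: real) ^ N g (4 * m) w) \<le> 2 ^ m * (5/8) ^ (4 * m)" by blast
  have "real m / 2 \<le> N g (4 * m) w" if w: "w \<subseteq> {..<m}" "w \<noteq> {}" for w
  proof (rule ccontr)
    \<comment> \<open>A single bad \<open>w\<close> would contribute at least
      \<open>(1/2) ^ m\<close>, more than the bound for the whole sum, as
      \<open>2 * (5/8) ^ 4\<close> is about 0.31.\<close>
    assume "\<not> ?thesis"
    then have "2 * N g (4 * m) w \<le> m" by linarith
    then have "(1/2 :: real) ^ m \<le> (1/2) ^ (2 * N g (4 * m) w)" by (intro power_decreasing) auto
    also have "\<dots> = (1/4) ^ N g (4 * m) w" by (simp add: power_mult power2_eq_square)
    also have "\<dots> \<le> (\<Sum>w\<in>?V - {{}}. (1/4 :: real) ^ N g (4 * m) w)"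
      using w by (intro member_le_sum) auto
    also have "\<dots> \<le> 2 ^ m * (5/8) ^ (4 * m)" by (rule le)
    also have "\<dots> = (2 * (5/8) ^ 4) ^ m" by (simp add: power_mult power_mult_distrib)
    also have "\<dots> < (1/2 :: real) ^ m"
      using m by (intro power_strict_mono) (auto simp: power_def)
    finally show False by simp
  qed
  then show ?thesis using that g unfolding N_def by blast
qed

text \<open>The sum modulo 2 of the vectors \<open>e c\<close> for \<open>c\<close> in
  \<open>A\<close>.\<close>

definition span_sum :: "('c \<Rightarrow> nat set) \<Rightarrow> 'c set \<Rightarrow> nat set" where
  "span_sum e A = {l. odd (card {c\<in>A. l \<in> e c})}"

text \<open>Word length over the generators \<open>e c\<close>: in a group of exponent 2 repeated
  letters cancel, so sets of indices represent all words. The value is meaningful only for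
  \<open>v\<close> in the span.\<close>

definition word_norm :: "(nat \<Rightarrow> nat set) \<Rightarrow> nat \<Rightarrow> nat set \<Rightarrow> nat" where
  "word_norm e q v = (LEAST n. \<exists>A\<subseteq>{..<q}. card A = n \<and> span_sum e A = v)"

lemma span_sum_sym_diff:
  assumes "finite A" "finite B"
  shows "span_sum e (sym_diff A B) = sym_diff (span_sum e A) (span_sum e B)"
proof -
  have "odd (card {c \<in> sym_diff A B. l \<in> e c}) \<longleftrightarrow>
      odd (card {c\<in>A. l \<in> e c}) \<noteq> odd (card {c\<in>B. l \<in> e c})" for l
  proof -
    have "{c \<in> sym_diff A B. l \<in> e c} = sym_diff {c\<in>A. l \<in> e c} {c\<in>B. l \<in> e c}" by auto
    with card_sym_diff[of "{c\<in>A. l \<in> e c}" "{c\<in>B. l \<in> e c}"] assms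
    have "card {c \<in> sym_diff A B. l \<in> e c} + 2 * card ({c\<in>A. l \<in> e c} \<inter> {c\<in>B. l \<in> e c})
        = card {c\<in>A. l \<in> e c} + card {c\<in>B. l \<in> e c}" by simp
    then show ?thesis by presburger
  qed
  then show ?thesis by (auto simp: span_sum_def)
qed

lemma word_norm_span_sum_le:
  "A \<subseteq> {..<q} \<Longrightarrow> word_norm e q (span_sum e A) \<le> card A"
  unfolding word_norm_def by (rule Least_le) auto

lemma word_norm_attained:
  assumes "v \<in> span_sum e ` Pow {..<q}"
  obtains A where "A \<subseteq> {..<q}" "card A = word_norm e q v" "span_sum e A = v"
proof -
  have "\<exists>n. \<exists>A\<subseteq>{..<q}. card A = n \<and> span_sum e A = v" using assms by auto
  from LeastI_ex[OF this] show ?thesis using that unfolding word_norm_def by blast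
qed

lemma word_norm_sym_diff_le:
  assumes "v \<in> span_sum e ` Pow {..<q}" "v' \<in> span_sum e ` Pow {..<q}"
  shows "word_norm e q (sym_diff v v') \<le> word_norm e q v + word_norm e q v'"
proof -
  obtain A where A: "A \<subseteq> {..<q}" "card A = word_norm e q v" "span_sum e A = v"
    using word_norm_attained[OF assms(1)] .
  obtain B where B: "B \<subseteq> {..<q}" "card B = word_norm e q v'" "span_sum e B = v'"
    using word_norm_attained[OF assms(2)] .
  have fin: "finite A" "finite B" using A(1) B(1) finite_subset by blast+
  have "word_norm e q (sym_diff v v') \<le> card (sym_diff A B)"
    using word_norm_span_sum_le[of "sym_diff A B" q e] A B fin by (auto simp: span_sum_sym_diff)
  also have "\<dots> \<le> card A + card B" using card_sym_diff[OF fin] by simp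
  finally show ?thesis using A(2) B(2) by simp
qed

lemma span_sum_empty [simp]: "span_sum e {} = {}"
  by (simp add: span_sum_def)

lemma span_sum_singleton: "span_sum e {c} = e c"
proof -
  have "{c'\<in>{c}. l \<in> e c'} = (if l \<in> e c then {c} else {})" for l by auto
  then show ?thesis by (auto simp: span_sum_def)
qed

lemma word_norm_empty [simp]: "word_norm e q {} = 0"
  using word_norm_span_sum_le[of "{}" q e] by simp

lemma word_norm_generator_le: "c < q \<Longrightarrow> word_norm e q (e c) \<le> 1"
  using word_norm_span_sum_le[of "{c}" q e] by (simp add: span_sum_singleton)

text \<open>Markov's inequality for the weight \<open>(1/16) ^ card A\<close>, whose sum over all
  subsets is the product of \<open>q\<close> factors \<open>1 + 1/16\<close>.\<close>

lemma card_small_subsets_le: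
  "real (card {A. A \<subseteq> {..<q} \<and> card A \<le> r}) \<le> 16 ^ r * (17/16) ^ q"
proof -
  have "(\<Sum>A\<in>Pow {..<q}. (1/16 :: real) ^ card A) = (17/16) ^ q"
    using prod_add[of "{..<q}" "\<lambda>_. 1/16 :: real" "\<lambda>_. 1"] by simp
  moreover have "(\<Sum>A | A \<subseteq> {..<q} \<and> card A \<le> r. (1/16 :: real) ^ r)
      \<le> (\<Sum>A | A \<subseteq> {..<q} \<and> card A \<le> r. (1/16) ^ card A)"
    by (intro sum_mono power_decreasing) auto
  moreover have "\<dots> \<le> (\<Sum>A\<in>Pow {..<q}. (1/16 :: real) ^ card A)"
    by (intro sum_mono2) auto
  ultimately have "real (card {A. A \<subseteq> {..<q} \<and> card A \<le> r}) * (1/16) ^ r \<le> (17/16) ^ q"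
    by simp
  then show ?thesis by (simp add: power_one_over field_simps)
qed

lemma card_word_norm_ball_le:
  assumes "V \<subseteq> span_sum e ` Pow {..<q}"
  shows "real (card {v\<in>V. word_norm e q v \<le> r}) \<le> 16 ^ r * (17/16) ^ q"
proof -
  have "{v\<in>V. word_norm e q v \<le> r} \<subseteq> span_sum e ` {A. A \<subseteq> {..<q} \<and> card A \<le> r}"
  proof
    fix v assume v: "v \<in> {v\<in>V. word_norm e q v \<le> r}"
    then obtain A where "A \<subseteq> {..<q}" "card A = word_norm e q v" "span_sum e A = v"
      using assms word_norm_attained[of v e q] by blast
    then show "v \<in> span_sum e ` {A. A \<subseteq> {..<q} \<and> card A \<le> r}" using v by auto
  qed
  moreover have "finite {A. A \<subseteq> {..<q} \<and> card A \<le> r}"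
    by (rule finite_subset[of _ "Pow {..<q}"]) auto
  ultimately have "card {v\<in>V. word_norm e q v \<le> r} \<le> card {A. A \<subseteq> {..<q} \<and> card A \<le> r}"
    by (meson card_image_le card_mono finite_imageI order_trans)
  then show ?thesis using card_small_subsets_le[of q r] by linarith
qed

text \<open>The ball of radius \<open>m div 16\<close> contains at most half of the group, as there
  are too few short words. The other half has norm at least \<open>m / 16\<close>, and 512 is 2
  times the square of 16.\<close>

lemma sum_word_norm_ge:
  assumes m: "0 < m" and rep: "Pow {..<m} \<subseteq> span_sum e ` Pow {..<5 * m}"
  shows "2 ^ m * (real m)\<^sup>2 / 512 \<le> (\<Sum>v\<in>Pow {..<m}. (real (word_norm e (5 * m) v))\<^sup>2)"
proof -
  define r where "r = m div 16"
  let ?N = "word_norm e (5 * m)" and ?V = "Pow {..<m}"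
  have count: "2 * card {v\<in>?V. ?N v \<le> r} \<le> 2 ^ m"
  proof (cases "4 \<le> m")
    case True
    \<comment> \<open>The fourth power turns \<open>16 ^ r\<close> into \<open>2 ^ (16 * r)\<close>,
      at most \<open>2 ^ m\<close>, while the other factor becomes at most \<open>4 ^ m\<close>.
      Their product \<open>2 ^ (3 * m)\<close> is below the fourth power of half the group order
      precisely from \<open>m = 4\<close> on.\<close>
    have "real (card {v\<in>?V. ?N v \<le> r}) ^ 4 \<le> (16 ^ r * (17/16) ^ (5 * m)) ^ 4"
      by (intro power_mono card_word_norm_ball_le rep) auto
    also have "\<dots> = 2 ^ (16 * r) * (((17/16) ^ 10) ^ 2) ^ m"
    proof -
      have "(16 :: real) ^ r = 2 ^ (4 * r)" by (simp add: power_mult)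
      then have "(16 ^ r * c ^ (5 * m)) ^ 4 = 2 ^ (16 * r) * ((c ^ 10) ^ 2) ^ m" for c :: real
        by (simp add: power_mult_distrib power_mult[symmetric] mult.commute)
      then show ?thesis .
    qed
    also have "\<dots> \<le> 2 ^ m * (2 ^ 2) ^ m"
    proof (intro mult_mono power_mono power_increasing)
      show "16 * r \<le> m" by (simp add: r_def)
      show "(17/16 :: real) ^ 10 \<le> 2" by (simp add: power_divide)
    qed auto
    also have "\<dots> = 2 ^ (3 * m)" by (simp add: power_mult power_mult_distrib[symmetric])
    also have "\<dots> \<le> 2 ^ (4 * (m - 1))" using True by (intro power_increasing) auto
    also have "\<dots> = (2 ^ (m - 1)) ^ 4" by (simp add: power_mult[symmetric] mult.commute)
    finally have "real (card {v\<in>?V. ?N v \<le> r}) \<le> 2 ^ (m - 1)"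
      by (rule power_mono_iff[THEN iffD1, rotated -1]) auto
    then have "real (2 * card {v\<in>?V. ?N v \<le> r}) \<le> 2 * 2 ^ (m - 1)" by simp
    also have "\<dots> = real (2 ^ m)" using m by (cases m) simp_all
    finally show ?thesis by (simp only: of_nat_le_iff)
  next
    case False
    \<comment> \<open>For small \<open>m\<close> the ball has radius 0 and contains only the neutral
      element.\<close>
    then have r: "r = 0" by (simp add: r_def)
    have "{v\<in>?V. ?N v \<le> r} \<subseteq> {{}}"
    proof
      fix v assume v: "v \<in> {v\<in>?V. ?N v \<le> r}"
      then obtain A where A: "A \<subseteq> {..<5 * m}" "card A = ?N v" "span_sum e A = v"
        using rep word_norm_attained[of v e "5 * m"] by blast
      then have "A = {}" using v r finite_subset[OF A(1)] by simp
      then show "v \<in> {{}}" using A(3) by simp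
    qed
    then have "card {v\<in>?V. ?N v \<le> r} \<le> card {{} :: nat set}" by (rule card_mono[rotated]) simp
    then have "card {v\<in>?V. ?N v \<le> r} \<le> 1" by simp
    moreover have "2 \<le> (2 ^ m :: nat)" using m by (cases m) auto
    ultimately show ?thesis by linarith
  qed
  have split: "2 ^ m = card {v\<in>?V. ?N v \<le> r} + card {v\<in>?V. \<not> ?N v \<le> r}"
  proof -
    have "card ?V = card ({v\<in>?V. ?N v \<le> r} \<union> {v\<in>?V. \<not> ?N v \<le> r})"
      by (intro arg_cong[where f = card]) auto
    also have "\<dots> = card {v\<in>?V. ?N v \<le> r} + card {v\<in>?V. \<not> ?N v \<le> r}"
      by (intro card_Un_disjoint) auto
    finally show ?thesis by (simp add: card_Pow)
  qed
  with count have "2 ^ m \<le> 2 * card {v\<in>?V. \<not> ?N v \<le> r}" by simp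
  then have "real (2 ^ m) \<le> real (2 * card {v\<in>?V. \<not> ?N v \<le> r})" by (simp only: of_nat_le_iff)
  then have big: "2 ^ m / 2 \<le> real (card {v\<in>?V. \<not> ?N v \<le> r})" by simp
  have mr: "real m / 16 \<le> real (r + 1)" by (simp add: r_def)
  have "2 ^ m * (real m)\<^sup>2 / 512 = 2 ^ m / 2 * (real m / 16)\<^sup>2" by (simp add: power_divide)
  also have "\<dots> \<le> real (card {v\<in>?V. \<not> ?N v \<le> r}) * (real (r + 1))\<^sup>2"
    using big mr by (intro mult_mono power_mono) auto
  also have "\<dots> = (\<Sum>v | v \<in> ?V \<and> \<not> ?N v \<le> r. (real (r + 1))\<^sup>2)" by simp
  also have "\<dots> \<le> (\<Sum>v | v \<in> ?V \<and> \<not> ?N v \<le> r. (real (?N v))\<^sup>2)"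
    by (intro sum_mono power_mono) auto
  also have "\<dots> \<le> (\<Sum>v\<in>?V. (real (?N v))\<^sup>2)"
    by (intro sum_mono2) auto
  finally show ?thesis .
qed

section \<open>The recursive construction\<close>

locale gadget =
  fixes m K :: nat and g :: "nat \<Rightarrow> nat set"
  assumes m_pos: "0 < m" and gen_sub: "g c \<subseteq> {..<m}"
    and expanding: "\<lbrakk>w \<subseteq> {..<m}; w \<noteq> {}\<rbrakk> \<Longrightarrow> real m / 2 \<le> card {c\<in>{..<4 * m}. walsh w (g c) = -1}"
begin

definition T :: nat where "T = 4 * m"

definition V :: "nat set set" where "V = Pow {..<m}"

text \<open>The group \<open>(\<int>/2)\<^sup>m\<close> is represented by \<open>Pow {..<m}\<close> with symmetric difference. The indices
  \<open>c \<ge> 4 * m\<close> are lazy steps; all labels use \<open>c < 8 * m\<close>, so that half of the steps are lazy.\<close>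

definition step :: "nat \<Rightarrow> nat set" where "step c = (if c < 4 * m then g c else {})"

text \<open>Singletons count as generators for the word norm because the walks \<open>pos\<close> below use them.\<close>

definition norm_gen :: "nat \<Rightarrow> nat set" where
  "norm_gen c = (if c < 4 * m then g c else {c - 4 * m})"

definition nrm :: "nat set \<Rightarrow> real" where "nrm v = word_norm norm_gen (5 * m) v"

text \<open>The closed walk of the label \<open>(v, c)\<close> builds \<open>v\<close> one coordinate at a time, goes back and forth
  between \<open>v\<close> and \<open>v + step c\<close> during \<open>2 * m\<close> steps, and dismantles \<open>v\<close> again. In its middle part every
  pair of successive positions is a uniformly random edge if \<open>(v, c)\<close> is uniformly random.\<close>

definition pos :: "nat set \<times> nat \<Rightarrow> nat \<Rightarrow> nat set" where
  "pos a i = (if i \<le> m then fst a \<inter> {..<i}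
     else if i \<le> 3 * m then (if even (i - m) then fst a else sym_diff (fst a) (step (snd a)))
     else fst a \<inter> {..<4 * m - i})"

definition labels :: "(nat set \<times> nat) set" where "labels = V \<times> {..<8 * m}"

definition \<Omega> :: "(nat \<Rightarrow> nat set \<times> nat) set" where "\<Omega> = PiE {..<K} (\<lambda>_. labels)"

text \<open>All walks stop at time \<open>T ^ K\<close>. As all labels are identified from then on, each further time adds
  exactly one point, which allows every large cardinality.\<close>

definition val :: "nat \<Rightarrow> nat \<Rightarrow> (nat \<Rightarrow> nat set \<times> nat) \<Rightarrow> nat set" where
  "val k n \<sigma> = (if n < T ^ (K - k) then pos (\<sigma> k) (n mod T) else {})"

text \<open>Height and half-width are both \<open>T ^ k\<close>. The slope 1 makes \<open>u\<close>
  Lipschitz in time. At a node of level \<open>k\<close> all other tents of this level vanish, and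
  at any time at most two are positive, which keeps the number of distinct points small.\<close>

definition hat :: "nat \<Rightarrow> nat \<Rightarrow> real \<Rightarrow> real" where
  "hat k n t = max 0 (real (T ^ k) - \<bar>t - real (n * T ^ k)\<bar>)"

text \<open>The last multiple \<open>T ^ (K - k)\<close> is left out because \<open>val\<close> is
  empty there for all labels.\<close>

definition nodes :: "(nat \<times> nat) set" where "nodes = Sigma {..<K} (\<lambda>k. {..<T ^ (K - k)})"

definition u :: "real \<Rightarrow> (nat \<Rightarrow> nat set \<times> nat) \<Rightarrow> (nat \<Rightarrow> nat set \<times> nat) \<Rightarrow> real" where
  "u t \<sigma> \<sigma>' = Max (insert 0 ((\<lambda>(k, n). if val k n \<sigma> \<noteq> val k n \<sigma>' then hat k n t else 0) ` nodes))"

text \<open>Distances to a fixed group element, interpolated linearly in time, so that \<open>word_dist\<close> is a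
  pseudometric without any further argument.\<close>

definition word_coord :: "nat \<Rightarrow> nat set \<Rightarrow> nat \<Rightarrow> (nat \<Rightarrow> nat set \<times> nat) \<Rightarrow> real" where
  "word_coord k x t \<sigma> = real (T ^ k - t mod T ^ k) * nrm (sym_diff (val k (t div T ^ k) \<sigma>) x)
     + real (t mod T ^ k) * nrm (sym_diff (val k (t div T ^ k + 1) \<sigma>) x)"

definition word_dist :: "nat \<times> (nat \<Rightarrow> nat set \<times> nat) \<Rightarrow> nat \<times> (nat \<Rightarrow> nat set \<times> nat) \<Rightarrow> real" where
  "word_dist = (\<lambda>(t, \<sigma>) (s, \<sigma>'). Max (insert 0
     ((\<lambda>(k, x). \<bar>word_coord k x t \<sigma> - word_coord k x s \<sigma>'\<bar>) ` ({..<K} \<times> V))))"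

lemma T_pos: "0 < T" using m_pos by (simp add: T_def)

lemma finite_V: "finite V" and card_V: "card V = 2 ^ m"
  by (simp_all add: V_def card_Pow)

lemma finite_labels: "finite labels" and card_labels: "card labels = 2 ^ m * (8 * m)"
  by (simp_all add: labels_def finite_V card_V card_cartesian_product)

lemma finite_\<Omega>: "finite \<Omega>"
  by (simp add: \<Omega>_def finite_PiE finite_labels)

lemma \<Omega>_nonempty: "\<Omega> \<noteq> {}"
  using m_pos by (auto simp: \<Omega>_def PiE_eq_empty_iff labels_def V_def lessThan_empty_iff)

lemma fun_upd_\<Omega>: "\<lbrakk>\<sigma> \<in> \<Omega>; k < K; a \<in> labels\<rbrakk> \<Longrightarrow> \<sigma>(k := a) \<in> \<Omega>"
  by (auto simp: \<Omega>_def PiE_iff extensional_def)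

lemma \<Omega>_labels: "\<lbrakk>\<sigma> \<in> \<Omega>; k < K\<rbrakk> \<Longrightarrow> \<sigma> k \<in> labels"
  by (auto simp: \<Omega>_def)

lemma finite_nodes: "finite nodes"
  by (simp add: nodes_def)

section \<open>The ultrametrics \<open>u t\<close> on the labels\<close>

lemma u_le_iff: "u t \<sigma> \<sigma>' \<le> c \<longleftrightarrow>
    0 \<le> c \<and> (\<forall>k n. (k, n) \<in> nodes \<longrightarrow> val k n \<sigma> \<noteq> val k n \<sigma>' \<longrightarrow> hat k n t \<le> c)"
proof -
  have "u t \<sigma> \<sigma>' \<le> c \<longleftrightarrow> 0 \<le> c \<and>
      (\<forall>p\<in>nodes. (if val (fst p) (snd p) \<sigma> \<noteq> val (fst p) (snd p) \<sigma>' then hat (fst p) (snd p) t else 0) \<le> c)"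
    unfolding u_def using finite_nodes by (subst Max_le_iff) (auto simp: case_prod_beta')
  also have "\<dots> \<longleftrightarrow> 0 \<le> c \<and>
      (\<forall>k n. (k, n) \<in> nodes \<longrightarrow> val k n \<sigma> \<noteq> val k n \<sigma>' \<longrightarrow> hat k n t \<le> c)"
  proof (intro conj_cong refl iffI allI impI ballI)
    fix k n assume "0 \<le> c" and kn: "(k, n) \<in> nodes" "val k n \<sigma> \<noteq> val k n \<sigma>'"
      and "\<forall>p\<in>nodes. (if val (fst p) (snd p) \<sigma> \<noteq> val (fst p) (snd p) \<sigma>' then hat (fst p) (snd p) t else 0) \<le> c"
    from bspec[OF this(4) kn(1)] kn(2) show "hat k n t \<le> c" by simp
  next
    fix p assume "0 \<le> c" and "p \<in> nodes"
      and "\<forall>k n. (k, n) \<in> nodes \<longrightarrow> val k n \<sigma> \<noteq> val k n \<sigma>' \<longrightarrow> hat k n t \<le> c"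
    then show "(if val (fst p) (snd p) \<sigma> \<noteq> val (fst p) (snd p) \<sigma>' then hat (fst p) (snd p) t else 0) \<le> c"
      by simp
  qed
  finally show ?thesis .
qed

lemma u_nonneg: "0 \<le> u t \<sigma> \<sigma>'"
  using u_le_iff[of t \<sigma> \<sigma>' "u t \<sigma> \<sigma>'"] by blast

lemma hat_le_u: "\<lbrakk>(k, n) \<in> nodes; val k n \<sigma> \<noteq> val k n \<sigma>'\<rbrakk> \<Longrightarrow> hat k n t \<le> u t \<sigma> \<sigma>'"
  using u_le_iff[of t \<sigma> \<sigma>' "u t \<sigma> \<sigma>'"] by blast

lemma u_refl: "u t \<sigma> \<sigma> = 0"
  using u_le_iff[of t \<sigma> \<sigma> 0] u_nonneg[of t \<sigma> \<sigma>] by simp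

lemma u_commute: "u t \<sigma> \<sigma>' = u t \<sigma>' \<sigma>"
proof -
  have "u t \<sigma> \<sigma>' \<le> u t \<sigma>' \<sigma>" for \<sigma> \<sigma>'
    unfolding u_le_iff using u_nonneg hat_le_u by metis
  from this[of \<sigma> \<sigma>'] this[of \<sigma>' \<sigma>] show ?thesis by (rule antisym)
qed

lemma u_ultra: "u t \<sigma> \<sigma>'' \<le> max (u t \<sigma> \<sigma>') (u t \<sigma>' \<sigma>'')"
  unfolding u_le_iff
proof (intro conjI allI impI)
  show "0 \<le> max (u t \<sigma> \<sigma>') (u t \<sigma>' \<sigma>'')" using u_nonneg by (simp add: le_max_iff_disj)
  fix k n assume kn: "(k, n) \<in> nodes" and "val k n \<sigma> \<noteq> val k n \<sigma>''"
  then have "val k n \<sigma> \<noteq> val k n \<sigma>' \<or> val k n \<sigma>' \<noteq> val k n \<sigma>''" by metis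
  then show "hat k n t \<le> max (u t \<sigma> \<sigma>') (u t \<sigma>' \<sigma>'')"
    using hat_le_u[OF kn] by (auto simp: le_max_iff_disj)
qed

lemma u_lipschitz: "u t \<sigma> \<sigma>' \<le> u s \<sigma> \<sigma>' + \<bar>t - s\<bar>"
  unfolding u_le_iff
proof (intro conjI allI impI)
  show "0 \<le> u s \<sigma> \<sigma>' + \<bar>t - s\<bar>" using u_nonneg[of s \<sigma> \<sigma>'] by simp
  fix k n assume "(k, n) \<in> nodes" "val k n \<sigma> \<noteq> val k n \<sigma>'"
  then have "hat k n s \<le> u s \<sigma> \<sigma>'" by (rule hat_le_u)
  moreover have "hat k n t \<le> hat k n s + \<bar>t - s\<bar>" unfolding hat_def by linarith
  ultimately show "hat k n t \<le> u s \<sigma> \<sigma>' + \<bar>t - s\<bar>" by linarith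
qed

lemma scaled_u_flow:
  assumes "0 \<le> \<theta>"
  shows "ultrametric_flow \<Omega> (\<lambda>t \<sigma> \<sigma>'. \<theta> * u t \<sigma> \<sigma>') \<theta>"
proof
  show "finite \<Omega>" by (rule finite_\<Omega>)
  show "0 \<le> \<theta>" by (rule assms)
  fix t s x y
  have "\<theta> * u t x y \<le> \<theta> * (u s x y + \<bar>t - s\<bar>)" using u_lipschitz assms by (rule mult_left_mono)
  then show "\<theta> * u t x y \<le> \<theta> * u s x y + \<theta> * \<bar>t - s\<bar>" by (simp add: distrib_left)
  have "ultrametric_on \<Omega> (u t)"
    unfolding ultrametric_on_def using u_refl u_nonneg u_commute u_ultra by blast
  then show "ultrametric_on \<Omega> (\<lambda>\<sigma> \<sigma>'. \<theta> * u t \<sigma> \<sigma>')"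
    using assms by (intro ultrametric_on_mono_comp[of \<Omega> "u t" "\<lambda>x. \<theta> * x"])
      (auto simp: mono_on_def mult_left_mono)
qed

section \<open>The word norm along the walks\<close>

lemma norm_gen_spans: "v \<in> V \<Longrightarrow> v = span_sum norm_gen ((\<lambda>l. 4 * m + l) ` v)"
proof -
  assume "v \<in> V"
  have "{c \<in> (\<lambda>l. 4 * m + l) ` v. l \<in> norm_gen c} = (if l \<in> v then {4 * m + l} else {})" for l
    by (auto simp: norm_gen_def)
  then show ?thesis by (auto simp: span_sum_def)
qed

lemma V_subset_span: "V \<subseteq> span_sum norm_gen ` Pow {..<5 * m}"
proof
  fix v assume v: "v \<in> V"
  then have "(\<lambda>l. 4 * m + l) ` v \<in> Pow {..<5 * m}" by (auto simp: V_def)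
  then show "v \<in> span_sum norm_gen ` Pow {..<5 * m}"
    by (rule image_eqI[rotated]) (rule norm_gen_spans[OF v])
qed

lemma sym_diff_V: "\<lbrakk>v \<in> V; v' \<in> V\<rbrakk> \<Longrightarrow> sym_diff v v' \<in> V"
  by (auto simp: V_def)

lemma nrm_nonneg: "0 \<le> nrm v" by (simp add: nrm_def)

lemma nrm_empty [simp]: "nrm {} = 0" by (simp add: nrm_def)

lemma nrm_le: "v \<in> V \<Longrightarrow> nrm v \<le> m"
proof -
  assume v: "v \<in> V"
  have "word_norm norm_gen (5 * m) (span_sum norm_gen ((\<lambda>l. 4 * m + l) ` v)) \<le> card ((\<lambda>l. 4 * m + l) ` v)"
    using v by (intro word_norm_span_sum_le) (auto simp: V_def)
  also have "\<dots> = card v" by (intro card_image) (auto simp: inj_on_def)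
  also have "\<dots> \<le> card {..<m}" using v by (intro card_mono) (auto simp: V_def)
  finally show ?thesis unfolding norm_gen_spans[OF v, symmetric] by (simp add: nrm_def)
qed

lemma nrm_sym_diff_le:
  assumes "x \<in> V" "y \<in> V" "z \<in> V"
  shows "\<bar>nrm (sym_diff x z) - nrm (sym_diff y z)\<bar> \<le> nrm (sym_diff x y)"
proof -
  have tri: "nrm (sym_diff a b) \<le> nrm a + nrm b" if "a \<in> V" "b \<in> V" for a b
    using word_norm_sym_diff_le[of a norm_gen "5 * m" b] that V_subset_span
    unfolding nrm_def by (metis of_nat_add of_nat_le_iff subsetD)
  have "sym_diff x z = sym_diff (sym_diff x y) (sym_diff y z)"
    "sym_diff y z = sym_diff (sym_diff x y) (sym_diff x z)" by auto
  then show ?thesis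
    using tri[of "sym_diff x y" "sym_diff y z"] tri[of "sym_diff x y" "sym_diff x z"] assms
    by (auto simp: sym_diff_V)
qed

lemma nrm_singleton_le: "l < m \<Longrightarrow> nrm {l} \<le> 1"
  using word_norm_generator_le[of "4 * m + l" "5 * m" norm_gen] by (simp add: nrm_def norm_gen_def)

lemma step_V: "step c \<in> V" using gen_sub by (auto simp: step_def V_def)

lemma nrm_step_le: "nrm (step c) \<le> 1"
  using word_norm_generator_le[of c "5 * m" norm_gen] by (auto simp: nrm_def norm_gen_def step_def)

lemma pos_V: "a \<in> labels \<Longrightarrow> pos a i \<in> V"
  using step_V[of "snd a"] by (auto simp: pos_def labels_def V_def)

lemma pos_0 [simp]: "pos a 0 = {}" by (simp add: pos_def)

lemma pos_T: "pos a T = {}" using m_pos by (simp add: pos_def T_def)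

lemma pos_even: "\<lbrakk>v \<in> V; j < m\<rbrakk> \<Longrightarrow> pos (v, c) (m + 2 * j) = v"
  by (auto simp: pos_def V_def)

lemma pos_odd: "\<lbrakk>v \<in> V; j < m\<rbrakk> \<Longrightarrow> pos (v, c) (m + 2 * j + 1) = sym_diff v (step c)"
  by (auto simp: pos_def)

text \<open>Each step leaves the position alone, changes one coordinate or applies
  \<open>step c\<close>, and these have norm at most 1.\<close>

lemma nrm_pos_step_le:
  assumes a: "a \<in> labels" and i: "i < T"
  shows "nrm (sym_diff (pos a i) (pos a (i + 1))) \<le> 1"
proof -
  obtain v c where vc: "a = (v, c)" by (cases a)
  have v: "v \<subseteq> {..<m}" using a vc by (auto simp: labels_def V_def)
  consider "i < m" | "m \<le> i" "i < 3 * m" | "3 * m \<le> i" by linarith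
  then show ?thesis
  proof cases
    case 1
    then have "sym_diff (pos a i) (pos a (i + 1)) = (if i \<in> v then {i} else {})"
      by (auto simp: pos_def vc less_Suc_eq)
    then show ?thesis using nrm_singleton_le[OF 1] by simp
  next
    case 2
    \<comment> \<open>At \<open>i = m\<close> the first branch of \<open>pos\<close> applies, but
      agrees with the second because \<open>v\<close> lies in \<open>{..<m}\<close>; the same
      happens at \<open>i = 3 * m\<close> with the third branch below.\<close>
    have "pos a i = (if even (i - m) then v else sym_diff v (step c))"
      using 2 v by (auto simp: pos_def vc)
    moreover have "pos a (i + 1) = (if even (i + 1 - m) then v else sym_diff v (step c))"
      using 2 by (auto simp: pos_def vc)
    moreover have "even (i + 1 - m) \<longleftrightarrow> odd (i - m)" using 2 by (simp add: Suc_diff_le)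
    ultimately have "sym_diff (pos a i) (pos a (i + 1)) = step c" by auto
    then show ?thesis using nrm_step_le by simp
  next
    case 3
    have "pos a i = v \<inter> {..<4 * m - i}"
      using 3 v m_pos by (cases "i = 3 * m") (auto simp: pos_def vc)
    moreover have "pos a (i + 1) = v \<inter> {..<4 * m - (i + 1)}"
      using 3 m_pos by (auto simp: pos_def vc)
    moreover have "{..<4 * m - i} = insert (4 * m - (i + 1)) {..<4 * m - (i + 1)}"
      using i by (auto simp: T_def)
    ultimately have "sym_diff (pos a i) (pos a (i + 1))
        = (if 4 * m - (i + 1) \<in> v then {4 * m - (i + 1)} else {})"
      by auto
    then show ?thesis using nrm_singleton_le[of "4 * m - (i + 1)"] 3 m_pos by simp
  qed
qed

lemma val_V: "\<lbrakk>\<sigma> \<in> \<Omega>; k < K\<rbrakk> \<Longrightarrow> val k n \<sigma> \<in> V"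
  using pos_V[OF \<Omega>_labels] by (auto simp: val_def V_def)

text \<open>Restarting the walk causes no jump since it begins and ends at the empty set. The final
  switch to the empty set happens at a multiple of \<open>T\<close>, hence also at the end of a
  walk.\<close>

lemma nrm_val_step_le:
  assumes \<sigma>: "\<sigma> \<in> \<Omega>" and k: "k < K"
  shows "nrm (sym_diff (val k n \<sigma>) (val k (n + 1) \<sigma>)) \<le> 1"
proof (cases "n < T ^ (K - k)")
  case True
  have dv: "T dvd T ^ (K - k)" using k by (intro dvd_power) auto
  have lt: "n mod T < T" using T_pos by simp
  have "val k (n + 1) \<sigma> = pos (\<sigma> k) (n mod T + 1)"
  proof (cases "n mod T + 1 = T")
    case wrap: True
    then have "(n + 1) mod T = 0" by (metis mod_Suc Suc_eq_plus1)
    then show ?thesis using wrap pos_T by (simp add: val_def)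
  next
    case False
    then have nm: "(n + 1) mod T = n mod T + 1" using lt by (metis mod_Suc Suc_eq_plus1)
    then have "n + 1 \<noteq> T ^ (K - k)" using dv by (metis dvd_imp_mod_0 add_is_0 one_neq_zero)
    then show ?thesis using True nm by (simp add: val_def)
  qed
  then show ?thesis
    using nrm_pos_step_le[OF \<Omega>_labels[OF \<sigma> k] lt] True by (simp add: val_def)
next
  case False
  then show ?thesis by (simp add: val_def)
qed

text \<open>Between two nodes the coordinate is linear in time. The weights carry the factor
  \<open>T ^ k\<close>, so one time step changes it by the full difference of the two node values,
  which is at most 1 at unit speed.\<close>

lemma word_coord_step_le:
  assumes \<sigma>: "\<sigma> \<in> \<Omega>" and k: "k < K" and x: "x \<in> V"
  shows "\<bar>word_coord k x (t + 1) \<sigma> - word_coord k x t \<sigma>\<bar> \<le> 1"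
proof -
  define L where "L = T ^ k"
  define n where "n = t div L"
  define r where "r = t mod L"
  define a where "a i = nrm (sym_diff (val k i \<sigma>) x)" for i
  have L: "0 < L" using T_pos by (simp add: L_def)
  have r: "r < L" using L by (simp add: r_def)
  have a: "\<bar>a n - a (n + 1)\<bar> \<le> 1"
    using nrm_sym_diff_le[OF val_V[OF \<sigma> k] val_V[OF \<sigma> k] x] nrm_val_step_le[OF \<sigma> k]
    unfolding a_def by (meson order_trans)
  have t: "word_coord k x t \<sigma> = real (L - r) * a n + real r * a (n + 1)"
    by (simp add: word_coord_def L_def n_def r_def a_def)
  have "word_coord k x (t + 1) \<sigma> - word_coord k x t \<sigma> = a (n + 1) - a n"
  proof (cases "r + 1 = L")
    case True
    then have "(t + 1) mod L = 0" by (metis mod_Suc Suc_eq_plus1 r_def)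
    moreover from this have "(t + 1) div L = n + 1" by (simp add: n_def div_Suc)
    ultimately have "word_coord k x (t + 1) \<sigma> = real L * a (n + 1)"
      by (simp add: word_coord_def L_def[symmetric] a_def)
    moreover have "real L = real r + 1" "L - r = 1" using True by auto
    ultimately show ?thesis using t by (simp add: algebra_simps)
  next
    case False
    then have "(t + 1) mod L = r + 1" using r by (metis mod_Suc Suc_eq_plus1 r_def)
    moreover from this have "(t + 1) div L = n" by (simp add: n_def div_Suc)
    ultimately have "word_coord k x (t + 1) \<sigma> = real (L - (r + 1)) * a n + real (r + 1) * a (n + 1)"
      by (simp add: word_coord_def L_def[symmetric] a_def)
    then show ?thesis using t r by (simp add: of_nat_diff algebra_simps)
  qed
  then show ?thesis using a by simp
qed

lemma word_coord_time_lipschitz: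
  assumes "\<sigma> \<in> \<Omega>" "k < K" "x \<in> V"
  shows "\<bar>word_coord k x t \<sigma> - word_coord k x s \<sigma>\<bar> \<le> \<bar>real t - real s\<bar>"
proof -
  have *: "\<bar>word_coord k x (s + d) \<sigma> - word_coord k x s \<sigma>\<bar> \<le> d" for s d
  proof (induction d)
    case (Suc d)
    then show ?case using word_coord_step_le[OF assms, of "s + d"] by simp
  qed simp
  show ?thesis
  proof (cases "s \<le> t")
    case True
    then show ?thesis using *[of s "t - s"] by (simp add: of_nat_diff)
  next
    case False
    then show ?thesis using *[of t "s - t"] by (simp add: of_nat_diff abs_minus_commute)
  qed
qed

text \<open>The two interpolation weights are the heights at \<open>t\<close> of the neighbouring
  tents, hence at most \<open>u t \<sigma> \<sigma>'\<close> at a node where the walks differ. A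
  node value changes by at most \<open>m\<close>, and there are two nodes.\<close>

lemma word_coord_space_le:
  assumes \<sigma>: "\<sigma> \<in> \<Omega>" "\<sigma>' \<in> \<Omega>" and k: "k < K" and x: "x \<in> V"
  shows "\<bar>word_coord k x t \<sigma> - word_coord k x t \<sigma>'\<bar> \<le> 2 * m * u t \<sigma> \<sigma>'"
proof -
  define L where "L = T ^ k"
  define n where "n = t div L"
  define r where "r = t mod L"
  define a where "a \<sigma> i = nrm (sym_diff (val k i \<sigma>) x)" for \<sigma> i
  have L: "0 < L" using T_pos by (simp add: L_def)
  have r: "r < L" using L by (simp add: r_def)
  have tnr: "t = n * L + r" by (simp add: n_def r_def)
  have node: "h * \<bar>a \<sigma> i - a \<sigma>' i\<bar> \<le> m * u t \<sigma> \<sigma>'" if h: "h = hat k i t" for h i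
  proof (cases "val k i \<sigma> = val k i \<sigma>'")
    case True
    then show ?thesis using u_nonneg by (simp add: a_def)
  next
    case False
    then have "i < T ^ (K - k)" by (auto simp: val_def)
    then have "hat k i t \<le> u t \<sigma> \<sigma>'" using False k by (intro hat_le_u) (auto simp: nodes_def)
    moreover have "\<bar>a \<sigma> i - a \<sigma>' i\<bar> \<le> m"
      using nrm_sym_diff_le[OF val_V[OF \<sigma>(1) k] val_V[OF \<sigma>(2) k] x, of i i]
        nrm_le[OF sym_diff_V[OF val_V[OF \<sigma>(1) k] val_V[OF \<sigma>(2) k]], of i i]
      unfolding a_def by linarith
    ultimately have "hat k i t * \<bar>a \<sigma> i - a \<sigma>' i\<bar> \<le> u t \<sigma> \<sigma>' * m"
      using u_nonneg by (intro mult_mono) auto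
    then show ?thesis using h by (simp add: mult.commute)
  qed
  have "real (L - r) = hat k n t"
    using r by (simp add: hat_def L_def[symmetric] tnr of_nat_diff)
  moreover have "real r = hat k (n + 1) t"
    using r by (simp add: hat_def L_def[symmetric] tnr algebra_simps)
  ultimately have "real (L - r) * \<bar>a \<sigma> n - a \<sigma>' n\<bar> + real r * \<bar>a \<sigma> (n + 1) - a \<sigma>' (n + 1)\<bar>
      \<le> 2 * m * u t \<sigma> \<sigma>'"
    using node[of "real (L - r)" n] node[of "real r" "n + 1"] by simp
  moreover have eq: "word_coord k x t \<sigma> - word_coord k x t \<sigma>'
      = real (L - r) * (a \<sigma> n - a \<sigma>' n) + real r * (a \<sigma> (n + 1) - a \<sigma>' (n + 1))"
    by (simp add: word_coord_def L_def n_def r_def a_def algebra_simps)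
  moreover have "\<bar>real (L - r) * p + real r * q\<bar> \<le> real (L - r) * \<bar>p\<bar> + real r * \<bar>q\<bar>" for p q :: real
    using abs_triangle_ineq[of "real (L - r) * p" "real r * q"] by (simp add: abs_mult)
  ultimately show ?thesis unfolding eq by (meson order_trans)
qed

end

section \<open>The energy inequality\<close>

text \<open>The decomposition of a second moment into squared mean and variance, with the variance
  written through the deviations from linear interpolation, so that equal slopes can later be
  subtracted at both ends of an edge.\<close>

lemma sum_square_increments:
  fixes x :: "nat \<Rightarrow> real"
  assumes "0 < T"
  defines "s \<equiv> (x T - x 0) / T"
  shows "(\<Sum>i<T. (x (i + 1) - x i)\<^sup>2) = (x T - x 0)\<^sup>2 / T
    + (\<Sum>i<T. ((x (i + 1) - real (i + 1) * s) - (x i - i * s))\<^sup>2)"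
proof -
  have tel: "(\<Sum>i<T. x (i + 1) - x i) = x T - x 0"
    using sum_lessThan_telescope[of x T] by simp
  have "((x (i + 1) - real (i + 1) * s) - (x i - i * s))\<^sup>2
      = (x (i + 1) - x i)\<^sup>2 - 2 * s * (x (i + 1) - x i) + s\<^sup>2"
    for i by (simp add: power2_eq_square algebra_simps)
  then have "(\<Sum>i<T. ((x (i + 1) - real (i + 1) * s) - (x i - i * s))\<^sup>2)
      = (\<Sum>i<T. (x (i + 1) - x i)\<^sup>2) - (\<Sum>i<T. 2 * s * (x (i + 1) - x i)) + (\<Sum>i<T. s\<^sup>2)"
    by (simp only: sum.distrib sum_subtractf)
  moreover have "(\<Sum>i<T. 2 * s * (x (i + 1) - x i)) = 2 * s * (\<Sum>i<T. x (i + 1) - x i)"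
    by (simp only: sum_distrib_left)
  moreover have "(\<Sum>i<T. s\<^sup>2) = T * s\<^sup>2" by simp
  moreover have "2 * s * (x T - x 0) - T * s\<^sup>2 = (x T - x 0)\<^sup>2 / T"
    using assms(1) by (simp add: s_def power2_eq_square field_simps)
  ultimately show ?thesis unfolding tel by linarith
qed

text \<open>Exchanging \<open>a\<close> with the entry of \<sigma> at \<open>k\<close> is an
  involution of the pairs.\<close>

lemma sum_PiE_resample:
  assumes k: "k \<in> I"
  shows "(\<Sum>\<sigma>\<in>PiE I (\<lambda>_. A). \<Sum>a\<in>A. f (\<sigma>(k := a))) = real (card A) * (\<Sum>\<sigma>\<in>PiE I (\<lambda>_. A). f \<sigma>)"
proof -
  have "(\<Sum>\<sigma>\<in>PiE I (\<lambda>_. A). \<Sum>a\<in>A. f (\<sigma>(k := a)))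
      = (\<Sum>(\<sigma>, a)\<in>PiE I (\<lambda>_. A) \<times> A. f (\<sigma>(k := a)))"
    by (rule sum.cartesian_product)
  also have "\<dots> = (\<Sum>(\<sigma>, a)\<in>PiE I (\<lambda>_. A) \<times> A. f \<sigma>)"
    using k by (intro sum.reindex_bij_witness[of _ "\<lambda>(\<sigma>, a). (\<sigma>(k := a), \<sigma> k)" "\<lambda>(\<sigma>, a). (\<sigma>(k := a), \<sigma> k)"])
      (auto simp: PiE_iff extensional_def split: if_splits)
  also have "\<dots> = (\<Sum>\<sigma>\<in>PiE I (\<lambda>_. A). \<Sum>a\<in>A. f \<sigma>)"
    by (rule sum.cartesian_product[symmetric])
  finally show ?thesis by (simp add: sum_distrib_left)
qed

context gadget
begin

text \<open>At a node time the other tents of level \<open>k\<close> vanish, and on all other levels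
  the two labels coincide.\<close>

lemma u_eq_0_of_pos_eq:
  assumes k: "k < K" and eq: "pos a (n mod T) = pos a' (n mod T)"
  shows "u (real (n * T ^ k)) (\<sigma>(k := a)) (\<sigma>(k := a')) = 0"
proof -
  have "u (real (n * T ^ k)) (\<sigma>(k := a)) (\<sigma>(k := a')) \<le> 0"
    unfolding u_le_iff
  proof (intro conjI allI impI)
    fix j i assume ne: "val j i (\<sigma>(k := a)) \<noteq> val j i (\<sigma>(k := a'))"
    then have j: "j = k" by (auto simp: val_def split: if_splits)
    then have "i \<noteq> n" using ne eq by (auto simp: val_def split: if_splits)
    then have "1 \<le> \<bar>real n - real i\<bar>" by linarith
    then have "1 * real (T ^ k) \<le> \<bar>real n - real i\<bar> * real (T ^ k)"
      by (intro mult_right_mono) auto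
    also have "\<dots> = \<bar>real (n * T ^ k) - real (i * T ^ k)\<bar>"
      by (simp add: abs_mult left_diff_distrib[symmetric])
    finally show "hat j i (real (n * T ^ k)) \<le> 0" by (simp add: hat_def j)
  qed simp
  then show ?thesis using u_nonneg by (intro antisym) auto
qed

text \<open>An even position in the middle part of the walk in block \<open>B\<close> of level
  \<open>k\<close>, where the label \<open>(v, c)\<close> sits at \<open>v\<close> whatever
  \<open>c\<close> is.\<close>

definition node_time :: "nat \<Rightarrow> nat \<Rightarrow> nat \<Rightarrow> nat" where
  "node_time k B j = (B * T + (m + 2 * j)) * T ^ k"

text \<open>Telescoping over the levels leaves a nonnegative remainder and the fluctuations
  \<open>G k\<close>, weighted by \<open>1 / T ^ k\<close>. On the middle edges these are bounded
  below by the Poincare inequality after averaging over the label of level \<open>k\<close>. The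
  hypothesis says that \<open>F t\<close> lives on the quotient by distance 0; the lazy label
  \<open>(v, 4 * m)\<close> stands for the element \<open>v\<close> of a layer.\<close>

lemma energy_inequality:
  fixes F :: "nat \<Rightarrow> (nat \<Rightarrow> nat set \<times> nat) \<Rightarrow> real"
  assumes inv: "\<And>t \<sigma> \<sigma>'. \<lbrakk>\<sigma> \<in> \<Omega>; \<sigma>' \<in> \<Omega>; u (real t) \<sigma> \<sigma>' = 0\<rbrakk> \<Longrightarrow> F t \<sigma> = F t \<sigma>'"
  shows "(\<Sum>k<K. 1 / (16 * 4 ^ m * T ^ k) * (\<Sum>\<sigma>\<in>\<Omega>. \<Sum>B<T ^ (K - Suc k). \<Sum>j<m. \<Sum>v\<in>V. \<Sum>v'\<in>V.
        (F (node_time k B j) (\<sigma>(k := (v, 4 * m))) - F (node_time k B j) (\<sigma>(k := (v', 4 * m))))\<^sup>2))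
    \<le> (\<Sum>\<sigma>\<in>\<Omega>. \<Sum>t<T ^ K. (F (t + 1) \<sigma> - F t \<sigma>)\<^sup>2)"
proof -
  define S where "S k \<sigma> = (\<Sum>n<T ^ (K - k). (F ((n + 1) * T ^ k) \<sigma> - F (n * T ^ k) \<sigma>)\<^sup>2)" for k \<sigma>
  define sl where "sl k B \<sigma> = (F ((B * T + T) * T ^ k) \<sigma> - F ((B * T + 0) * T ^ k) \<sigma>) / T" for k B \<sigma>
  define y where "y k B \<sigma> i = F ((B * T + i) * T ^ k) \<sigma> - i * sl k B \<sigma>" for k B \<sigma> i
  define G where "G k \<sigma> = (\<Sum>B<T ^ (K - Suc k). \<Sum>i<T. (y k B \<sigma> (i + 1) - y k B \<sigma> i)\<^sup>2)" for k \<sigma>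
  \<comment> \<open>A segment of level \<open>k + 1\<close> is one block of \<open>T\<close>
    segments of level \<open>k\<close>, to which the variance decomposition applies.\<close>
  have refine: "S k \<sigma> = S (Suc k) \<sigma> / T + G k \<sigma>" if k: "k < K" for k \<sigma>
  proof -
    have "K - k = Suc (K - Suc k)" using k by simp
    then have "T ^ (K - k) = T ^ (K - Suc k) * T" by simp
    then have "S k \<sigma> = (\<Sum>B<T ^ (K - Suc k). \<Sum>n = B * T..<B * T + T. (F ((n + 1) * T ^ k) \<sigma> - F (n * T ^ k) \<sigma>)\<^sup>2)"
      unfolding S_def by (simp only: sum.nat_group)
    also have "\<dots> = (\<Sum>B<T ^ (K - Suc k). \<Sum>i<T. (F ((B * T + (i + 1)) * T ^ k) \<sigma> - F ((B * T + i) * T ^ k) \<sigma>)\<^sup>2)"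
    proof (rule sum.cong[OF refl])
      fix B
      show "(\<Sum>n = B * T..<B * T + T. (F ((n + 1) * T ^ k) \<sigma> - F (n * T ^ k) \<sigma>)\<^sup>2)
          = (\<Sum>i<T. (F ((B * T + (i + 1)) * T ^ k) \<sigma> - F ((B * T + i) * T ^ k) \<sigma>)\<^sup>2)"
        using sum.shift_bounds_nat_ivl[of "\<lambda>n. (F ((n + 1) * T ^ k) \<sigma> - F (n * T ^ k) \<sigma>)\<^sup>2" 0 "B * T" T]
        by (simp add: atLeast0LessThan add.commute add.left_commute)
    qed
    also have "\<dots> = (\<Sum>B<T ^ (K - Suc k).
        (F ((B * T + T) * T ^ k) \<sigma> - F ((B * T + 0) * T ^ k) \<sigma>)\<^sup>2 / T
        + (\<Sum>i<T. (y k B \<sigma> (i + 1) - y k B \<sigma> i)\<^sup>2))"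
      using sum_square_increments[OF T_pos, of "\<lambda>i. F ((_ * T + i) * T ^ k) \<sigma>"]
      by (intro sum.cong refl) (simp only: y_def sl_def)
    also have "\<dots> = S (Suc k) \<sigma> / T + G k \<sigma>"
      by (simp add: S_def G_def sum.distrib sum_divide_distrib algebra_simps)
    finally show ?thesis .
  qed
  have tele: "S 0 \<sigma> = S j \<sigma> / T ^ j + (\<Sum>k<j. G k \<sigma> / T ^ k)" if "j \<le> K" for j \<sigma>
    using that
  proof (induction j)
    case (Suc j)
    then have "S 0 \<sigma> = (S (Suc j) \<sigma> / T + G j \<sigma>) / T ^ j + (\<Sum>k<j. G k \<sigma> / T ^ k)"
      using refine[of j \<sigma>] by simp
    then show ?case by (simp add: add_divide_distrib)
  qed simp
  have "0 \<le> S K \<sigma>" for \<sigma> by (simp add: S_def sum_nonneg)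
  then have S0: "(\<Sum>k<K. G k \<sigma> / T ^ k) \<le> (\<Sum>t<T ^ K. (F (t + 1) \<sigma> - F t \<sigma>)\<^sup>2)" for \<sigma>
    using tele[of K \<sigma>] by (simp add: S_def)
  have gain: "1 / (16 * 4 ^ m) * (\<Sum>\<sigma>\<in>\<Omega>. \<Sum>B<T ^ (K - Suc k). \<Sum>j<m. \<Sum>v\<in>V. \<Sum>v'\<in>V.
        (F (node_time k B j) (\<sigma>(k := (v, 4 * m))) - F (node_time k B j) (\<sigma>(k := (v', 4 * m))))\<^sup>2)
      \<le> (\<Sum>\<sigma>\<in>\<Omega>. G k \<sigma>)" if k: "k < K" for k
  proof -
    have block: "(m / 2) / 2 ^ m * (\<Sum>j<m. \<Sum>v\<in>V. \<Sum>v'\<in>V.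
        (F (node_time k B j) (\<sigma>(k := (v, 4 * m))) - F (node_time k B j) (\<sigma>(k := (v', 4 * m))))\<^sup>2)
        \<le> (\<Sum>a\<in>labels. \<Sum>i<T. (y k B (\<sigma>(k := a)) (i + 1) - y k B (\<sigma>(k := a)) i)\<^sup>2)"
      if \<sigma>: "\<sigma> \<in> \<Omega>" for \<sigma> B
    proof -
      have F_eq: "F ((B * T + i) * T ^ k) (\<sigma>(k := a)) = F ((B * T + i) * T ^ k) (\<sigma>(k := a'))"
        if "a \<in> labels" "a' \<in> labels" "pos a (i mod T) = pos a' (i mod T)" for a a' i
        using that k \<sigma> by (intro inv fun_upd_\<Omega> u_eq_0_of_pos_eq) auto
      have lab: "(v, c) \<in> labels" if "v \<in> V" "c < 8 * m" for v c using that by (simp add: labels_def)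
      define a0 where "a0 = ({} :: nat set, 4 * m)"
      have a0: "a0 \<in> labels" using m_pos by (simp add: a0_def labels_def V_def)
      define s where "s = sl k B (\<sigma>(k := a0))"
      \<comment> \<open>Every walk is at the empty set at both ends of the block, so the slope is
        the same for all labels of level \<open>k\<close>.\<close>
      have sl: "sl k B (\<sigma>(k := a)) = s" if "a \<in> labels" for a
        using F_eq[OF that a0, of T] F_eq[OF that a0, of 0] by (simp add: s_def sl_def)
      define R where "R i v = F ((B * T + i) * T ^ k) (\<sigma>(k := (v, 4 * m))) - i * s" for i v
      \<comment> \<open>\<open>F\<close> sees the label of level \<open>k\<close> at a node only
        through the position there, so the label may be replaced by a lazy one that passes through
        the same position.\<close>
      have yR: "y k B (\<sigma>(k := (v, c))) i = R i (pos (v, c) i)"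
        if v: "v \<in> V" and c: "c < 8 * m" and i: "i < T" and p: "pos (pos (v, c) i, 4 * m) i = pos (v, c) i" for v c i
      proof -
        have "(pos (v, c) i, 4 * m) \<in> labels" using pos_V[OF lab[OF v c]] m_pos by (simp add: labels_def)
        then have "F ((B * T + i) * T ^ k) (\<sigma>(k := (v, c))) = F ((B * T + i) * T ^ k) (\<sigma>(k := (pos (v, c) i, 4 * m)))"
          using lab[OF v c] p i by (intro F_eq) auto
        then show ?thesis using sl[OF lab[OF v c]] by (simp add: y_def R_def)
      qed
      have even_y: "y k B (\<sigma>(k := (v, c))) (m + 2 * j) = R (m + 2 * j) v"
        if "v \<in> V" "c < 8 * m" "j < m" for v c j
        using yR[OF that(1,2), of "m + 2 * j"] pos_even[OF that(1,3)] that by (simp add: T_def)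
      have odd_y: "y k B (\<sigma>(k := (v, c))) (m + 2 * j + 1) = R (m + 2 * j + 1) (sym_diff v (step c))"
        if "v \<in> V" "c < 8 * m" "j < m" for v c j
      proof -
        have "step (4 * m) = {}" by (simp add: step_def)
        then show ?thesis
          using yR[OF that(1,2), of "m + 2 * j + 1"] pos_odd[OF that(1,3), of c]
            pos_odd[OF sym_diff_V[OF that(1) step_V[of c]] that(3), of "4 * m"] that
          by (simp add: T_def)
      qed
      have "(m / 2) / 2 ^ m * (\<Sum>v\<in>V. \<Sum>v'\<in>V.
          (F (node_time k B j) (\<sigma>(k := (v, 4 * m))) - F (node_time k B j) (\<sigma>(k := (v', 4 * m))))\<^sup>2)
          \<le> (\<Sum>a\<in>labels. (y k B (\<sigma>(k := a)) (m + 2 * j + 1) - y k B (\<sigma>(k := a)) (m + 2 * j))\<^sup>2)"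
        if j: "j < m" for j
      proof -
        have "(m / 2) / 2 ^ card {..<m} * (\<Sum>v\<in>Pow {..<m}. \<Sum>v'\<in>Pow {..<m}. (R (m + 2 * j) v - R (m + 2 * j) v')\<^sup>2)
            \<le> (\<Sum>c<2 * (4 * m). \<Sum>v\<in>Pow {..<m}. (R (m + 2 * j) v - R (m + 2 * j + 1) (sym_diff v (step c)))\<^sup>2)"
        proof (rule lazy_walk_poincare)
          show "real m / 2 \<le> real (card {c \<in> {..<4 * m}. walsh w (step c) = - 1})"
            if "w \<subseteq> {..<m}" "w \<noteq> {}" for w
          proof -
            have "{c \<in> {..<4 * m}. walsh w (step c) = - 1} = {c \<in> {..<4 * m}. walsh w (g c) = - 1}"
              by (auto simp: step_def)
            then show ?thesis using expanding[OF that] by simp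
          qed
        qed (use gen_sub in \<open>auto simp: step_def\<close>)
        also have "\<dots> = (\<Sum>c<8 * m. \<Sum>v\<in>V. (y k B (\<sigma>(k := (v, c))) (m + 2 * j + 1) - y k B (\<sigma>(k := (v, c))) (m + 2 * j))\<^sup>2)"
          using even_y odd_y j by (auto simp: V_def[symmetric] power2_commute intro!: sum.cong)
        also have "\<dots> = (\<Sum>a\<in>labels. (y k B (\<sigma>(k := a)) (m + 2 * j + 1) - y k B (\<sigma>(k := a)) (m + 2 * j))\<^sup>2)"
          unfolding labels_def by (subst sum.swap) (simp add: sum.cartesian_product case_prod_beta')
        finally show ?thesis by (simp add: R_def node_time_def V_def)
      qed
      then have "(\<Sum>j<m. (m / 2) / 2 ^ m * (\<Sum>v\<in>V. \<Sum>v'\<in>V.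
          (F (node_time k B j) (\<sigma>(k := (v, 4 * m))) - F (node_time k B j) (\<sigma>(k := (v', 4 * m))))\<^sup>2))
          \<le> (\<Sum>j<m. \<Sum>a\<in>labels. (y k B (\<sigma>(k := a)) (m + 2 * j + 1) - y k B (\<sigma>(k := a)) (m + 2 * j))\<^sup>2)"
        by (intro sum_mono) auto
      also have "\<dots> = (\<Sum>a\<in>labels. \<Sum>j<m. (y k B (\<sigma>(k := a)) (m + 2 * j + 1) - y k B (\<sigma>(k := a)) (m + 2 * j))\<^sup>2)"
        by (rule sum.swap)
      also have "\<dots> \<le> (\<Sum>a\<in>labels. \<Sum>i<T. (y k B (\<sigma>(k := a)) (i + 1) - y k B (\<sigma>(k := a)) i)\<^sup>2)"
      proof (rule sum_mono)
        fix a
        have "(\<Sum>j<m. (y k B (\<sigma>(k := a)) (m + 2 * j + 1) - y k B (\<sigma>(k := a)) (m + 2 * j))\<^sup>2)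
            = (\<Sum>i\<in>(\<lambda>j. m + 2 * j) ` {..<m}. (y k B (\<sigma>(k := a)) (i + 1) - y k B (\<sigma>(k := a)) i)\<^sup>2)"
          by (subst sum.reindex) (auto simp: inj_on_def)
        also have "\<dots> \<le> (\<Sum>i<T. (y k B (\<sigma>(k := a)) (i + 1) - y k B (\<sigma>(k := a)) i)\<^sup>2)"
          by (intro sum_mono2) (auto simp: T_def)
        finally show "(\<Sum>j<m. (y k B (\<sigma>(k := a)) (m + 2 * j + 1) - y k B (\<sigma>(k := a)) (m + 2 * j))\<^sup>2)
            \<le> (\<Sum>i<T. (y k B (\<sigma>(k := a)) (i + 1) - y k B (\<sigma>(k := a)) i)\<^sup>2)" .
      qed
      finally show ?thesis by (simp add: sum_distrib_left)
    qed
    define Z where "Z = (\<Sum>\<sigma>\<in>\<Omega>. \<Sum>B<T ^ (K - Suc k). \<Sum>j<m. \<Sum>v\<in>V. \<Sum>v'\<in>V.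
        (F (node_time k B j) (\<sigma>(k := (v, 4 * m))) - F (node_time k B j) (\<sigma>(k := (v', 4 * m))))\<^sup>2)"
    have "(m / 2) / 2 ^ m * Z \<le> (\<Sum>\<sigma>\<in>\<Omega>. \<Sum>B<T ^ (K - Suc k).
        \<Sum>a\<in>labels. \<Sum>i<T. (y k B (\<sigma>(k := a)) (i + 1) - y k B (\<sigma>(k := a)) i)\<^sup>2)"
      unfolding Z_def sum_distrib_left[where A = \<Omega>]
      by (intro sum_mono, subst sum_distrib_left, intro sum_mono block)
    also have "\<dots> = (\<Sum>\<sigma>\<in>\<Omega>. \<Sum>a\<in>labels. G k (\<sigma>(k := a)))"
      unfolding G_def by (rule sum.cong[OF refl], rule sum.swap)
    also have "\<dots> = real (card labels) * (\<Sum>\<sigma>\<in>\<Omega>. G k \<sigma>)"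
      unfolding \<Omega>_def using k by (intro sum_PiE_resample) simp
    finally have "(m / 2) / 2 ^ m * Z \<le> (2 ^ m * (8 * real m)) * (\<Sum>\<sigma>\<in>\<Omega>. G k \<sigma>)"
      by (simp add: card_labels)
    then have "(m / 2) / 2 ^ m * Z / (2 ^ m * (8 * real m)) \<le> (\<Sum>\<sigma>\<in>\<Omega>. G k \<sigma>)"
      using m_pos by (simp add: pos_divide_le_eq mult_ac)
    \<comment> \<open>The factor \<open>m\<close> from the number of labels cancels against the
      spectral gap \<open>m / 2\<close>, so the gain per pair of a layer is free of
      \<open>m\<close>.\<close>
    moreover have "(m / 2) / 2 ^ m * Z / (2 ^ m * (8 * real m)) = 1 / (16 * 4 ^ m) * Z"
    proof -
      have "(4 :: real) ^ m = 2 ^ m * 2 ^ m" by (simp add: power_mult_distrib[symmetric])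
      then show ?thesis using m_pos by (simp add: field_simps)
    qed
    ultimately show ?thesis unfolding Z_def by simp
  qed
  have "(\<Sum>k<K. 1 / (16 * 4 ^ m * T ^ k) * (\<Sum>\<sigma>\<in>\<Omega>. \<Sum>B<T ^ (K - Suc k). \<Sum>j<m. \<Sum>v\<in>V. \<Sum>v'\<in>V.
        (F (node_time k B j) (\<sigma>(k := (v, 4 * m))) - F (node_time k B j) (\<sigma>(k := (v', 4 * m))))\<^sup>2))
      \<le> (\<Sum>k<K. (\<Sum>\<sigma>\<in>\<Omega>. G k \<sigma>) / T ^ k)"
  proof (rule sum_mono)
    fix k assume "k \<in> {..<K}"
    then have "k < K" by simp
    from divide_right_mono[OF gain[OF this], of "T ^ k"]
    show "1 / (16 * 4 ^ m * T ^ k) * (\<Sum>\<sigma>\<in>\<Omega>. \<Sum>B<T ^ (K - Suc k). \<Sum>j<m. \<Sum>v\<in>V. \<Sum>v'\<in>V.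
        (F (node_time k B j) (\<sigma>(k := (v, 4 * m))) - F (node_time k B j) (\<sigma>(k := (v', 4 * m))))\<^sup>2)
      \<le> (\<Sum>\<sigma>\<in>\<Omega>. G k \<sigma>) / T ^ k" by simp
  qed
  also have "\<dots> = (\<Sum>\<sigma>\<in>\<Omega>. \<Sum>k<K. G k \<sigma> / T ^ k)"
    unfolding sum_divide_distrib by (rule sum.swap)
  also have "\<dots> \<le> (\<Sum>\<sigma>\<in>\<Omega>. \<Sum>t<T ^ K. (F (t + 1) \<sigma> - F t \<sigma>)\<^sup>2)"
    by (intro sum_mono S0)
  finally show ?thesis .
qed

end

section \<open>The metric spaces\<close>

text \<open>\<open>\<kappa>\<close> names the classes of points at distance 0. Numbering them gives
  a metric on an initial segment of the naturals, with its size visible as the number of values of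
  \<open>\<kappa>\<close>.\<close>

lemma finite_pseudometric_quotient:
  fixes D :: "'p \<Rightarrow> 'p \<Rightarrow> real" and \<kappa> :: "'p \<Rightarrow> 'q"
  assumes fin: "finite P"
    and nonneg: "\<And>p q. 0 \<le> D p q" and comm: "\<And>p q. D p q = D q p"
    and tri: "\<And>p q r. \<lbrakk>p \<in> P; q \<in> P; r \<in> P\<rbrakk> \<Longrightarrow> D p r \<le> D p q + D q r"
    and zero: "\<And>p q. \<lbrakk>p \<in> P; q \<in> P\<rbrakk> \<Longrightarrow> D p q = 0 \<longleftrightarrow> \<kappa> p = \<kappa> q"
  obtains d :: "nat \<Rightarrow> nat \<Rightarrow> real" and cls :: "'p \<Rightarrow> nat" and rep :: "nat \<Rightarrow> 'p"
  where "Metric_space {..<card (\<kappa> ` P)} d"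
    "\<And>p. p \<in> P \<Longrightarrow> cls p < card (\<kappa> ` P)" "\<And>p q. \<kappa> p = \<kappa> q \<Longrightarrow> cls p = cls q"
    "\<And>p q. \<lbrakk>p \<in> P; q \<in> P\<rbrakk> \<Longrightarrow> d (cls p) (cls q) = D p q"
    "\<And>i. i < card (\<kappa> ` P) \<Longrightarrow> rep i \<in> P \<and> cls (rep i) = i"
proof -
  let ?c = "card (\<kappa> ` P)"
  obtain h where h: "bij_betw h (\<kappa> ` P) {..<?c}"
    using ex_bij_betw_finite_nat[of "\<kappa> ` P"] fin by (auto simp: atLeast0LessThan)
  define cls where "cls p = h (\<kappa> p)" for p
  have cls_lt: "cls p < ?c" if "p \<in> P" for p
    using h that by (auto simp: cls_def bij_betw_def)
  have cls_eq: "cls p = cls q \<longleftrightarrow> D p q = 0" if "p \<in> P" "q \<in> P" for p q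
    using h that zero[OF that] by (auto simp: cls_def bij_betw_def inj_on_def)
  have "\<exists>p. p \<in> P \<and> cls p = i" if "i < ?c" for i
    using h that unfolding cls_def bij_betw_def by (metis imageE lessThan_iff)
  then obtain rep where rep: "\<And>i. i < ?c \<Longrightarrow> rep i \<in> P \<and> cls (rep i) = i" by metis
  \<comment> \<open>\<open>Metric_space\<close> asks for nonnegativity and symmetry at all
    arguments, also outside the carrier, hence the default 0.\<close>
  define d where "d i j = (if i < ?c \<and> j < ?c then D (rep i) (rep j) else 0)" for i j
  have "Metric_space {..<?c} d"
  proof
    show "0 \<le> d x y" for x y using nonneg by (simp add: d_def)
    show "d x y = d y x" for x y using comm by (auto simp: d_def)
    show "(d x y = 0) = (x = y)" if "x \<in> {..<?c}" "y \<in> {..<?c}" for x y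
      using that rep[of x] rep[of y] cls_eq[of "rep x" "rep y"] by (auto simp: d_def)
    show "d x z \<le> d x y + d y z" if "x \<in> {..<?c}" "y \<in> {..<?c}" "z \<in> {..<?c}" for x y z
      using that rep tri by (simp add: d_def)
  qed
  moreover have "d (cls p) (cls q) = D p q" if p: "p \<in> P" and q: "q \<in> P" for p q
  proof -
    let ?p = "rep (cls p)" and ?q = "rep (cls q)"
    have P: "?p \<in> P" "?q \<in> P" using rep cls_lt p q by auto
    have "D p ?p = 0" "D q ?q = 0"
      using cls_eq[OF p P(1)] cls_eq[OF q P(2)] rep cls_lt p q by auto
    then have "D ?p ?q = D p q"
      using tri[OF p P(1) q] tri[OF P(1,2) q] tri[OF P(1) p P(2)] tri[OF p q P(2)] comm
      by (smt (verit))
    then show ?thesis using cls_lt p q by (simp add: d_def)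
  qed
  moreover have "cls p = cls q" if "\<kappa> p = \<kappa> q" for p q using that by (simp add: cls_def)
  ultimately show ?thesis using that cls_lt rep by blast
qed

lemma card_image_le_card_image:
  assumes "finite Q" "\<And>x y. \<lbrakk>x \<in> Q; y \<in> Q; \<eta> x = \<eta> y\<rbrakk> \<Longrightarrow> \<kappa> x = \<kappa> y"
  shows "card (\<kappa> ` Q) \<le> card (\<eta> ` Q)"
proof -
  have "\<kappa> ` Q \<subseteq> (\<kappa> \<circ> inv_into Q \<eta>) ` (\<eta> ` Q)"
  proof
    fix z assume "z \<in> \<kappa> ` Q"
    then obtain x where x: "x \<in> Q" "z = \<kappa> x" by blast
    then have "z = (\<kappa> \<circ> inv_into Q \<eta>) (\<eta> x)"
      using assms(2)[of x "inv_into Q \<eta> (\<eta> x)"] by (simp add: inv_into_into f_inv_into_f)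
    then show "z \<in> (\<kappa> \<circ> inv_into Q \<eta>) ` (\<eta> ` Q)" using x by blast
  qed
  then show ?thesis
    using assms(1) by (meson card_image_le card_mono finite_imageI order_trans)
qed

context gadget
begin

lemma word_coord_diff_le_word_dist:
  assumes "k < K" "x \<in> V"
  shows "\<bar>word_coord k x t \<sigma> - word_coord k x s \<sigma>'\<bar> \<le> word_dist (t, \<sigma>) (s, \<sigma>')"
  unfolding word_dist_def prod.case using assms finite_V by (intro Max_ge) force+

lemma word_dist_leI:
  assumes "0 \<le> c" "\<And>k x. \<lbrakk>k < K; x \<in> V\<rbrakk> \<Longrightarrow> \<bar>word_coord k x t \<sigma> - word_coord k x s \<sigma>'\<bar> \<le> c"
  shows "word_dist (t, \<sigma>) (s, \<sigma>') \<le> c"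
  unfolding word_dist_def prod.case using assms finite_V by (intro Max.boundedI) auto

lemma word_dist_nonneg: "0 \<le> word_dist p q"
  unfolding word_dist_def using finite_V by (auto simp: split_beta intro!: Max_ge)

lemma word_dist_commute: "word_dist p q = word_dist q p"
  unfolding word_dist_def by (simp add: split_beta abs_minus_commute)

lemma word_dist_triangle: "word_dist p r \<le> word_dist p q + word_dist q r"
proof -
  obtain t \<sigma> s \<sigma>' t' \<sigma>'' where [simp]: "p = (t, \<sigma>)" "q = (s, \<sigma>')" "r = (t', \<sigma>'')"
    by (cases p, cases q, cases r)
  show ?thesis
    unfolding \<open>p = _\<close> \<open>r = _\<close>
  proof (rule word_dist_leI)
    show "0 \<le> word_dist (t, \<sigma>) q + word_dist q (t', \<sigma>'')" using word_dist_nonneg by (simp add: add_nonneg_nonneg)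
    fix k x assume "k < K" "x \<in> V"
    then show "\<bar>word_coord k x t \<sigma> - word_coord k x t' \<sigma>''\<bar> \<le> word_dist (t, \<sigma>) q + word_dist q (t', \<sigma>'')"
      using word_coord_diff_le_word_dist[of k x t \<sigma> s \<sigma>'] word_coord_diff_le_word_dist[of k x s \<sigma>' t' \<sigma>''] by simp
  qed
qed

definition flow :: "real \<Rightarrow> nat \<times> (nat \<Rightarrow> nat set \<times> nat) \<Rightarrow> nat \<times> (nat \<Rightarrow> nat set \<times> nat) \<Rightarrow> real" where
  "flow \<theta> p q = flow_dist \<theta> (\<lambda>t \<sigma> \<sigma>'. \<theta> * u t \<sigma> \<sigma>') (real (fst p), snd p) (real (fst q), snd q)"

text \<open>Only the values 0 and 1 of \<zeta> are used in the end: 0 for bounded \<alpha>, where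
  the ultrametric alone suffices, and 1 for large \<alpha>.\<close>

definition gadget_dist :: "real \<Rightarrow> real \<Rightarrow> nat \<times> (nat \<Rightarrow> nat set \<times> nat) \<Rightarrow> nat \<times> (nat \<Rightarrow> nat set \<times> nat) \<Rightarrow> real" where
  "gadget_dist \<theta> \<zeta> p q = max (flow \<theta> p q) (\<zeta> * word_dist p q)"

lemma flow_eq: "flow \<theta> (t, \<sigma>) (s, \<sigma>') = sqrt ((real t - real s)\<^sup>2 +
    (max (max (\<theta> * u t \<sigma> \<sigma>') (\<theta> * u s \<sigma> \<sigma>')) (\<theta> * \<bar>real t - real s\<bar>))\<^sup>2)"
  by (simp add: flow_def flow_dist_def)

lemma flow_nonneg: "0 \<le> flow \<theta> p q"
  by (cases p; cases q) (simp add: flow_eq)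

lemma flow_commute: "flow \<theta> p q = flow \<theta> q p"
  by (cases p; cases q) (simp add: flow_eq power2_commute abs_minus_commute u_commute max.commute)

lemma time_le_flow: "\<bar>real t - real s\<bar> \<le> flow \<theta> (t, \<sigma>) (s, \<sigma>')"
  unfolding flow_eq by (rule real_le_rsqrt) simp

lemma u_le_flow:
  assumes "0 \<le> \<theta>"
  shows "\<theta> * u t \<sigma> \<sigma>' \<le> flow \<theta> (t, \<sigma>) (s, \<sigma>')"
  unfolding flow_eq
proof (rule real_le_rsqrt)
  have "(\<theta> * u t \<sigma> \<sigma>')\<^sup>2 \<le> (max (max (\<theta> * u t \<sigma> \<sigma>') (\<theta> * u s \<sigma> \<sigma>')) (\<theta> * \<bar>real t - real s\<bar>))\<^sup>2"
    using assms u_nonneg by (intro power_mono) auto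
  then show "(\<theta> * u t \<sigma> \<sigma>')\<^sup>2 \<le> (real t - real s)\<^sup>2 +
      (max (max (\<theta> * u t \<sigma> \<sigma>') (\<theta> * u s \<sigma> \<sigma>')) (\<theta> * \<bar>real t - real s\<bar>))\<^sup>2"
    by (simp add: add_increasing)
qed

text \<open>First the label is changed at time \<open>t\<close>, which costs
  \<open>2 * m / \<theta>\<close> because \<open>flow\<close> sees \<open>u\<close> only scaled by
  \<theta>; then the time is changed at fixed label, which costs 1.\<close>

lemma word_dist_le_flow:
  assumes \<theta>: "0 < \<theta>" and \<sigma>: "\<sigma> \<in> \<Omega>" "\<sigma>' \<in> \<Omega>"
  shows "word_dist (t, \<sigma>) (s, \<sigma>') \<le> (1 + 2 * m / \<theta>) * flow \<theta> (t, \<sigma>) (s, \<sigma>')"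
proof (rule word_dist_leI)
  show "0 \<le> (1 + 2 * m / \<theta>) * flow \<theta> (t, \<sigma>) (s, \<sigma>')"
    using \<theta> flow_nonneg by (intro mult_nonneg_nonneg) auto
  fix k x assume kx: "k < K" "x \<in> V"
  have "2 * m * u t \<sigma> \<sigma>' = 2 * m / \<theta> * (\<theta> * u t \<sigma> \<sigma>')" using \<theta> by simp
  also have "\<dots> \<le> 2 * m / \<theta> * flow \<theta> (t, \<sigma>) (s, \<sigma>')"
    using \<theta> u_le_flow by (intro mult_left_mono) auto
  finally have "\<bar>word_coord k x t \<sigma> - word_coord k x t \<sigma>'\<bar> \<le> 2 * m / \<theta> * flow \<theta> (t, \<sigma>) (s, \<sigma>')"
    using word_coord_space_le[OF \<sigma> kx, of t] by linarith
  moreover have "\<bar>word_coord k x t \<sigma>' - word_coord k x s \<sigma>'\<bar> \<le> flow \<theta> (t, \<sigma>) (s, \<sigma>')"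
    using word_coord_time_lipschitz[OF \<sigma>(2) kx, of t s] time_le_flow by (meson order_trans)
  ultimately show "\<bar>word_coord k x t \<sigma> - word_coord k x s \<sigma>'\<bar> \<le> (1 + 2 * m / \<theta>) * flow \<theta> (t, \<sigma>) (s, \<sigma>')"
    by (simp add: distrib_right)
qed

lemma gadget_dist_nonneg: "0 \<le> gadget_dist \<theta> \<zeta> p q"
  using flow_nonneg by (simp add: gadget_dist_def le_max_iff_disj)

lemma gadget_dist_commute: "gadget_dist \<theta> \<zeta> p q = gadget_dist \<theta> \<zeta> q p"
  unfolding gadget_dist_def flow_commute[of \<theta> p q] word_dist_commute[of p q] by (rule refl)

lemma gadget_dist_triangle:
  assumes \<theta>: "0 \<le> \<theta>" and \<zeta>: "0 \<le> \<zeta>" and \<Omega>: "snd p \<in> \<Omega>" "snd q \<in> \<Omega>" "snd r \<in> \<Omega>"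
  shows "gadget_dist \<theta> \<zeta> p r \<le> gadget_dist \<theta> \<zeta> p q + gadget_dist \<theta> \<zeta> q r"
proof -
  interpret ultrametric_flow \<Omega> "\<lambda>t \<sigma> \<sigma>'. \<theta> * u t \<sigma> \<sigma>'" \<theta> by (rule scaled_u_flow[OF \<theta>])
  have "flow \<theta> p r \<le> flow \<theta> p q + flow \<theta> q r"
    unfolding flow_def using \<Omega> by (rule flow_dist_triangle)
  moreover have "\<zeta> * word_dist p r \<le> \<zeta> * word_dist p q + \<zeta> * word_dist q r"
    using mult_left_mono[OF word_dist_triangle \<zeta>] by (simp add: distrib_left)
  ultimately show ?thesis unfolding gadget_dist_def by linarith
qed

lemma gadget_dist_between:
  assumes \<theta>: "0 < \<theta>" and \<zeta>: "0 \<le> \<zeta>" and A: "1 \<le> A" "\<zeta> * (1 + 2 * m / \<theta>) \<le> A"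
    and \<Omega>: "snd p \<in> \<Omega>" "snd q \<in> \<Omega>"
  shows "flow \<theta> p q \<le> gadget_dist \<theta> \<zeta> p q" "gadget_dist \<theta> \<zeta> p q \<le> A * flow \<theta> p q"
proof -
  show "flow \<theta> p q \<le> gadget_dist \<theta> \<zeta> p q" by (simp add: gadget_dist_def)
  have "\<zeta> * word_dist p q \<le> \<zeta> * ((1 + 2 * m / \<theta>) * flow \<theta> p q)"
    using word_dist_le_flow[OF \<theta> \<Omega>, of "fst p" "fst q"] \<zeta> by (intro mult_left_mono) auto
  also have "\<dots> = (\<zeta> * (1 + 2 * m / \<theta>)) * flow \<theta> p q" by (simp only: mult.assoc)
  also have "\<dots> \<le> A * flow \<theta> p q" using A flow_nonneg by (intro mult_right_mono)
  finally have "\<zeta> * word_dist p q \<le> A * flow \<theta> p q" .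
  moreover have "1 * flow \<theta> p q \<le> A * flow \<theta> p q" using A flow_nonneg by (intro mult_right_mono)
  ultimately show "gadget_dist \<theta> \<zeta> p q \<le> A * flow \<theta> p q" by (simp add: gadget_dist_def)
qed

text \<open>Two points receive the same value iff their distance is 0, so the image under this map
  is the quotient.\<close>

definition node_class :: "nat \<times> (nat \<Rightarrow> nat set \<times> nat) \<Rightarrow> nat \<times> (nat \<Rightarrow> nat set \<times> nat) set" where
  "node_class p = (fst p, {\<sigma>\<in>\<Omega>. u (fst p) (snd p) \<sigma> = 0})"

lemma node_class_eq_iff:
  assumes "\<sigma> \<in> \<Omega>" "\<sigma>' \<in> \<Omega>"
  shows "node_class (t, \<sigma>) = node_class (s, \<sigma>') \<longleftrightarrow> t = s \<and> u t \<sigma> \<sigma>' = 0"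
proof
  assume "node_class (t, \<sigma>) = node_class (s, \<sigma>')"
  then have "t = s" "{\<tau>\<in>\<Omega>. u t \<sigma> \<tau> = 0} = {\<tau>\<in>\<Omega>. u t \<sigma>' \<tau> = 0}" by (auto simp: node_class_def)
  then show "t = s \<and> u t \<sigma> \<sigma>' = 0" using assms u_refl[of t \<sigma>'] by blast
next
  assume eq: "t = s \<and> u t \<sigma> \<sigma>' = 0"
  have "u t \<sigma> \<tau> \<le> u t \<sigma>' \<tau>" "u t \<sigma>' \<tau> \<le> u t \<sigma> \<tau>" for \<tau>
    using u_ultra[of t \<sigma> \<tau> \<sigma>'] u_ultra[of t \<sigma>' \<tau> \<sigma>] eq u_commute[of t \<sigma> \<sigma>'] u_nonneg by (auto simp: max_def split: if_splits)
  then have "u t \<sigma> \<tau> = u t \<sigma>' \<tau>" for \<tau> by (intro antisym)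
  then show "node_class (t, \<sigma>) = node_class (s, \<sigma>')" using eq by (simp add: node_class_def)
qed

lemma gadget_dist_eq_0_iff:
  assumes "0 < \<theta>" "0 \<le> \<zeta>" and \<Omega>: "snd p \<in> \<Omega>" "snd q \<in> \<Omega>"
  shows "gadget_dist \<theta> \<zeta> p q = 0 \<longleftrightarrow> node_class p = node_class q"
proof -
  obtain t \<sigma> s \<sigma>' where pq: "p = (t, \<sigma>)" "q = (s, \<sigma>')" by (cases p, cases q)
  define A where "A = max 1 (\<zeta> * (1 + 2 * m / \<theta>))"
  have b: "flow \<theta> p q \<le> gadget_dist \<theta> \<zeta> p q" "gadget_dist \<theta> \<zeta> p q \<le> A * flow \<theta> p q"
    using gadget_dist_between[OF assms(1,2) _ _ \<Omega>, of A] by (auto simp: A_def)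
  have "flow \<theta> p q = 0 \<longleftrightarrow> t = s \<and> u t \<sigma> \<sigma>' = 0"
  proof
    assume z: "flow \<theta> p q = 0"
    have "\<bar>real t - real s\<bar> \<le> 0" "\<theta> * u t \<sigma> \<sigma>' \<le> 0"
      using time_le_flow[of t s \<theta> \<sigma> \<sigma>'] u_le_flow[of \<theta> t \<sigma> \<sigma>' s] assms(1) z pq by auto
    then show "t = s \<and> u t \<sigma> \<sigma>' = 0"
      using assms(1) u_nonneg[of t \<sigma> \<sigma>'] by (auto simp: mult_le_0_iff)
  qed (auto simp: pq flow_eq)
  moreover have "flow \<theta> p q = 0 \<longleftrightarrow> gadget_dist \<theta> \<zeta> p q = 0"
    using b flow_nonneg[of \<theta> p q] gadget_dist_nonneg[of \<theta> \<zeta> p q] by (metis antisym mult_zero_right)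
  ultimately show ?thesis using node_class_eq_iff \<Omega> pq by simp
qed

section \<open>Counting the points\<close>

lemma u_after_end:
  assumes "T ^ K \<le> t"
  shows "u (real t) \<sigma> \<sigma>' = 0"
proof -
  have "u t \<sigma> \<sigma>' \<le> 0"
    unfolding u_le_iff
  proof (intro conjI allI impI)
    fix k n assume "(k, n) \<in> nodes"
    then have "n + 1 \<le> T ^ (K - k)" "k < K" by (auto simp: nodes_def)
    then have "(n + 1) * T ^ k \<le> T ^ (K - k) * T ^ k" by (intro mult_le_mono1)
    moreover have "T ^ (K - k) * T ^ k = T ^ K" using \<open>k < K\<close> by (simp flip: power_add)
    ultimately have "n * T ^ k + T ^ k \<le> t" using assms by simp
    then have "real (n * T ^ k) + real (T ^ k) \<le> real t" by (metis of_nat_add of_nat_le_iff)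
    then show "hat k n t \<le> 0" unfolding hat_def by simp
  qed simp
  then show ?thesis using u_nonneg by (intro antisym) auto
qed

text \<open>At time \<open>t\<close> only the two nodes around \<open>t\<close> matter on each
  level, so a class is determined by \<open>t\<close> and two group elements per level. This gives
  \<open>4 ^ (m * K)\<close> choices for every time, and \<open>4 * m \<le> 4 ^ m\<close> bounds the
  number of times; 32 is \<open>2 * 4 * 4\<close>.\<close>

lemma card_node_class_le:
  assumes K: "0 < K"
  shows "card (node_class ` ({..T ^ K} \<times> \<Omega>)) \<le> 32 ^ (m * K)"
proof -
  define \<eta> where "\<eta> = (\<lambda>(t, \<sigma>). (t, \<lambda>k\<in>{..<K}. (val k (t div T ^ k) \<sigma>, val k (t div T ^ k + 1) \<sigma>)))"
  have "card (node_class ` ({..T ^ K} \<times> \<Omega>)) \<le> card (\<eta> ` ({..T ^ K} \<times> \<Omega>))"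
  proof (rule card_image_le_card_image)
    fix p q assume pq: "p \<in> {..T ^ K} \<times> \<Omega>" "q \<in> {..T ^ K} \<times> \<Omega>" "\<eta> p = \<eta> q"
    obtain t \<sigma> s \<sigma>' where [simp]: "p = (t, \<sigma>)" "q = (s, \<sigma>')" by (cases p, cases q)
    have ts: "t = s" using pq(3) by (simp add: \<eta>_def)
    have H: "(\<lambda>k\<in>{..<K}. (val k (t div T ^ k) \<sigma>, val k (t div T ^ k + 1) \<sigma>))
        = (\<lambda>k\<in>{..<K}. (val k (t div T ^ k) \<sigma>', val k (t div T ^ k + 1) \<sigma>'))"
      using pq(3) ts by (simp add: \<eta>_def)
    have eq: "val k (t div T ^ k) \<sigma> = val k (t div T ^ k) \<sigma>'"
      "val k (t div T ^ k + 1) \<sigma> = val k (t div T ^ k + 1) \<sigma>'" if "k < K" for k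
      using fun_cong[OF H, of k] that by simp_all
    have "u t \<sigma> \<sigma>' \<le> 0"
      unfolding u_le_iff
    proof (intro conjI allI impI)
      fix k n assume kn: "(k, n) \<in> nodes" "val k n \<sigma> \<noteq> val k n \<sigma>'"
      then have k: "k < K" by (simp add: nodes_def)
      define L where "L = T ^ k"
      have L: "0 < L" using T_pos by (simp add: L_def)
      have "n \<noteq> t div L" "n \<noteq> t div L + 1" using kn(2) eq[OF k] by (auto simp: L_def)
      then consider "n + 1 \<le> t div L" | "t div L + 2 \<le> n" by linarith
      then have "n * L + L \<le> t \<or> t + L \<le> n * L"
      proof cases
        case 1
        then have "(n + 1) * L \<le> t div L * L" by (rule mult_le_mono1)
        also have "\<dots> \<le> t" by simp
        finally show ?thesis by simp
      next
        case 2
        then have "(t div L + 2) * L \<le> n * L" by (rule mult_le_mono1)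
        moreover have "t < t div L * L + L" using L by (simp add: dividend_less_div_times add.commute)
        ultimately show ?thesis by simp
      qed
      then have "real (n * L) + real L \<le> real t \<or> real t + real L \<le> real (n * L)"
        by (metis of_nat_add of_nat_le_iff)
      then show "hat k n t \<le> 0" unfolding hat_def L_def[symmetric] by auto
    qed simp
    then have "u t \<sigma> \<sigma>' = 0" using u_nonneg by (intro antisym) auto
    then show "node_class p = node_class q" using ts pq node_class_eq_iff[of \<sigma> \<sigma>' t s] by simp
  qed (simp add: finite_\<Omega>)
  also have "\<dots> \<le> card ({..T ^ K} \<times> PiE {..<K} (\<lambda>_. V \<times> V))"
  proof (rule card_mono)
    show "finite ({..T ^ K} \<times> PiE {..<K} (\<lambda>_. V \<times> V))"
      by (intro finite_cartesian_product finite_PiE) (simp_all add: finite_V)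
    show "\<eta> ` ({..T ^ K} \<times> \<Omega>) \<subseteq> {..T ^ K} \<times> PiE {..<K} (\<lambda>_. V \<times> V)"
    proof (rule image_subsetI)
      fix p assume "p \<in> {..T ^ K} \<times> \<Omega>"
      then obtain t \<sigma> where "p = (t, \<sigma>)" "t \<in> {..T ^ K}" "\<sigma> \<in> \<Omega>" by blast
      then show "\<eta> p \<in> {..T ^ K} \<times> PiE {..<K} (\<lambda>_. V \<times> V)"
        using val_V[OF \<open>\<sigma> \<in> \<Omega>\<close>] by (simp add: \<eta>_def restrict_PiE_iff)
    qed
  qed
  also have "\<dots> = (T ^ K + 1) * (2 ^ m * 2 ^ m) ^ K"
    by (simp add: card_PiE card_cartesian_product card_V)
  also have "\<dots> \<le> (2 * 4 ^ (m * K)) * 4 ^ (m * K)"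
  proof (intro mult_mono)
    have "4 * j \<le> 4 ^ j" if "0 < j" for j :: nat
      using that by (induction j rule: nat_induct_non_zero) auto
    then have "T ^ K \<le> (4 ^ m) ^ K" unfolding T_def using m_pos by (intro power_mono) auto
    moreover have "1 \<le> T ^ K" using T_pos by (simp add: Suc_leI)
    ultimately show "T ^ K + 1 \<le> 2 * 4 ^ (m * K)" by (simp add: power_mult)
    have "(4 :: nat) ^ m = 2 ^ m * 2 ^ m" by (simp add: power_mult_distrib[symmetric])
    then show "((2 :: nat) ^ m * 2 ^ m) ^ K \<le> 4 ^ (m * K)" by (simp add: power_mult)
  qed auto
  also have "\<dots> \<le> 2 ^ (m * K) * 4 ^ (m * K) * 4 ^ (m * K)"
  proof -
    have "(2 :: nat) ^ 1 \<le> 2 ^ (m * K)" using m_pos K by (intro power_increasing) auto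
    then show ?thesis by (intro mult_le_mono) auto
  qed
  also have "\<dots> = 32 ^ (m * K)" by (simp add: power_mult_distrib[symmetric])
  finally show ?thesis .
qed

lemma card_node_class_extended:
  "card (node_class ` ({..T ^ K + r} \<times> \<Omega>)) = card (node_class ` ({..T ^ K} \<times> \<Omega>)) + r"
proof -
  have late: "node_class (t, \<sigma>) = (t, \<Omega>)" if "T ^ K \<le> t" for t \<sigma>
    using u_after_end[OF that] by (simp add: node_class_def)
  obtain \<sigma>0 where \<sigma>0: "\<sigma>0 \<in> \<Omega>" using \<Omega>_nonempty by blast
  have "node_class ` ({..T ^ K + r} \<times> \<Omega>)
      = node_class ` ({..T ^ K} \<times> \<Omega>) \<union> node_class ` ({T ^ K<..T ^ K + r} \<times> \<Omega>)"
    by (subst image_Un[symmetric]) (rule arg_cong[where f = "image node_class"], auto)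
  also have "node_class ` ({T ^ K<..T ^ K + r} \<times> \<Omega>) = (\<lambda>t. (t, \<Omega>)) ` {T ^ K<..T ^ K + r}"
    using late \<sigma>0 by (force simp: image_iff)
  also have "card (node_class ` ({..T ^ K} \<times> \<Omega>) \<union> \<dots>)
      = card (node_class ` ({..T ^ K} \<times> \<Omega>)) + card ((\<lambda>t. (t, \<Omega>)) ` {T ^ K<..T ^ K + r})"
    by (intro card_Un_disjoint) (auto simp: finite_\<Omega> node_class_def)
  also have "card ((\<lambda>t. (t, \<Omega>)) ` {T ^ K<..T ^ K + r}) = r"
    by (subst card_image) (auto simp: inj_on_def)
  finally show ?thesis .
qed

section \<open>Distortion of \<open>gadget_dist\<close> from below and scale by scale\<close>

lemma gadget_dist_time_step_le:
  assumes \<sigma>: "\<sigma> \<in> \<Omega>" and \<theta>: "0 \<le> \<theta>" "\<theta> \<le> 1" and \<zeta>: "0 \<le> \<zeta>" "\<zeta> \<le> 1"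
  shows "gadget_dist \<theta> \<zeta> (t + 1, \<sigma>) (t, \<sigma>) \<le> 2"
proof -
  have "\<theta>\<^sup>2 \<le> 1" using \<theta> by (simp add: power_le_one)
  then have "flow \<theta> (t + 1, \<sigma>) (t, \<sigma>) \<le> 2"
    using \<theta> unfolding flow_eq by (intro real_le_lsqrt) (simp_all add: u_refl max_def)
  moreover have "word_dist (t + 1, \<sigma>) (t, \<sigma>) \<le> 1"
    using word_coord_step_le[OF \<sigma>] by (intro word_dist_leI) auto
  then have "\<zeta> * word_dist (t + 1, \<sigma>) (t, \<sigma>) \<le> 1"
    using \<zeta> word_dist_nonneg by (intro mult_le_one) auto
  ultimately show ?thesis by (simp add: gadget_dist_def)
qed

lemma node_time_less:
  assumes "k < K" "B < T ^ (K - Suc k)" "j < m"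
  shows "B * T + (m + 2 * j) < T ^ (K - k)" "node_time k B j < T ^ K"
proof -
  have "B * T + (m + 2 * j) < (B + 1) * T" using assms(3) by (simp add: T_def)
  also have "\<dots> \<le> T ^ (K - Suc k) * T" using assms(2) by (intro mult_le_mono1) simp
  also have "\<dots> = T ^ Suc (K - Suc k)" by simp
  also have "\<dots> = T ^ (K - k)" using assms(1) by (simp add: Suc_diff_Suc)
  finally show lt: "B * T + (m + 2 * j) < T ^ (K - k)" .
  then have "node_time k B j < T ^ (K - k) * T ^ k"
    unfolding node_time_def using T_pos by (intro mult_less_mono1) auto
  also have "\<dots> = T ^ K" using assms(1) by (simp flip: power_add)
  finally show "node_time k B j < T ^ K" .
qed

text \<open>At the node time the tent has its full height \<open>T ^ k\<close>, and the word
  coordinate based at \<open>v'\<close> takes the values \<open>T ^ k * nrm (sym_diff v v')\<close>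
  and 0.\<close>

lemma gadget_dist_layer_ge:
  assumes \<theta>: "0 \<le> \<theta>" and \<zeta>: "0 \<le> \<zeta>" and k: "k < K" and B: "B < T ^ (K - Suc k)" and j: "j < m"
    and v: "v \<in> V" "v' \<in> V"
  shows "T ^ k * max (\<theta> * of_bool (v \<noteq> v')) (\<zeta> * nrm (sym_diff v v'))
    \<le> gadget_dist \<theta> \<zeta> (node_time k B j, \<sigma>(k := (v, 4 * m))) (node_time k B j, \<sigma>(k := (v', 4 * m)))"
proof -
  define n where "n = B * T + (m + 2 * j)"
  have n: "n < T ^ (K - k)" unfolding n_def by (rule node_time_less[OF k B j])
  have t: "node_time k B j = n * T ^ k" by (simp add: node_time_def n_def)
  have "m + 2 * j < T" using j by (simp add: T_def)
  then have "n mod T = m + 2 * j" by (simp add: n_def)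
  then have val: "val k n (\<sigma>(k := (x, 4 * m))) = x" if "x \<in> V" for x
    using n pos_even[OF that j] by (simp add: val_def)
  let ?p = "\<sigma>(k := (v, 4 * m))" and ?q = "\<sigma>(k := (v', 4 * m))"
  have "T ^ k * (\<theta> * of_bool (v \<noteq> v')) \<le> \<theta> * u (n * T ^ k) ?p ?q"
  proof (cases "v = v'")
    case False
    then have "hat k n (n * T ^ k) \<le> u (n * T ^ k) ?p ?q"
      using val v n k by (intro hat_le_u) (auto simp: nodes_def)
    then have "\<theta> * T ^ k \<le> \<theta> * u (n * T ^ k) ?p ?q"
      using \<theta> by (intro mult_left_mono) (auto simp: hat_def)
    then show ?thesis using False by (simp add: mult.commute)
  qed (use \<theta> u_nonneg in simp)
  also have "\<dots> \<le> flow \<theta> (n * T ^ k, ?p) (n * T ^ k, ?q)" by (rule u_le_flow[OF \<theta>])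
  finally have 1: "T ^ k * (\<theta> * of_bool (v \<noteq> v')) \<le> flow \<theta> (n * T ^ k, ?p) (n * T ^ k, ?q)" .
  have word_coord: "word_coord k v' (n * T ^ k) (\<sigma>(k := (x, 4 * m))) = T ^ k * nrm (sym_diff x v')" if "x \<in> V" for x
    using val[OF that] T_pos by (simp add: word_coord_def)
  have "T ^ k * nrm (sym_diff v v') \<le> word_dist (n * T ^ k, ?p) (n * T ^ k, ?q)"
    using word_coord_diff_le_word_dist[OF k v(2), of "n * T ^ k" ?p "n * T ^ k" ?q]
    unfolding word_coord[OF v(1)] word_coord[OF v(2)] by simp
  then have "\<zeta> * (T ^ k * nrm (sym_diff v v')) \<le> \<zeta> * word_dist (n * T ^ k, ?p) (n * T ^ k, ?q)"
    using \<zeta> by (rule mult_left_mono)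
  then have 2: "T ^ k * (\<zeta> * nrm (sym_diff v v')) \<le> \<zeta> * word_dist (n * T ^ k, ?p) (n * T ^ k, ?q)"
    by (simp only: mult.left_commute)
  have "T ^ k * max (\<theta> * of_bool (v \<noteq> v')) (\<zeta> * nrm (sym_diff v v'))
      = max (T ^ k * (\<theta> * of_bool (v \<noteq> v'))) (T ^ k * (\<zeta> * nrm (sym_diff v v')))"
    by (rule max_mult_distrib_left[THEN trans]) simp
  also have "\<dots> \<le> gadget_dist \<theta> \<zeta> (n * T ^ k, ?p) (n * T ^ k, ?q)"
    unfolding gadget_dist_def by (rule max.mono[OF 1 2])
  finally show ?thesis by (simp only: t)
qed

text \<open>\<open>\<Delta>\<close> bounds the root mean square of layer distances, in units of
  \<open>T ^ k\<close>, from below. A time step has length at most 2, so the right side of the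
  energy inequality is at most \<open>4 * A\<^sup>2\<close> per step and label, whereas each level
  yields \<open>\<Delta>\<^sup>2 / 64\<close>, up to \<open>B\<^sup>2\<close>. The 16 is the root of
  4 times 64.\<close>

lemma distortion_lower_bound:
  fixes h :: "nat \<times> (nat \<Rightarrow> nat set \<times> nat) \<Rightarrow> real \<Rightarrow> real"
  assumes \<theta>: "0 \<le> \<theta>" "\<theta> \<le> 1" and \<zeta>: "0 \<le> \<zeta>" "\<zeta> \<le> 1"
    and layer: "4 ^ m * \<Delta>\<^sup>2 \<le> (\<Sum>v\<in>V. \<Sum>v'\<in>V. (max (\<theta> * of_bool (v \<noteq> v')) (\<zeta> * nrm (sym_diff v v')))\<^sup>2)"
    and h: "\<And>p. h p \<in> L2" and inv: "\<And>t \<sigma> \<sigma>'. \<lbrakk>\<sigma> \<in> \<Omega>; \<sigma>' \<in> \<Omega>; u (real t) \<sigma> \<sigma>' = 0\<rbrakk> \<Longrightarrow> h (t, \<sigma>) = h (t, \<sigma>')"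
    and A: "0 \<le> A" and B: "0 \<le> B"
    and up: "\<And>p q. \<lbrakk>p \<in> {..T ^ K} \<times> \<Omega>; q \<in> {..T ^ K} \<times> \<Omega>\<rbrakk> \<Longrightarrow> L2_dist (h p) (h q) \<le> A * gadget_dist \<theta> \<zeta> p q"
    and low: "\<And>p q. \<lbrakk>p \<in> {..T ^ K} \<times> \<Omega>; q \<in> {..T ^ K} \<times> \<Omega>\<rbrakk> \<Longrightarrow> gadget_dist \<theta> \<zeta> p q \<le> B * L2_dist (h p) (h q)"
  shows "sqrt K * \<Delta> / 16 \<le> A * B"
proof -
  let ?M = "lebesgue_on {0..1 :: real}"
  define I where "I p q = (L2_dist (h p) (h q))\<^sup>2" for p q
  define X where "X k b j \<sigma> v = (node_time k b j, \<sigma>(k := (v, 4 * m)))" for k b j and \<sigma> :: "nat \<Rightarrow> nat set \<times> nat" and v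
  have int: "integrable ?M (\<lambda>x. (h p x - h q x)\<^sup>2)" for p q
    by (rule L2_diff_square_integrable[OF h h])
  have I_int: "I p q = integral\<^sup>L ?M (\<lambda>x. (h p x - h q x)\<^sup>2)" for p q
    by (simp add: I_def L2_dist_power2)
  \<comment> \<open>The scalar energy inequality is applied to the values of all functions at one
    point \<open>x\<close> and integrated over \<open>x\<close>.\<close>
  have energy: "(\<Sum>k<K. 1 / (16 * 4 ^ m * T ^ k) * (\<Sum>\<sigma>\<in>\<Omega>. \<Sum>b<T ^ (K - Suc k). \<Sum>j<m. \<Sum>v\<in>V. \<Sum>v'\<in>V.
        I (X k b j \<sigma> v) (X k b j \<sigma> v')))
    \<le> (\<Sum>\<sigma>\<in>\<Omega>. \<Sum>t<T ^ K. I (t + 1, \<sigma>) (t, \<sigma>))"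
  proof -
    have "(\<Sum>k<K. 1 / (16 * 4 ^ m * T ^ k) * (\<Sum>\<sigma>\<in>\<Omega>. \<Sum>b<T ^ (K - Suc k). \<Sum>j<m. \<Sum>v\<in>V. \<Sum>v'\<in>V.
        I (X k b j \<sigma> v) (X k b j \<sigma> v')))
      = integral\<^sup>L ?M (\<lambda>x. \<Sum>k<K. 1 / (16 * 4 ^ m * T ^ k) * (\<Sum>\<sigma>\<in>\<Omega>. \<Sum>b<T ^ (K - Suc k). \<Sum>j<m. \<Sum>v\<in>V. \<Sum>v'\<in>V.
        (h (X k b j \<sigma> v) x - h (X k b j \<sigma> v') x)\<^sup>2))"
      unfolding I_int by (simp only: Bochner_Integration.integral_sum Bochner_Integration.integrable_sum
          integral_mult_right_zero integrable_mult_right int)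
    also have "\<dots> \<le> integral\<^sup>L ?M (\<lambda>x. \<Sum>\<sigma>\<in>\<Omega>. \<Sum>t<T ^ K. (h (t + 1, \<sigma>) x - h (t, \<sigma>) x)\<^sup>2)"
    proof (rule integral_mono)
      show "integrable ?M (\<lambda>x. \<Sum>k<K. 1 / (16 * 4 ^ m * T ^ k) * (\<Sum>\<sigma>\<in>\<Omega>. \<Sum>b<T ^ (K - Suc k). \<Sum>j<m. \<Sum>v\<in>V. \<Sum>v'\<in>V.
        (h (X k b j \<sigma> v) x - h (X k b j \<sigma> v') x)\<^sup>2))"
        by (intro Bochner_Integration.integrable_sum integrable_mult_right int)
      show "integrable ?M (\<lambda>x. \<Sum>\<sigma>\<in>\<Omega>. \<Sum>t<T ^ K. (h (t + 1, \<sigma>) x - h (t, \<sigma>) x)\<^sup>2)"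
        by (intro Bochner_Integration.integrable_sum int)
      show "(\<Sum>k<K. 1 / (16 * 4 ^ m * T ^ k) * (\<Sum>\<sigma>\<in>\<Omega>. \<Sum>b<T ^ (K - Suc k). \<Sum>j<m. \<Sum>v\<in>V. \<Sum>v'\<in>V.
        (h (X k b j \<sigma> v) x - h (X k b j \<sigma> v') x)\<^sup>2)) \<le> (\<Sum>\<sigma>\<in>\<Omega>. \<Sum>t<T ^ K. (h (t + 1, \<sigma>) x - h (t, \<sigma>) x)\<^sup>2)" for x
        using energy_inequality[of "\<lambda>t \<sigma>. h (t, \<sigma>) x"] inv unfolding X_def by simp
    qed
    also have "\<dots> = (\<Sum>\<sigma>\<in>\<Omega>. \<Sum>t<T ^ K. I (t + 1, \<sigma>) (t, \<sigma>))"
      unfolding I_int by (simp only: Bochner_Integration.integral_sum Bochner_Integration.integrable_sum int)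
    finally show ?thesis .
  qed
  have lay: "T ^ k * T ^ k * (4 ^ m * \<Delta>\<^sup>2) \<le> B\<^sup>2 * (\<Sum>v\<in>V. \<Sum>v'\<in>V. I (X k b j \<sigma> v) (X k b j \<sigma> v'))"
    if k: "k < K" and \<sigma>: "\<sigma> \<in> \<Omega>" and b: "b < T ^ (K - Suc k)" and j: "j < m" for k b j \<sigma>
  proof -
    have "T ^ k * T ^ k * (4 ^ m * \<Delta>\<^sup>2)
      \<le> T ^ k * T ^ k * (\<Sum>v\<in>V. \<Sum>v'\<in>V. (max (\<theta> * of_bool (v \<noteq> v')) (\<zeta> * nrm (sym_diff v v')))\<^sup>2)"
      using layer by (intro mult_left_mono) auto
    also have "\<dots> = (\<Sum>v\<in>V. \<Sum>v'\<in>V. (T ^ k * max (\<theta> * of_bool (v \<noteq> v')) (\<zeta> * nrm (sym_diff v v')))\<^sup>2)"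
      by (simp add: sum_distrib_left power_mult_distrib power2_eq_square[of "T ^ k"] power2_eq_square[of "real T ^ k"])
    also have "\<dots> \<le> (\<Sum>v\<in>V. \<Sum>v'\<in>V. B\<^sup>2 * I (X k b j \<sigma> v) (X k b j \<sigma> v'))"
    proof (intro sum_mono)
      fix v v' assume v: "v \<in> V" "v' \<in> V"
      have mem: "X k b j \<sigma> x \<in> {..T ^ K} \<times> \<Omega>" if "x \<in> V" for x
        using that node_time_less(2)[OF k b j] fun_upd_\<Omega>[OF \<sigma> k] m_pos
        by (auto simp: X_def labels_def)
      have "T ^ k * max (\<theta> * of_bool (v \<noteq> v')) (\<zeta> * nrm (sym_diff v v')) \<le> gadget_dist \<theta> \<zeta> (X k b j \<sigma> v) (X k b j \<sigma> v')"
        unfolding X_def by (rule gadget_dist_layer_ge[OF \<theta>(1) \<zeta>(1) k b j v])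
      also have "\<dots> \<le> B * L2_dist (h (X k b j \<sigma> v)) (h (X k b j \<sigma> v'))"
        using low mem v by blast
      finally have "(T ^ k * max (\<theta> * of_bool (v \<noteq> v')) (\<zeta> * nrm (sym_diff v v')))\<^sup>2
          \<le> (B * L2_dist (h (X k b j \<sigma> v)) (h (X k b j \<sigma> v')))\<^sup>2"
        using \<theta> by (intro power_mono mult_nonneg_nonneg) (auto simp: le_max_iff_disj)
      then show "(T ^ k * max (\<theta> * of_bool (v \<noteq> v')) (\<zeta> * nrm (sym_diff v v')))\<^sup>2
          \<le> B\<^sup>2 * I (X k b j \<sigma> v) (X k b j \<sigma> v')"
        by (simp add: I_def power_mult_distrib)
    qed
    finally show ?thesis by (simp add: sum_distrib_left)
  qed
  \<comment> \<open>There are \<open>m * T ^ (K - Suc k)\<close> layers at level \<open>k\<close>,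
    each weighted by \<open>T ^ k / 16\<close>; as \<open>T = 4 * m\<close>, every level contributes
    the same amount.\<close>
  have level: "card \<Omega> * T ^ K * \<Delta>\<^sup>2 / 64
      \<le> B\<^sup>2 * (1 / (16 * 4 ^ m * T ^ k) * (\<Sum>\<sigma>\<in>\<Omega>. \<Sum>b<T ^ (K - Suc k). \<Sum>j<m. \<Sum>v\<in>V. \<Sum>v'\<in>V.
        I (X k b j \<sigma> v) (X k b j \<sigma> v')))" if k: "k < K" for k
  proof -
    have "T ^ K = T ^ (K - Suc k) * T * T ^ k"
      using k by (simp flip: power_add power_Suc2 add: Suc_diff_Suc)
    then have TK: "real T ^ K = real T ^ (K - Suc k) * (4 * m) * real T ^ k"
      by (metis T_def of_nat_mult of_nat_numeral of_nat_power)
    have "card \<Omega> * T ^ K * \<Delta>\<^sup>2 / 64 = 1 / (16 * 4 ^ m * T ^ k) *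
        (\<Sum>\<sigma>\<in>\<Omega>. \<Sum>b<T ^ (K - Suc k). \<Sum>j<m. T ^ k * T ^ k * (4 ^ m * \<Delta>\<^sup>2))"
      using T_pos by (simp add: TK field_simps)
    also have "\<dots> \<le> 1 / (16 * 4 ^ m * T ^ k) * (\<Sum>\<sigma>\<in>\<Omega>. \<Sum>b<T ^ (K - Suc k). \<Sum>j<m.
        B\<^sup>2 * (\<Sum>v\<in>V. \<Sum>v'\<in>V. I (X k b j \<sigma> v) (X k b j \<sigma> v')))"
      using lay k by (intro mult_left_mono sum_mono) auto
    also have "\<dots> = B\<^sup>2 * (1 / (16 * 4 ^ m * T ^ k) * (\<Sum>\<sigma>\<in>\<Omega>. \<Sum>b<T ^ (K - Suc k). \<Sum>j<m. \<Sum>v\<in>V. \<Sum>v'\<in>V.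
        I (X k b j \<sigma> v) (X k b j \<sigma> v')))"
      by (simp only: sum_distrib_left[symmetric] mult.left_commute)
    finally show ?thesis .
  qed
  have upper: "(\<Sum>\<sigma>\<in>\<Omega>. \<Sum>t<T ^ K. I (t + 1, \<sigma>) (t, \<sigma>)) \<le> card \<Omega> * T ^ K * (4 * A\<^sup>2)"
  proof -
    have "(\<Sum>\<sigma>\<in>\<Omega>. \<Sum>t<T ^ K. I (t + 1, \<sigma>) (t, \<sigma>)) \<le> (\<Sum>\<sigma>\<in>\<Omega>. \<Sum>t<T ^ K. 4 * A\<^sup>2)"
    proof (intro sum_mono)
      fix \<sigma> t assume "\<sigma> \<in> \<Omega>" "t \<in> {..<T ^ K}"
      then have "L2_dist (h (t + 1, \<sigma>)) (h (t, \<sigma>)) \<le> A * gadget_dist \<theta> \<zeta> (t + 1, \<sigma>) (t, \<sigma>)"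
        by (intro up) auto
      also have "\<dots> \<le> A * 2" using gadget_dist_time_step_le \<open>\<sigma> \<in> \<Omega>\<close> \<theta> \<zeta> A by (intro mult_left_mono) auto
      finally have "I (t + 1, \<sigma>) (t, \<sigma>) \<le> (A * 2)\<^sup>2"
        unfolding I_def using L2_dist_nonneg by (intro power_mono) auto
      then show "I (t + 1, \<sigma>) (t, \<sigma>) \<le> 4 * A\<^sup>2" by (simp add: power_mult_distrib)
    qed
    then show ?thesis by simp
  qed
  have pos: "0 < real (card \<Omega> * T ^ K)"
    using finite_\<Omega> \<Omega>_nonempty T_pos by (simp add: card_gt_0_iff)
  have "K * (card \<Omega> * T ^ K * \<Delta>\<^sup>2 / 64)
      \<le> (\<Sum>k<K. B\<^sup>2 * (1 / (16 * 4 ^ m * T ^ k) * (\<Sum>\<sigma>\<in>\<Omega>. \<Sum>b<T ^ (K - Suc k). \<Sum>j<m. \<Sum>v\<in>V. \<Sum>v'\<in>V.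
        I (X k b j \<sigma> v) (X k b j \<sigma> v'))))"
    using sum_mono[of "{..<K}", OF level] by simp
  also have "\<dots> \<le> B\<^sup>2 * (card \<Omega> * T ^ K * (4 * A\<^sup>2))"
    unfolding sum_distrib_left[symmetric, of "B\<^sup>2"] using energy upper
    by (intro mult_left_mono) (auto intro: order_trans)
  finally have "real (card \<Omega> * T ^ K) * (K * \<Delta>\<^sup>2) \<le> real (card \<Omega> * T ^ K) * (256 * (A * B)\<^sup>2)"
    by (simp add: power_mult_distrib mult_ac)
  then have "K * \<Delta>\<^sup>2 \<le> 256 * (A * B)\<^sup>2" using pos by (simp only: mult_le_cancel_left_pos)
  then have "(sqrt K * \<Delta>)\<^sup>2 \<le> (16 * (A * B))\<^sup>2" by (simp add: power_mult_distrib)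
  then have "sqrt K * \<Delta> \<le> 16 * (A * B)" by (rule power2_le_imp_le) (use A B in simp)
  then show ?thesis by simp
qed

text \<open>\<open>gadget_dist\<close> lies between \<open>flow\<close> and \<open>A\<close> times
  \<open>flow\<close>, so its scale \<open>2 powi k\<close> is served by the map for
  \<open>flow\<close> at scale \<open>2 powi k / A\<close>, with loss \<open>a\<close>.\<close>

lemma gadget_dist_every_scale_embeds:
  fixes a A S \<theta> \<zeta> :: real
  assumes \<theta>: "0 < \<theta>" and \<zeta>: "0 \<le> \<zeta>" and A: "1 \<le> A" "\<zeta> * (1 + 2 * m / \<theta>) \<le> A" and S: "0 < S" and a: "0 < a"
    and ratio: "1 / a \<le> (1 - \<theta> - 2 * \<theta> * S - pi / S) / (1 + pi / S)"
    and rep: "\<And>i. i \<in> X \<Longrightarrow> rep i \<in> {..M} \<times> \<Omega>"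
    and d: "\<And>i j. \<lbrakk>i \<in> X; j \<in> X\<rbrakk> \<Longrightarrow> d i j = gadget_dist \<theta> \<zeta> (rep i) (rep j)"
  shows "every_scale_embeds X d (a * A)"
  unfolding every_scale_embeds_def
proof
  fix k :: int
  interpret ultrametric_flow \<Omega> "\<lambda>t \<sigma> \<sigma>'. \<theta> * u t \<sigma> \<sigma>'" \<theta>
    by (rule scaled_u_flow) (use \<theta> in simp)
  define R where "R = 2 powi k / A"
  have R: "0 < R" using A by (simp add: R_def)
  obtain J :: "(nat \<times> real \<times> (nat \<Rightarrow> nat set \<times> nat) set) option set" and \<phi> where J: "finite J" and
    up: "\<And>t s x y. \<lbrakk>0 \<le> t; t \<le> real M; 0 \<le> s; s \<le> real M; x \<in> \<Omega>; y \<in> \<Omega>\<rbrakk> \<Longrightarrow>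
       L2_set (\<lambda>j. \<phi> (t, x) j - \<phi> (s, y) j) J \<le> flow_dist \<theta> (\<lambda>t \<sigma> \<sigma>'. \<theta> * u t \<sigma> \<sigma>') (t, x) (s, y)" and
    low: "\<And>t s x y. \<lbrakk>0 \<le> t; t \<le> real M; 0 \<le> s; s \<le> real M; x \<in> \<Omega>; y \<in> \<Omega>;
         R \<le> flow_dist \<theta> (\<lambda>t \<sigma> \<sigma>'. \<theta> * u t \<sigma> \<sigma>') (t, x) (s, y)\<rbrakk> \<Longrightarrow>
       R * (1 - \<theta> - 2 * \<theta> * S - pi / S) / (1 + pi / S) \<le> L2_set (\<lambda>j. \<phi> (t, x) j - \<phi> (s, y) j) J"
    using flow_scale_embeds[OF R S, of "real M"] by blast
  obtain \<psi> where \<psi>: "\<And>p. \<psi> p \<in> L2" "\<And>p q. L2_dist (\<psi> p) (\<psi> q) = L2_set (\<lambda>j. \<phi> p j - \<phi> q j) J"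
    using finite_dim_embeds_L2[OF J, of \<phi>] by blast
  define f where "f i = \<psi> (real (fst (rep i)), snd (rep i))" for i
  have rep': "fst (rep i) \<le> M" "snd (rep i) \<in> \<Omega>" if "i \<in> X" for i
    using rep[OF that] by (auto simp: mem_Times_iff)
  have fl: "flow \<theta> (rep i) (rep j) \<le> d i j" "d i j \<le> A * flow \<theta> (rep i) (rep j)" if "i \<in> X" "j \<in> X" for i j
    using gadget_dist_between[OF \<theta> \<zeta> A rep'(2)[OF that(1)] rep'(2)[OF that(2)]] d[OF that] by auto
  show "\<exists>\<phi>\<in>X \<rightarrow> L2. (\<forall>x\<in>X. \<forall>y\<in>X. L2_dist (\<phi> x) (\<phi> y) \<le> d x y) \<and>
      (\<forall>x\<in>X. \<forall>y\<in>X. 2 powi k \<le> d x y \<longrightarrow> 2 powi k / (a * A) \<le> L2_dist (\<phi> x) (\<phi> y))"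
  proof (intro bexI conjI ballI impI)
    show "f \<in> X \<rightarrow> L2" using \<psi>(1) by (simp add: f_def)
    fix i j assume ij: "i \<in> X" "j \<in> X"
    have "L2_dist (f i) (f j) \<le> flow \<theta> (rep i) (rep j)"
      unfolding f_def \<psi>(2) flow_def using rep' ij by (intro up) auto
    then show "L2_dist (f i) (f j) \<le> d i j" using fl(1)[OF ij] by simp
    assume "2 powi k \<le> d i j"
    then have "2 powi k \<le> A * flow \<theta> (rep i) (rep j)" using fl(2)[OF ij] by simp
    then have "R \<le> flow \<theta> (rep i) (rep j)" using A by (simp add: R_def pos_divide_le_eq mult.commute)
    then have "R * (1 - \<theta> - 2 * \<theta> * S - pi / S) / (1 + pi / S) \<le> L2_dist (f i) (f j)"
      unfolding f_def \<psi>(2) flow_def using rep' ij by (intro low) auto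
    moreover have "R * (1 / a) \<le> R * ((1 - \<theta> - 2 * \<theta> * S - pi / S) / (1 + pi / S))"
      using ratio R by (intro mult_left_mono) auto
    ultimately show "2 powi k / (a * A) \<le> L2_dist (f i) (f j)"
      using A by (simp add: R_def mult.commute)
  qed
qed

lemma ex_space:
  fixes a A S \<theta> \<zeta> \<Delta> :: real
  assumes K: "0 < K" and n: "32 ^ (m * K) \<le> n"
    and \<theta>: "0 < \<theta>" "\<theta> \<le> 1" and \<zeta>: "0 \<le> \<zeta>" "\<zeta> \<le> 1"
    and A: "1 \<le> A" "\<zeta> * (1 + 2 * m / \<theta>) \<le> A" and S: "0 < S" and a: "0 < a"
    and ratio: "1 / a \<le> (1 - \<theta> - 2 * \<theta> * S - pi / S) / (1 + pi / S)"
    and layer: "4 ^ m * \<Delta>\<^sup>2 \<le> (\<Sum>v\<in>V. \<Sum>v'\<in>V. (max (\<theta> * of_bool (v \<noteq> v')) (\<zeta> * nrm (sym_diff v v')))\<^sup>2)"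
  shows "\<exists>(X :: nat set) d. Metric_space X d \<and> finite X \<and> card X = n \<and>
    every_scale_embeds X d (a * A) \<and> requires_Euclidean_distortion X d (sqrt K * \<Delta> / 16)"
proof -
  \<comment> \<open>The additional times that fill up the cardinality to exactly
    \<open>n\<close>.\<close>
  define r where "r = n - card (node_class ` ({..T ^ K} \<times> \<Omega>))"
  define P where "P = {..T ^ K + r} \<times> \<Omega>"
  have "card (node_class ` ({..T ^ K} \<times> \<Omega>)) \<le> n"
    using card_node_class_le[OF K] n by (rule order_trans)
  then have card: "card (node_class ` P) = n"
    unfolding P_def card_node_class_extended r_def by simp
  have P\<Omega>: "snd p \<in> \<Omega>" if "p \<in> P" for p using that by (auto simp: P_def)
  have finP: "finite P" by (simp add: P_def finite_\<Omega>)
  have zero: "gadget_dist \<theta> \<zeta> p q = 0 \<longleftrightarrow> node_class p = node_class q" if "p \<in> P" "q \<in> P" for p q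
    using gadget_dist_eq_0_iff[OF \<theta>(1) \<zeta>(1) P\<Omega> P\<Omega>] that by blast
  have tri: "gadget_dist \<theta> \<zeta> p r \<le> gadget_dist \<theta> \<zeta> p q + gadget_dist \<theta> \<zeta> q r" if "p \<in> P" "q \<in> P" "r \<in> P" for p q r
    using gadget_dist_triangle[OF less_imp_le[OF \<theta>(1)] \<zeta>(1) P\<Omega> P\<Omega> P\<Omega>] that by blast
  obtain d cls rep where M: "Metric_space {..<n} d"
    and cls: "\<And>p. p \<in> P \<Longrightarrow> cls p < n" "\<And>p q. node_class p = node_class q \<Longrightarrow> cls p = cls q"
    and d: "\<And>p q. \<lbrakk>p \<in> P; q \<in> P\<rbrakk> \<Longrightarrow> d (cls p) (cls q) = gadget_dist \<theta> \<zeta> p q"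
    and rep: "\<And>i. i < n \<Longrightarrow> rep i \<in> P \<and> cls (rep i) = i"
    using finite_pseudometric_quotient[of P "gadget_dist \<theta> \<zeta>" node_class, unfolded card,
        OF finP gadget_dist_nonneg gadget_dist_commute tri zero] by blast
  have "every_scale_embeds {..<n} d (a * A)"
  proof (rule gadget_dist_every_scale_embeds[OF \<theta>(1) \<zeta>(1) A S a ratio])
    show "rep i \<in> {..T ^ K + r} \<times> \<Omega>" if "i \<in> {..<n}" for i
      using rep that unfolding P_def by blast
    show "d i j = gadget_dist \<theta> \<zeta> (rep i) (rep j)" if "i \<in> {..<n}" "j \<in> {..<n}" for i j
      using rep that d by (metis lessThan_iff)
  qed
  moreover have "requires_Euclidean_distortion {..<n} d (sqrt K * \<Delta> / 16)"
  proof (rule requires_Euclidean_distortionI[OF M])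
    have "(32 :: nat) ^ 1 \<le> 32 ^ (m * K)" using m_pos K by (intro power_increasing) auto
    then have n2: "2 \<le> n" using n by simp
    show "0 \<in> {..<n}" "1 \<in> {..<n}" using n2 by auto
    fix f A' B assume f: "f \<in> {..<n} \<rightarrow> L2" and A': "0 \<le> A'" and B: "0 \<le> B"
      and up: "\<And>x y. \<lbrakk>x \<in> {..<n}; y \<in> {..<n}\<rbrakk> \<Longrightarrow> L2_dist (f x) (f y) \<le> A' * d x y"
      and low: "\<And>x y. \<lbrakk>x \<in> {..<n}; y \<in> {..<n}\<rbrakk> \<Longrightarrow> d x y \<le> B * L2_dist (f x) (f y)"
    \<comment> \<open>The lower bound speaks of maps on all pairs, so \<open>f\<close> is pulled
      back to the classes and extended by the zero function.\<close>
    define h where "h p = (if cls p < n then f (cls p) else (\<lambda>_. 0))" for p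
    have sub: "p \<in> P" if "p \<in> {..T ^ K} \<times> \<Omega>" for p using that by (auto simp: P_def)
    have hP: "h p = f (cls p)" if "p \<in> P" for p using cls(1)[OF that] by (simp add: h_def)
    show "sqrt K * \<Delta> / 16 \<le> A' * B"
    proof (rule distortion_lower_bound[OF _ \<theta>(2) \<zeta> layer _ _ A' B])
      show "0 \<le> \<theta>" using \<theta> by simp
      have "(\<lambda>_. 0) \<in> L2" by (simp add: L2_def)
      then show "h p \<in> L2" for p using f by (auto simp: h_def)
      show "h (t, \<sigma>) = h (t, \<sigma>')" if "\<sigma> \<in> \<Omega>" "\<sigma>' \<in> \<Omega>" "u (real t) \<sigma> \<sigma>' = 0" for t \<sigma> \<sigma>'
        using cls(2)[of "(t, \<sigma>)" "(t, \<sigma>')"] node_class_eq_iff[OF that(1,2)] that(3) by (simp add: h_def)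
      fix p q assume "p \<in> {..T ^ K} \<times> \<Omega>" "q \<in> {..T ^ K} \<times> \<Omega>"
      then have pq: "p \<in> P" "q \<in> P" using sub by auto
      show "L2_dist (h p) (h q) \<le> A' * gadget_dist \<theta> \<zeta> p q"
        using up[of "cls p" "cls q"] cls(1) pq d[OF pq] by (simp add: hP)
      show "gadget_dist \<theta> \<zeta> p q \<le> B * L2_dist (h p) (h q)"
        using low[of "cls p" "cls q"] cls(1) pq d[OF pq] by (simp add: hP)
    qed
  qed auto
  ultimately show ?thesis using M by (intro exI[of _ "{..<n}"] exI[of _ d]) simp
qed

text \<open>At least half of the pairs in a layer are distinct, and a quarter is enough.\<close>

lemma layer_discrete:
  "4 ^ m * (\<theta> / 2)\<^sup>2 \<le> (\<Sum>v\<in>V. \<Sum>v'\<in>V. (max (\<theta> * of_bool (v \<noteq> v')) (0 * nrm (sym_diff v v')))\<^sup>2)"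
  if "0 \<le> \<theta>"
proof -
  have "(\<Sum>v'\<in>V. (max (\<theta> * of_bool (v \<noteq> v')) (0 * nrm (sym_diff v v')))\<^sup>2) = (2 ^ m - 1) * \<theta>\<^sup>2"
    if v: "v \<in> V" for v
  proof -
    have "(\<Sum>v'\<in>V. (max (\<theta> * of_bool (v \<noteq> v')) (0 * nrm (sym_diff v v')))\<^sup>2) = (\<Sum>v'\<in>V. if v' = v then 0 else \<theta>\<^sup>2)"
      using \<open>0 \<le> \<theta>\<close> by (intro sum.cong) auto
    also have "\<dots> = (\<Sum>v'\<in>V - {v}. \<theta>\<^sup>2)"
      using finite_V v by (intro sum.mono_neutral_cong_right) auto
    also have "\<dots> = (2 ^ m - 1) * \<theta>\<^sup>2"
      using finite_V v by (simp add: card_V of_nat_diff)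
    finally show ?thesis .
  qed
  then have "(\<Sum>v\<in>V. \<Sum>v'\<in>V. (max (\<theta> * of_bool (v \<noteq> v')) (0 * nrm (sym_diff v v')))\<^sup>2)
      = 2 ^ m * ((2 ^ m - 1) * \<theta>\<^sup>2)" by (simp add: card_V)
  moreover have "(2 :: real) ^ 1 \<le> 2 ^ m"
    using m_pos by (intro power_increasing) auto
  then have "2 ^ m / 4 \<le> (2 :: real) ^ m - 1" by simp
  then have "2 ^ m * (2 ^ m / 4 * \<theta>\<^sup>2) \<le> 2 ^ m * ((2 ^ m - 1) * \<theta>\<^sup>2)"
    by (intro mult_left_mono mult_right_mono) auto
  moreover have "(4 :: real) ^ m = 2 ^ m * 2 ^ m" by (simp add: power_mult_distrib[symmetric])
  ultimately show ?thesis by (simp add: power_divide)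
qed

text \<open>By translation invariance every \<open>v\<close> sees the same sum of squared norms;
  1024, the square of 32, leaves a factor 2 to spare.\<close>

lemma layer_word:
  assumes "0 \<le> \<theta>"
  shows "4 ^ m * (real m / 32)\<^sup>2 \<le> (\<Sum>v\<in>V. \<Sum>v'\<in>V. (max (\<theta> * of_bool (v \<noteq> v')) (1 * nrm (sym_diff v v')))\<^sup>2)"
proof -
  have one: "2 ^ m * (real m)\<^sup>2 / 512 \<le> (\<Sum>v'\<in>V. (nrm (sym_diff v v'))\<^sup>2)" if v: "v \<in> V" for v
  proof -
    have "(\<Sum>v'\<in>V. (nrm (sym_diff v v'))\<^sup>2) = (\<Sum>v'\<in>V. (nrm (sym_diff v' v))\<^sup>2)"
      by (intro sum.cong refl arg_cong[where f = "\<lambda>x. (nrm x)\<^sup>2"]) auto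
    also have "\<dots> = (\<Sum>v'\<in>V. (nrm v')\<^sup>2)"
      unfolding V_def using v by (intro sum_sym_diff_shift) (simp add: V_def)
    also have "\<dots> \<ge> 2 ^ m * (real m)\<^sup>2 / 512"
      using sum_word_norm_ge[OF m_pos, of norm_gen] V_subset_span by (simp add: nrm_def V_def)
    finally show ?thesis .
  qed
  have "4 ^ m * (real m / 32)\<^sup>2 \<le> 2 ^ m * (2 ^ m * (real m)\<^sup>2 / 512)"
  proof -
    have "(4 :: real) ^ m = 2 ^ m * 2 ^ m" by (simp add: power_mult_distrib[symmetric])
    moreover have "(real m / 32)\<^sup>2 \<le> (real m)\<^sup>2 / 512" by (simp add: power_divide)
    then have "(2 ^ m * 2 ^ m) * (real m / 32)\<^sup>2 \<le> (2 ^ m * 2 ^ m) * ((real m)\<^sup>2 / 512)"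
      by (intro mult_left_mono) auto
    ultimately show ?thesis by simp
  qed
  also have "\<dots> = (\<Sum>v\<in>V. 2 ^ m * (real m)\<^sup>2 / 512)" by (simp add: card_V)
  also have "\<dots> \<le> (\<Sum>v\<in>V. \<Sum>v'\<in>V. (nrm (sym_diff v v'))\<^sup>2)" by (intro sum_mono one)
  also have "\<dots> \<le> (\<Sum>v\<in>V. \<Sum>v'\<in>V. (max (\<theta> * of_bool (v \<noteq> v')) (1 * nrm (sym_diff v v')))\<^sup>2)"
    using nrm_nonneg by (intro sum_mono power_mono) auto
  finally show ?thesis .
qed

end

section \<open>Choice of parameters\<close>

lemma every_scale_embeds_mono:
  assumes "every_scale_embeds X d \<alpha>" "0 < \<alpha>" "\<alpha> \<le> \<beta>"
  shows "every_scale_embeds X d \<beta>"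
proof -
  have le: "2 powi k / \<beta> \<le> 2 powi k / \<alpha>" for k :: int
    using assms(2,3) by (intro divide_left_mono) auto
  show ?thesis
    unfolding every_scale_embeds_def
  proof
    fix k :: int
    obtain \<phi> where "\<phi> \<in> X \<rightarrow> L2" "\<forall>x\<in>X. \<forall>y\<in>X. L2_dist (\<phi> x) (\<phi> y) \<le> d x y"
      "\<forall>x\<in>X. \<forall>y\<in>X. 2 powi k \<le> d x y \<longrightarrow> 2 powi k / \<alpha> \<le> L2_dist (\<phi> x) (\<phi> y)"
      using assms(1) unfolding every_scale_embeds_def by blast
    then show "\<exists>\<phi>\<in>X \<rightarrow> L2. (\<forall>x\<in>X. \<forall>y\<in>X. L2_dist (\<phi> x) (\<phi> y) \<le> d x y) \<and>
        (\<forall>x\<in>X. \<forall>y\<in>X. 2 powi k \<le> d x y \<longrightarrow> 2 powi k / \<beta> \<le> L2_dist (\<phi> x) (\<phi> y))"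
      using le[of k] by (meson order_trans)
  qed
qed

lemma requires_Euclidean_distortion_mono:
  "\<lbrakk>requires_Euclidean_distortion X d C; C' \<le> C\<rbrakk> \<Longrightarrow> requires_Euclidean_distortion X d C'"
  unfolding requires_Euclidean_distortion_def by (meson order_trans)

text \<open>\<open>K\<close> is the integral part of a real number that is at least 1, so rounding
  down loses at most a factor 2.\<close>

lemma ex_depth:
  assumes m: "0 < m" and le: "real m \<le> ln (real n) / ln 32"
  obtains K :: nat where "0 < K" "32 ^ (m * K) \<le> n" "ln (real n) / ln 32 \<le> 2 * (real m * real K)"
proof -
  define q where "q = ln (real n) / ln 32 / m"
  define K where "K = nat \<lfloor>q\<rfloor>"
  have q: "1 \<le> q"
    unfolding q_def using m le by (simp only: pos_le_divide_eq of_nat_0_less_iff mult_1)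
  then have K: "real K \<le> q" "q < real K + 1" "1 \<le> K" by (auto simp: K_def le_nat_floor)
  have "0 < n" using le m by (cases "n = 0") auto
  have "real (m * K) \<le> ln (real n) / ln 32"
    using K(1) m by (simp add: q_def pos_le_divide_eq mult.commute)
  then have "real (m * K) * ln 32 \<le> ln (real n)" by (simp add: pos_le_divide_eq)
  then have "ln ((32 :: real) ^ (m * K)) \<le> ln (real n)" by (simp add: ln_realpow)
  then have "(32 :: real) ^ (m * K) \<le> real n" using \<open>0 < n\<close> by (subst (asm) ln_le_cancel_iff) auto
  then have "32 ^ (m * K) \<le> n" by (metis of_nat_le_iff of_nat_numeral of_nat_power)
  moreover have "q \<le> 2 * real K" using K by linarith
  then have "q * m \<le> 2 * real K * m" by (intro mult_right_mono) auto
  then have "ln (real n) / ln 32 \<le> 2 * (real m * real K)" using m by (simp add: q_def mult_ac)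
  moreover have "0 < K" using K(3) by simp
  ultimately show ?thesis by (intro that)
qed

text \<open>\<open>\<delta>\<close> solves
  \<open>(1 - 2 * \<delta>) / (1 + \<delta>) = 1 / a\<close>. One \<delta> is allowed for the
  partition of unity, which fixes the window \<open>S\<close>, and one for the drift of the
  ultrametric during a window, which then fixes \<theta>.\<close>

lemma ex_scale_parameters:
  fixes a :: real
  assumes a: "1 < a"
  obtains S \<theta> where "0 < S" "0 < \<theta>" "\<theta> \<le> 1" "1 / a \<le> (1 - \<theta> - 2 * \<theta> * S - pi / S) / (1 + pi / S)"
proof -
  define \<delta> where "\<delta> = (a - 1) / (2 * a + 1)"
  define S where "S = pi / \<delta>"
  define \<theta> where "\<theta> = min 1 (\<delta> / (1 + 2 * S))"
  have \<delta>: "0 < \<delta>" using a by (simp add: \<delta>_def)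
  have S: "0 < S" "pi / S = \<delta>" using \<delta> by (auto simp: S_def)
  have \<theta>: "0 < \<theta>" "\<theta> \<le> 1" using \<delta> S by (auto simp: \<theta>_def)
  have "\<theta> \<le> \<delta> / (1 + 2 * S)" by (simp add: \<theta>_def)
  then have "\<theta> * (1 + 2 * S) \<le> \<delta>" using S by (simp add: pos_le_divide_eq)
  then have "1 - 2 * \<delta> \<le> 1 - \<theta> - 2 * \<theta> * S - \<delta>" by (simp add: algebra_simps)
  then have "(1 - 2 * \<delta>) / (1 + \<delta>) \<le> (1 - \<theta> - 2 * \<theta> * S - \<delta>) / (1 + \<delta>)"
    using \<delta> by (intro divide_right_mono) auto
  moreover have "1 / a = (1 - 2 * \<delta>) / (1 + \<delta>)"
  proof -
    have "\<delta> * (2 * a + 1) = a - 1" using a by (simp add: \<delta>_def)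
    then have eq: "1 + \<delta> = a * (1 - 2 * \<delta>)" by (simp add: algebra_simps)
    then have "1 - 2 * \<delta> \<noteq> 0" using \<delta> by auto
    then show ?thesis unfolding eq using a by simp
  qed
  ultimately show ?thesis using that S \<theta> by metis
qed

text \<open>The locale predicate depends on \<open>m\<close> and \<open>g\<close> only, so one group
  serves every depth \<open>K\<close>.\<close>

lemma ex_gadget:
  assumes "0 < m"
  shows "\<exists>g. gadget m g"
proof -
  obtain g where g: "\<And>c. g c \<subseteq> {..<m}"
    "\<And>w. \<lbrakk>w \<subseteq> {..<m}; w \<noteq> {}\<rbrakk> \<Longrightarrow> real m / 2 \<le> card {c\<in>{..<4 * m}. walsh w (g c) = -1}"
    using ex_expanding_generators[OF assms] by blast
  have "gadget m g" by (rule gadget.intro) (fact assms, fact g(1), fact g(2))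
  then show ?thesis by blast
qed

text \<open>Both parts of the theorem need this uniformity: \<open>c\<close> is fixed before
  \<open>n\<close> and \<alpha>. The group has dimension \<open>m\<close> about
  \<open>b * \<alpha>\<close>, or 1 if that is too small, and the depth uses up the remaining
  cardinality.\<close>

lemma tight_spaces_uniform:
  fixes a C :: real
  assumes a: "1 < a" and C: "0 < C"
  shows "\<exists>c>0. \<forall>n \<alpha>. 32 \<le> n \<longrightarrow> a \<le> \<alpha> \<longrightarrow> \<alpha> \<le> C * ln (real n) \<longrightarrow>
    (\<exists>(X :: nat set) d. Metric_space X d \<and> finite X \<and> card X = n \<and>
      every_scale_embeds X d \<alpha> \<and> requires_Euclidean_distortion X d (c * sqrt (\<alpha> * ln (real n))))"
proof -
  obtain S \<theta> where S: "0 < S" and \<theta>: "0 < \<theta>" "\<theta> \<le> 1"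
    and ratio: "1 / a \<le> (1 - \<theta> - 2 * \<theta> * S - pi / S) / (1 + pi / S)"
    using ex_scale_parameters[OF a] .
  define L :: real where "L = ln 32"
  have L: "0 < L" by (simp add: L_def)
  \<comment> \<open>The first bound makes \<open>a * (1 + 2 * m / \<theta>)\<close> at most
    \<alpha>, the second makes \<open>m\<close> at most the logarithm of \<open>n\<close> to base
    32, so that at least one level fits.\<close>
  define b where "b = min (\<theta> / (3 * a)) (1 / (C * L))"
  have b: "0 < b" "b \<le> \<theta> / (3 * a)" "b \<le> 1 / (C * L)" using \<theta> a C L by (auto simp: b_def)
  \<comment> \<open>Chosen for the case of large \<alpha>: rounding \<open>b * \<alpha>\<close> to
    \<open>m\<close> and the depth to \<open>K\<close> costs a factor 2 each, and
    \<open>32 * 16 = 512\<close> collects the constants of the layer and distortion bounds.\<close>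
  define c where "c = \<theta> * sqrt (b / (4 * L)) / 512"
  have c: "0 < c" using \<theta> b L by (simp add: c_def)
  have "\<exists>(X :: nat set) d. Metric_space X d \<and> finite X \<and> card X = n \<and>
      every_scale_embeds X d \<alpha> \<and> requires_Euclidean_distortion X d (c * sqrt (\<alpha> * ln (real n)))"
    if n: "32 \<le> n" and \<alpha>: "a \<le> \<alpha>" "\<alpha> \<le> C * ln (real n)" for n \<alpha>
  proof -
    define q where "q = ln (real n) / L"
    have q1: "1 \<le> q" using n L by (simp add: q_def L_def)
    have lnq: "ln (real n) = q * L" using L by (simp add: q_def)
    have "0 < \<alpha>" using a \<alpha> by simp
    have c2: "(c * sqrt (\<alpha> * ln (real n)))\<^sup>2 = \<theta>\<^sup>2 * (b * \<alpha>) * q / 1048576"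
    proof -
      have "(c * sqrt (\<alpha> * ln (real n)))\<^sup>2 = \<theta>\<^sup>2 * (b / (4 * L)) / 512\<^sup>2 * (\<alpha> * (q * L))"
        using b L \<open>0 < \<alpha>\<close> q1 by (simp add: c_def power_mult_distrib power_divide lnq)
      also have "\<dots> = \<theta>\<^sup>2 * (b * \<alpha>) * q / 1048576" using L by simp
      finally show ?thesis .
    qed
    have final: ?thesis
      if G: "gadget m g" and K: "0 < K" "32 ^ (m * K) \<le> n" and \<zeta>: "0 \<le> \<zeta>" "\<zeta> \<le> 1"
        and A: "1 \<le> A" "\<zeta> * (1 + real (2 * m) / \<theta>) \<le> A" "a * A \<le> \<alpha>" and \<Delta>: "0 \<le> \<Delta>"
        and layer: "4 ^ m * \<Delta>\<^sup>2 \<le> (\<Sum>v\<in>gadget.V m. \<Sum>v'\<in>gadget.V m.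
            (max (\<theta> * of_bool (v \<noteq> v')) (\<zeta> * gadget.nrm m g (sym_diff v v')))\<^sup>2)"
        and big: "\<theta>\<^sup>2 * (b * \<alpha>) * q / 1048576 \<le> K * \<Delta>\<^sup>2 / 256"
      for m K g \<zeta> A \<Delta>
    proof -
      interpret gadget m K g by (rule G)
      obtain X :: "nat set" and d where X: "Metric_space X d" "finite X" "card X = n"
        "every_scale_embeds X d (a * A)" "requires_Euclidean_distortion X d (sqrt K * \<Delta> / 16)"
        using ex_space[OF K \<theta> \<zeta> A(1,2) S _ ratio layer] a by auto
      have "every_scale_embeds X d \<alpha>"
        using X(4) A a by (intro every_scale_embeds_mono[OF X(4)]) auto
      moreover have "(c * sqrt (\<alpha> * ln (real n)))\<^sup>2 \<le> (sqrt K * \<Delta> / 16)\<^sup>2"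
        unfolding c2 using big by (simp add: power_mult_distrib power_divide)
      then have "c * sqrt (\<alpha> * ln (real n)) \<le> sqrt K * \<Delta> / 16"
        by (rule power2_le_imp_le) (use \<Delta> in simp)
      then have "requires_Euclidean_distortion X d (c * sqrt (\<alpha> * ln (real n)))"
        by (rule requires_Euclidean_distortion_mono[OF X(5)])
      ultimately show ?thesis using X by blast
    qed
    \<comment> \<open>Below \<open>1 / b\<close> the parameter \<alpha> is bounded, so a bound of
      order \<open>sqrt (ln n)\<close> suffices and \<open>m = 1\<close> with the discrete layers
      gives it without any loss beyond \<open>a\<close>.\<close>
    show ?thesis
    proof (cases "b * \<alpha> < 1")
      case True
      obtain g where G: "gadget 1 g" using ex_gadget[of 1] by auto
      have "real 1 \<le> ln (real n) / ln 32" using q1 by (simp add: q_def L_def)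
      then obtain K where K: "0 < K" "32 ^ (1 * K) \<le> n" "q \<le> 2 * (real 1 * real K)"
        using ex_depth[of 1 n] unfolding q_def L_def by auto
      have "\<theta>\<^sup>2 * (b * \<alpha>) * q / 1048576 \<le> \<theta>\<^sup>2 * 1 * (2 * K) / 1048576"
        using True K q1 b \<open>0 < \<alpha>\<close> by (intro divide_right_mono mult_mono) auto
      also have "\<dots> \<le> K * (\<theta> / 2)\<^sup>2 / 256" by (simp add: power_divide)
      finally show ?thesis
        using gadget.layer_discrete[OF G, of \<theta>] \<theta> \<alpha>
        by (intro final[OF G K(1,2), of 0 1 "\<theta> / 2"]) auto
    next
      case False
      define m where "m = nat \<lfloor>b * \<alpha>\<rfloor>"
      have m: "real m \<le> b * \<alpha>" "b * \<alpha> < real m + 1" "1 \<le> m"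
        using False by (auto simp: m_def le_nat_floor)
      obtain g where G: "gadget m g" using ex_gadget[of m] m(3) by auto
      have "b * \<alpha> \<le> 1 / (C * L) * (C * ln (real n))"
        using b \<alpha> C L \<open>0 < \<alpha>\<close> by (intro mult_mono) auto
      also have "\<dots> = q" using C by (simp add: q_def)
      finally have "real m \<le> ln (real n) / ln 32" using m(1) by (simp add: q_def L_def)
      then obtain K where K: "0 < K" "32 ^ (m * K) \<le> n" "q \<le> 2 * (real m * real K)"
        using ex_depth[of m n] m(3) unfolding q_def L_def by auto
      define A where "A = 1 + real (2 * m) / \<theta>"
      have "a * A \<le> \<alpha>"
      proof -
        have "1 \<le> m / \<theta>" using \<theta> m(3) by (simp add: pos_le_divide_eq)
        then have "A \<le> 3 * (m / \<theta>)" by (simp add: A_def)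
        also have "\<dots> \<le> 3 * (b * \<alpha> / \<theta>)" using m(1) \<theta> by (intro mult_left_mono divide_right_mono) auto
        finally have "a * A \<le> a * (3 * (b * \<alpha> / \<theta>))" using a by (intro mult_left_mono) auto
        also have "\<dots> = (3 * a / \<theta> * b) * \<alpha>" by simp
        also have "\<dots> \<le> 1 * \<alpha>"
          using b(2) a \<theta> \<open>0 < \<alpha>\<close> by (intro mult_right_mono) (auto simp: field_simps)
        finally show ?thesis by simp
      qed
      moreover have "\<theta>\<^sup>2 * (b * \<alpha>) * q / 1048576 \<le> K * (real m / 32)\<^sup>2 / 256"
      proof -
        have "b * \<alpha> \<le> 2 * real m" "\<theta>\<^sup>2 \<le> 1"
          using m \<theta> by (simp_all add: power_le_one)
        then have "\<theta>\<^sup>2 * (b * \<alpha>) \<le> 1 * (2 * real m)"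
          by (intro mult_mono[of "\<theta>\<^sup>2" 1 "b * \<alpha>"]) (use b \<open>0 < \<alpha>\<close> in simp_all)
        then have "\<theta>\<^sup>2 * (b * \<alpha>) * q \<le> 1 * (2 * real m) * (2 * (real m * real K))"
          by (rule mult_mono[OF _ K(3)]) (use q1 in auto)
        then show ?thesis by (simp add: power_divide power2_eq_square mult_ac)
      qed
      ultimately show ?thesis
        using gadget.layer_word[OF G, of \<theta>] \<theta>
        by (intro final[OF G K(1,2), of 1 A "real m / 32"]) (auto simp: A_def)
    qed
  qed
  then show ?thesis using c by blast
qed

theorem mainTheorem2:
  shows "(\<forall>a::real. a > 1 \<longrightarrow>
            (\<exists>c::real. c > 0 \<and>
               (\<forall>\<alpha>::real. \<alpha> \<ge> a \<longrightarrow>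
                  (\<forall>\<^sub>F n::nat in sequentially.
                     \<exists>(X::nat set) (d::nat \<Rightarrow> nat \<Rightarrow> real).
                       Metric_space X d \<and> finite X \<and> card X = n \<and>
                       every_scale_embeds X d \<alpha> \<and>
                       requires_Euclidean_distortion X d (c * sqrt (\<alpha> * ln (real n))))))) \<and>
         (\<forall>\<alpha>::nat \<Rightarrow> real. \<alpha> \<in> O(\<lambda>n. ln (real n)) \<longrightarrow>
            (\<exists>a>1. \<forall>\<^sub>F n in sequentially. \<alpha> n \<ge> a) \<longrightarrow>
            (\<exists>c::real. c > 0 \<and>
               (\<forall>\<^sub>F n::nat in sequentially.
                  \<exists>(X::nat set) (d::nat \<Rightarrow> nat \<Rightarrow> real).
                    Metric_space X d \<and> finite X \<and> card X = n \<and>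
                    every_scale_embeds X d (\<alpha> n) \<and>
                    requires_Euclidean_distortion X d (c * sqrt (\<alpha> n * ln (real n))))))"
proof (intro conjI allI impI)
  fix a :: real assume "a > 1"
  \<comment> \<open>\<open>C = 1\<close> is enough: a fixed \<alpha> is eventually at most
    \<open>ln n\<close>, and \<open>c\<close> is obtained before \<alpha> is chosen.\<close>
  from tight_spaces_uniform[OF this zero_less_one]
  obtain c :: real where c: "c > 0" and
    ex: "\<And>n \<alpha>. \<lbrakk>32 \<le> n; a \<le> \<alpha>; \<alpha> \<le> ln (real n)\<rbrakk> \<Longrightarrow>
      \<exists>(X :: nat set) d. Metric_space X d \<and> finite X \<and> card X = n \<and>
        every_scale_embeds X d \<alpha> \<and> requires_Euclidean_distortion X d (c * sqrt (\<alpha> * ln (real n)))"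
    by (metis mult_1)
  have "\<forall>\<^sub>F n in sequentially. \<exists>(X :: nat set) d. Metric_space X d \<and> finite X \<and> card X = n \<and>
        every_scale_embeds X d \<alpha> \<and> requires_Euclidean_distortion X d (c * sqrt (\<alpha> * ln (real n)))"
    if "\<alpha> \<ge> a" for \<alpha>
  proof -
    have "filterlim (\<lambda>n. ln (real n)) at_top sequentially"
      by (rule filterlim_compose[OF ln_at_top filterlim_real_sequentially])
    then have "\<forall>\<^sub>F n in sequentially. \<alpha> \<le> ln (real n)" by (simp add: filterlim_at_top)
    with eventually_ge_at_top[of 32] show ?thesis
      by eventually_elim (rule ex[OF _ that])
  qed
  with c show "\<exists>c>0. \<forall>\<alpha>\<ge>a. \<forall>\<^sub>F n in sequentially. \<exists>(X :: nat set) d.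
      Metric_space X d \<and> finite X \<and> card X = n \<and> every_scale_embeds X d \<alpha> \<and>
      requires_Euclidean_distortion X d (c * sqrt (\<alpha> * ln (real n)))"
    by blast
next
  fix \<alpha> :: "nat \<Rightarrow> real"
  assume "\<alpha> \<in> O(\<lambda>n. ln (real n))" and "\<exists>a>1. \<forall>\<^sub>F n in sequentially. \<alpha> n \<ge> a"
  then obtain a C where a: "a > 1" "\<forall>\<^sub>F n in sequentially. \<alpha> n \<ge> a"
    and C: "C > 0" "\<forall>\<^sub>F n in sequentially. norm (\<alpha> n) \<le> C * norm (ln (real n))"
    by (elim exE conjE landau_o.bigE)
  from tight_spaces_uniform[OF a(1) C(1)]
  obtain c :: real where c: "c > 0" and
    ex: "\<And>n \<alpha>. \<lbrakk>32 \<le> n; a \<le> \<alpha>; \<alpha> \<le> C * ln (real n)\<rbrakk> \<Longrightarrow>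
      \<exists>(X :: nat set) d. Metric_space X d \<and> finite X \<and> card X = n \<and>
        every_scale_embeds X d \<alpha> \<and> requires_Euclidean_distortion X d (c * sqrt (\<alpha> * ln (real n)))"
    by blast
  from a(2) C(2) eventually_ge_at_top[of 32]
  have "\<forall>\<^sub>F n in sequentially. \<exists>(X :: nat set) d. Metric_space X d \<and> finite X \<and> card X = n \<and>
        every_scale_embeds X d (\<alpha> n) \<and> requires_Euclidean_distortion X d (c * sqrt (\<alpha> n * ln (real n)))"
  proof eventually_elim
    case (elim n)
    then have "0 \<le> ln (real n)" by simp
    with elim show ?case by (intro ex) auto
  qed
  with c show "\<exists>c>0. \<forall>\<^sub>F n in sequentially. \<exists>(X :: nat set) d.
      Metric_space X d \<and> finite X \<and> card X = n \<and> every_scale_embeds X d (\<alpha> n) \<and>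
      requires_Euclidean_distortion X d (c * sqrt (\<alpha> n * ln (real n)))"
    by blast
qed

end
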